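(* For every $n\in\mathbb{N}$ (i.e. $n\ge 1$), the following identity holds in $\mathbb{C}[[t_1,\dots,t_n]]$: $$Z_{\mathrm{EMS}}(t_1,\dots,t_n)=\prod_{i=1}^{n}\frac{1-e^{-t_i-\cdots-t_n}}{t_i+\cdots+t_n}\cdot Z_{\mathrm{FKMT}}(-t_1,\dots,-t_n),$$ where $Z_{\mathrm{EMS}}$ and $Z_{\mathrm{FKMT}}$ are the generating functions of the renormalized values $\zeta_{\mathrm{EMS}}(-k_1,\dots,-k_n)$ and of the desingularized values $\zeta_{\mathrm{FKMT}}(-k_1,\dots,-k_n)$, respectively, and $\frac{1-e^{-u}}{u}$ denotes the power series $\sum_{m\ge0}\frac{(-u)^m}{(m+1)!}$ evaluated at $u=t_i+\cdots+t_n$.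
   Context: $\mathbb{N}=\{1,2,\dots\}$, $\mathbb{N}_0=\{0,1,2,\dots\}$. **Generating functions.** $$Z_{\bullet}(t_1,\dots,t_n):=\sum_{k_1,\dots,k_n=0}^{\infty}\frac{(-t_1)^{k_1}\cdots(-t_n)^{k_n}}{k_1!\cdots k_n!}\,\zeta_{\bullet}(-k_1,\dots,-k_n)\in\mathbb{C}[[t_1,\dots,t_n]],\qquad \bullet\in\{\mathrm{FKMT},\mathrm{EMS}\}.$$ **Desingularized values.** The desingularized multiple zeta function $\zeta_{\mathrm{FKMT}}(s_1,\dots,s_n)$ is defined for non-integral complex $s_1,\dots,s_n$ by $$\zeta_{\mathrm{FKMT}}(s_1,\dots,s_n):=\lim_{c\to1,\ c\in\mathbb{R}\setminus\{1\}}\frac{1}{(1-c)^n}\prod_{k=1}^n\frac{1}{(e^{2\pi i s_k}-1)\Gamma(s_k)}\int_{\mathcal{C}^n}\tilde{\mathfrak{H}}_n(t_1,\dots,t_n;c)\prod_{k=1}^n t_k^{s_k-1}\,dt_k,$$ $$\tilde{\mathfrak{H}}_n(t_1,\dots,t_n;c):=\prod_{j=1}^n\left(\frac{1}{\exp(\sum_{k=j}^n t_k)-1}-\frac{c}{\exp(c\sum_{k=j}^n t_k)-1}\right),$$ where $\mathcal{C}$ is the path consisting of the positive real axis (top side, traversed from $+\infty$), a circle around the origin of sufficiently small radius $\varepsilon$ (counterclockwise), and the positive real axis (bottom side, back to $+\infty$), with $\arg t=0$ on the top side and $\arg t=2\pi$ on the bottom side. It is known (Furusho–Komori–Matsumoto–Tsumura)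 that this extends to an entire function on $\mathbb{C}^n$, the extension being given by the same formula with the limit taken inside the integral factor by factor (each $j$-th factor being multiplied by $\frac1{1-c}$). The desingularized value $\zeta_{\mathrm{FKMT}}(-k_1,\dots,-k_n)$, $k_i\in\mathbb{N}_0$, is the value of this entire function at $(-k_1,\dots,-k_n)$. **Renormalized values.** Let $L=\{d,y\}$, let $L^*$ be the free monoid on $L$ with unit the empty word $\mathbf{1}$, and $\mathbb{Q}\langle L\rangle$ the $\mathbb{Q}$-span of $L^*$. Put $Y:=L^*y\cup\{\mathbf{1}\}$. Define a $\mathbb{Q}$-bilinear product $\sqcup\!\sqcup_0$ on $\mathbb{Q}\langle L\rangle$ recursively, for words $u,v,w\in L^*$, by $\mathbf 1\sqcup\!\sqcup_0 w=w\sqcup\!\sqcup_0\mathbf 1=w$; $\ yu\sqcup\!\sqcup_0 v=u\sqcup\!\sqcup_0 yv=y(u\sqcup\!\sqcup_0 v)$; $\ du\sqcup\!\sqcup_0 dv=d(u\sqcup\!\sqcup_0 dv)-u\sqcup\!\sqcup_0 d^2v$. Let $\mathcal{T}_-$ be the linear span of $\{wd\mid w\in L^*\}$; let $\mathcal{L}_-$ be the two-sided ideal of $(\mathbb{Q}\langle L\rangle,\sqcup\!\sqcup_0)$ generated by all $d^k\{d(u\sqcup\!\sqcup_0 v)-du\sqcup\!\sqcup_0 v-u\sqcup\!\sqcup_0 dv\}$ with $k\in\mathbb{N}_0$, $u,v\in L^*$; put $\mathcal{S}_-:=\mathcal{T}_-+\mathcal{L}_-$ (a two-sided ideal) and $\mathcal{H}_0:=\mathbb{Q}\langle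 L\rangle/\mathcal{S}_-$. It is known (Ebrahimi-Fard–Manchon–Singer) that $\mathcal{H}_0$ is a connected filtered commutative and cocommutative Hopf algebra with product $\sqcup\!\sqcup_0$ and coproduct given, for $w=x_1\cdots x_N\in Y\setminus\{\mathbf 1\}$ ($x_i\in L$), by $\Delta_0(w)=\sum_{S}w_S\otimes w_{\overline S}$, the sum being over all $S\subset\{1,\dots,N\}$ (possibly empty) such that $w_S,w_{\overline S}\in Y$, where $\overline S$ is the complement of $S$ and $w_S:=x_{i_1}\cdots x_{i_r}$ for $S=\{i_1<\cdots<i_r\}$. The counit $\varepsilon$ satisfies $\varepsilon(\mathbf 1)=1$ and $\varepsilon(w)=0$ for $w\in Y\setminus\{\mathbf 1\}$. Let $\mathcal{A}:=\mathbb{Q}[[z]][\frac1z]=\mathcal{A}_-\oplus\mathcal{A}_+$ with $\mathcal{A}_-=\frac1z\mathbb{Q}[\frac1z]$, $\mathcal{A}_+=\mathbb{Q}[[z]]$. For linear maps $\alpha,\beta:\mathcal{H}_0\to\mathcal{A}$ the convolution is $\alpha*\beta:=m_{\mathcal{A}}\circ(\alpha\otimes\beta)\circ\Delta_0$; the linear maps with $\mathbf 1\mapsto1$ form a group under $*$. Let $\phi:\mathcal{H}_0\to\mathcal{A}$ be the linear map with $\phi(\mathbf 1)=1$ and $\phi(d^{k_1}y\cdots d^{k_n}y)(z)=\partial_z^{k_1}(x\partial_z^{k_2})\cdots(x\partial_z^{k_n})(x)$, $x=x(z)=\frac{e^z}{1-e^z}$ (known to be a well-defined algebra homomorphism). By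 the algebraic Birkhoff decomposition there are unique linear maps $\phi_+:\mathcal{H}_0\to\mathcal{A}_+$ and $\phi_-:\mathcal{H}_0\to\mathbb{Q}\oplus\mathcal{A}_-$ with $\phi_-(\mathbf 1)=1$, $\phi_-(\ker\varepsilon)\subset\mathcal{A}_-$ and $\phi=\phi_-^{-1}*\phi_+$ (inverse with respect to $*$); both are algebra homomorphisms. The renormalized value is $$\zeta_{\mathrm{EMS}}(-k_1,\dots,-k_n):=\lim_{z\to0}\phi_+(d^{k_n}y\cdots d^{k_1}y)(z)\qquad(k_1,\dots,k_n\in\mathbb{N}_0).$$ *)

theory Defs
  imports
    "HOL-Complex_Analysis.Complex_Analysis"
    "HOL-Computational_Algebra.Formal_Laurent_Series"
    "HOL-Library.Poly_Mapping"
begin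

section \<open>Multivariate formal power series\<close>

text \<open>
  A monomial \<open>t\<^sub>1^m\<^sub>1 \<cdots> t\<^sub>n^m\<^sub>n\<close> is a finitely supported exponent map \<open>nat \<Rightarrow>\<^sub>0 nat\<close>, and a power series is an
  arbitrary coefficient map on monomials.  The variables are \<open>t\<^sub>i\<close> for all natural numbers \<open>i\<close>; the
  ring of power series in \<open>t\<^sub>1, \<dots>, t\<^sub>n\<close> is the subring of those series whose coefficients vanish at
  every monomial involving a variable outside \<open>{1..n}\<close>.
\<close>

typedef 'a mps = "UNIV :: ((nat \<Rightarrow>\<^sub>0 nat) \<Rightarrow> 'a) set"
  morphisms mps_coeff Abs_mps ..

setup_lifting type_definition_mps

lemma mps_eqI: "(\<And>m. mps_coeff f m = mps_coeff g m) \<Longrightarrow> f = g"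
  by (metis mps_coeff_inject ext)

definition splits :: "(nat \<Rightarrow>\<^sub>0 nat) \<Rightarrow> ((nat \<Rightarrow>\<^sub>0 nat) \<times> (nat \<Rightarrow>\<^sub>0 nat)) set" where
  "splits m = {(a, b). a + b = m}"

lemma finite_splits [simp]: "finite (splits m)"
proof -
  let ?B = "{f. \<forall>x. (x \<in> Poly_Mapping.keys m \<longrightarrow> f x \<in> {..Max (Poly_Mapping.lookup m ` Poly_Mapping.keys m)}) \<and> (x \<notin> Poly_Mapping.keys m \<longrightarrow> f x = (0::nat))}"
  have fB: "finite ?B"
    by (rule finite_set_of_finite_funs) auto
  have le: "Poly_Mapping.lookup a x \<le> Poly_Mapping.lookup m x" if "a + b = m" for a b x
    using that by (auto simp: lookup_add)
  have inB: "Poly_Mapping.lookup a \<in> ?B" if "a + b = m" for a b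
  proof -
    have "Poly_Mapping.lookup a x \<le> Max (Poly_Mapping.lookup m ` Poly_Mapping.keys m)" if "x \<in> Poly_Mapping.keys m" for x
      using le[OF \<open>a + b = m\<close>, of x] that by (meson Max_ge finite_imageI finite_keys imageI order_trans)
    moreover have "Poly_Mapping.lookup a x = 0" if "x \<notin> Poly_Mapping.keys m" for x
      using le[OF \<open>a + b = m\<close>, of x] that by (simp add: in_keys_iff)
    ultimately show ?thesis by auto
  qed
  have "finite {a. Poly_Mapping.lookup a \<in> ?B}"
    using finite_vimageI[OF fB, of Poly_Mapping.lookup] by (simp add: inj_def lookup_inject vimage_def)
  moreover have "splits m \<subseteq> (\<lambda>a. (a, m - a)) ` {a. Poly_Mapping.lookup a \<in> ?B}"
    using inB by (force simp: splits_def)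
  ultimately show ?thesis
    by (meson finite_imageI finite_subset)
qed

instantiation mps :: (comm_ring_1) comm_ring_1
begin

lift_definition zero_mps :: "'a mps" is "\<lambda>_. 0" .
lift_definition one_mps :: "'a mps" is "\<lambda>m. if m = 0 then 1 else 0" .
lift_definition plus_mps :: "'a mps \<Rightarrow> 'a mps \<Rightarrow> 'a mps" is "\<lambda>f g m. f m + g m" .
lift_definition minus_mps :: "'a mps \<Rightarrow> 'a mps \<Rightarrow> 'a mps" is "\<lambda>f g m. f m - g m" .
lift_definition uminus_mps :: "'a mps \<Rightarrow> 'a mps" is "\<lambda>f m. - f m" .
lift_definition times_mps :: "'a mps \<Rightarrow> 'a mps \<Rightarrow> 'a mps" is
  "\<lambda>f g m. \<Sum>(a, b)\<in>splits m. f a * g b" .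

instance
proof
  fix f g h :: "'a mps"
  show "f * g * h = f * (g * h)"
  proof (transfer, rule ext)
    fix f g h :: "(nat \<Rightarrow>\<^sub>0 nat) \<Rightarrow> 'a" and m
    have "(\<Sum>(a, b)\<in>splits m. (\<Sum>(c, d)\<in>splits a. f c * g d) * h b)
        = (\<Sum>p\<in>splits m. \<Sum>q\<in>splits (fst p). f (fst q) * g (snd q) * h (snd p))"
      by (simp add: case_prod_unfold sum_distrib_right)
    also have "\<dots> = (\<Sum>(p, q)\<in>Sigma (splits m) (\<lambda>p. splits (fst p)). f (fst q) * g (snd q) * h (snd p))"
      by (simp add: sum.Sigma)
    also have "\<dots> = (\<Sum>(p, q)\<in>Sigma (splits m) (\<lambda>p. splits (snd p)). f (fst p) * (g (fst q) * h (snd q)))"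
      by (rule sum.reindex_bij_witness
            [where i = "\<lambda>(p, q). ((fst p + fst q, snd q), (fst p, fst q))"
               and j = "\<lambda>(p, q). ((fst q, snd q + snd p), (snd q, snd p))"])
         (auto simp: splits_def add.assoc mult.assoc)
    also have "\<dots> = (\<Sum>(a, b)\<in>splits m. f a * (\<Sum>(c, d)\<in>splits b. g c * h d))"
      by (simp add: case_prod_unfold sum_distrib_left sum.Sigma)
    finally show "(\<Sum>(a, b)\<in>splits m. (\<Sum>(c, d)\<in>splits a. f c * g d) * h b)
      = (\<Sum>(a, b)\<in>splits m. f a * (\<Sum>(c, d)\<in>splits b. g c * h d))" .
  qed
  show "f * g = g * f"
  proof (transfer, rule ext)
    fix f g :: "(nat \<Rightarrow>\<^sub>0 nat) \<Rightarrow> 'a" and m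
    show "(\<Sum>(a, b)\<in>splits m. f a * g b) = (\<Sum>(a, b)\<in>splits m. g a * f b)"
      by (rule sum.reindex_bij_witness[where i = prod.swap and j = prod.swap])
         (auto simp: splits_def add.commute mult.commute)
  qed
  show "1 * f = f"
  proof (transfer, rule ext)
    fix f :: "(nat \<Rightarrow>\<^sub>0 nat) \<Rightarrow> 'a" and m
    have "(\<Sum>(a, b)\<in>splits m. (if a = 0 then 1 else 0) * f b)
        = (\<Sum>p\<in>{(0 :: nat \<Rightarrow>\<^sub>0 nat, m)}. (if fst p = 0 then 1 else 0) * f (snd p))"
      unfolding case_prod_unfold
      by (rule sum.mono_neutral_right[OF finite_splits]) (auto simp: splits_def)
    then show "(\<Sum>(a, b)\<in>splits m. (if a = 0 then 1 else 0) * f b) = f m" by simp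
  qed
  show "(f + g) * h = f * h + g * h"
    by transfer (auto simp: case_prod_unfold sum.distrib distrib_right)
  show "f + g + h = f + (g + h)" "f + g = g + f" "0 + f = f" "- f + f = 0" "f - g = f + - g"
    by (transfer; simp add: add_ac)+
  show "(0 :: 'a mps) \<noteq> 1"
    by transfer (metis zero_neq_one)
qed

end

lift_definition mps_var :: "nat \<Rightarrow> 'a::comm_ring_1 mps" is
  "\<lambda>i m. if m = Poly_Mapping.single i 1 then 1 else 0" .

definition mdegree :: "(nat \<Rightarrow>\<^sub>0 nat) \<Rightarrow> nat" where
  "mdegree m = (\<Sum>i\<in>Poly_Mapping.keys m. Poly_Mapping.lookup m i)"

text \<open>
  \<open>mps_eval a u\<close> is \<open>\<Sum>j. a\<^sub>j u^j\<close> for a power series \<open>u\<close> without constant term.  For such \<open>u\<close> the power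
  \<open>u^j\<close> has no terms of degree below \<open>j\<close>, so truncating at the degree of the monomial loses nothing
  (compare \<^const>\<open>fps_compose\<close>).
\<close>

definition mps_eval :: "'a::comm_ring_1 fps \<Rightarrow> 'a mps \<Rightarrow> 'a mps" where
  "mps_eval a u = Abs_mps (\<lambda>m. \<Sum>j\<le>mdegree m. fps_nth a j * mps_coeff (u ^ j) m)"

text \<open>The substitution \<open>t\<^sub>i \<mapsto> - t\<^sub>i\<close> for all \<open>i\<close>.\<close>

definition mps_negate_vars :: "'a::comm_ring_1 mps \<Rightarrow> 'a mps" where
  "mps_negate_vars f = Abs_mps (\<lambda>m. (- 1) ^ mdegree m * mps_coeff f m)"

text \<open>
  The series of \<open>(-t\<^sub>1)^k\<^sub>1 \<cdots> (-t\<^sub>n)^k\<^sub>n / (k\<^sub>1! \<cdots> k\<^sub>n!) \<cdot> z k\<close>, where \<open>z k\<close> stands for the zeta value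
  at \<open>(-k\<^sub>1, \<dots>, -k\<^sub>n)\<close>.
\<close>

definition generating_series :: "nat \<Rightarrow> ((nat \<Rightarrow> nat) \<Rightarrow> complex) \<Rightarrow> complex mps" where
  "generating_series n z = Abs_mps (\<lambda>m.
     if Poly_Mapping.keys m \<subseteq> {1..n}
     then (\<Prod>i=1..n. (- 1) ^ Poly_Mapping.lookup m i / fact (Poly_Mapping.lookup m i)) * z (Poly_Mapping.lookup m)
     else 0)"


section \<open>The desingularized multiple zeta function\<close>

text \<open>
  The contour comes in from \<open>+\<infinity>\<close> on the upper side of the positive real axis (parameter \<open>\<tau> \<le> 0\<close>),
  runs once counterclockwise around the circle of radius \<open>\<epsilon>\<close> (\<open>0 \<le> \<tau> \<le> 2 \<pi>\<close>), and returns to \<open>+\<infinity>\<close> on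
  the lower side (\<open>\<tau> \<ge> 2 \<pi>\<close>).  It is described through the branch of its logarithm with argument \<open>0\<close>
  on the upper and \<open>2 \<pi>\<close> on the lower side, which also gives the meaning of \<open>t powr (s - 1)\<close>.
\<close>

definition hankel_log :: "real \<Rightarrow> real \<Rightarrow> complex" where
  "hankel_log \<epsilon> \<tau> =
     (if \<tau> \<le> 0 then of_real (ln (\<epsilon> - \<tau>))
      else if \<tau> \<le> 2 * pi then of_real (ln \<epsilon>) + \<i> * of_real \<tau>
      else of_real (ln (\<epsilon> + (\<tau> - 2 * pi))) + \<i> * of_real (2 * pi))"

definition hankel :: "real \<Rightarrow> real \<Rightarrow> complex" where
  "hankel \<epsilon> \<tau> = exp (hankel_log \<epsilon> \<tau>)"

definition hankel_power :: "real \<Rightarrow> complex \<Rightarrow> real \<Rightarrow> complex" where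
  "hankel_power \<epsilon> w \<tau> = exp (w * hankel_log \<epsilon> \<tau>)"

definition desing_kernel :: "nat \<Rightarrow> real \<Rightarrow> (nat \<Rightarrow> complex) \<Rightarrow> complex" where
  "desing_kernel n c t =
     (\<Prod>j=1..n. 1 / (exp (\<Sum>k=j..n. t k) - 1)
              - of_real c / (exp (of_real c * (\<Sum>k=j..n. t k)) - 1))"

definition contour_power_integral ::
  "real \<Rightarrow> nat \<Rightarrow> ((nat \<Rightarrow> complex) \<Rightarrow> complex) \<Rightarrow> (nat \<Rightarrow> complex) \<Rightarrow> complex" where
  "contour_power_integral \<epsilon> n H s =
     (LINT \<tau> | (\<Pi>\<^sub>M k\<in>{1..n}. lborel).
        H (\<lambda>k. hankel \<epsilon> (\<tau> k)) *
        (\<Prod>k=1..n. hankel_power \<epsilon> (s k - 1) (\<tau> k) * vector_derivative (hankel \<epsilon>) (at (\<tau> k))))"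

definition desing_approx :: "nat \<Rightarrow> (nat \<Rightarrow> complex) \<Rightarrow> real \<Rightarrow> real \<Rightarrow> complex" where
  "desing_approx n s \<epsilon> c =
     1 / (1 - of_real c) ^ n *
     (\<Prod>k=1..n. 1 / ((exp (2 * of_real pi * \<i> * s k) - 1) * Gamma (s k))) *
     contour_power_integral \<epsilon> n (desing_kernel n c) s"

text \<open>
  \<open>\<complex>\<^sup>n\<close> is the set of functions on \<open>{1..n}\<close>, topologized as a subspace of the product topology.
  Entire functions are the continuous functions that are entire in each coordinate.
\<close>

definition Cn :: "nat \<Rightarrow> (nat \<Rightarrow> complex) set" where
  "Cn n = {1..n} \<rightarrow>\<^sub>E UNIV"

definition entire_Cn :: "nat \<Rightarrow> ((nat \<Rightarrow> complex) \<Rightarrow> complex) \<Rightarrow> bool" where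
  "entire_Cn n F \<longleftrightarrow> continuous_on (Cn n) F \<and>
     (\<forall>s\<in>Cn n. \<forall>i\<in>{1..n}. (\<lambda>z. F (s(i := z))) holomorphic_on UNIV)"

text \<open>
  The entire function extending the limit \<open>c \<rightarrow> 1\<close>; the integral does not depend on the radius
  \<open>\<epsilon>\<close> once it is small enough.  The function is fixed to be \<open>undefined\<close> off \<open>\<complex>\<^sup>n\<close> in order to be unique.
\<close>

definition zeta_desing :: "nat \<Rightarrow> (nat \<Rightarrow> complex) \<Rightarrow> complex" where
  "zeta_desing n = (THE F. F \<in> extensional (Cn n) \<and> entire_Cn n F \<and>
     (\<forall>s\<in>Cn n. (\<forall>i\<in>{1..n}. s i \<notin> \<int>) \<longrightarrow>
        (\<forall>\<^sub>F \<epsilon> in at_right 0. (desing_approx n s \<epsilon> \<longlongrightarrow> F s) (at 1))))"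

definition zeta_FKMT :: "nat \<Rightarrow> (nat \<Rightarrow> nat) \<Rightarrow> complex" where
  "zeta_FKMT n k = zeta_desing n (\<lambda>i\<in>{1..n}. - of_nat (k i))"

definition Z_FKMT :: "nat \<Rightarrow> complex mps" where
  "Z_FKMT n = generating_series n (zeta_FKMT n)"


section \<open>The Hopf algebra of renormalization\<close>

subsection \<open>Words and their linear span\<close>

datatype letter = Ltr_d | Ltr_y

type_synonym word_span = "letter list \<Rightarrow>\<^sub>0 rat"

definition Y_words :: "letter list set" where
  "Y_words = {w @ [Ltr_y] | w. True} \<union> {[]}"

abbreviation word :: "letter list \<Rightarrow> word_span" where
  "word w \<equiv> Poly_Mapping.single w 1"

definition ws_scale :: "rat \<Rightarrow> word_span \<Rightarrow> word_span" where
  "ws_scale c p = Poly_Mapping.map ((*) c) p"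

lemma lookup_ws_scale [simp]: "Poly_Mapping.lookup (ws_scale c p) w = c * Poly_Mapping.lookup p w"
  by (simp add: ws_scale_def Poly_Mapping.map.rep_eq when_def)

global_interpretation ws: vector_space ws_scale
  by unfold_locales (auto intro!: poly_mapping_eqI simp: lookup_add algebra_simps)

text \<open>The linear extension of a map on words.\<close>

definition ws_extend :: "(letter list \<Rightarrow> word_span) \<Rightarrow> word_span \<Rightarrow> word_span" where
  "ws_extend f p = (\<Sum>w\<in>Poly_Mapping.keys p. ws_scale (Poly_Mapping.lookup p w) (f w))"

lemma ws_extend_superset:
  assumes "finite A" "Poly_Mapping.keys p \<subseteq> A"
  shows "ws_extend f p = (\<Sum>w\<in>A. ws_scale (Poly_Mapping.lookup p w) (f w))"
  unfolding ws_extend_def using assms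
  by (intro sum.mono_neutral_left) (auto simp: in_keys_iff)

lemma ws_extend_add: "ws_extend f (p + q) = ws_extend f p + ws_extend f q"
proof -
  let ?A = "Poly_Mapping.keys p \<union> Poly_Mapping.keys q"
  have "Poly_Mapping.keys (p + q) \<subseteq> ?A" by (rule Poly_Mapping.keys_add)
  then show ?thesis
    by (simp add: ws_extend_superset[of ?A] lookup_add ws.scale_left_distrib sum.distrib)
qed

lemma ws_extend_scale: "ws_extend f (ws_scale c p) = ws_scale c (ws_extend f p)"
proof -
  have "Poly_Mapping.keys (ws_scale c p) \<subseteq> Poly_Mapping.keys p" by (auto simp: in_keys_iff)
  then show ?thesis
    by (simp add: ws_extend_superset[of "Poly_Mapping.keys p"] ws.scale_sum_right)
qed

lemma ws_extend_word [simp]: "ws_extend f (word w) = f w"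
  by (simp add: ws_extend_def)

definition prefix_letter :: "letter \<Rightarrow> word_span \<Rightarrow> word_span" where
  "prefix_letter a = ws_extend (\<lambda>w. word (a # w))"

lemma prefix_letter_diff: "prefix_letter a (p - q) = prefix_letter a p - prefix_letter a q"
proof -
  have "prefix_letter a (p - q) + prefix_letter a q = prefix_letter a p"
    unfolding prefix_letter_def by (simp flip: ws_extend_add)
  then show ?thesis by (simp add: eq_diff_eq)
qed

lemma prefix_letter_word [simp]: "prefix_letter a (word w) = word (a # w)"
  by (simp add: prefix_letter_def)

subsection \<open>The shuffle product\<close>

text \<open>
  The defining equations overlap; the clauses below are made disjoint, and the lemmas
  \<open>shuffle_words_Nil_right\<close> and \<open>shuffle_words_y_right\<close> recover the remaining equations.
\<close>

fun shuffle_words :: "letter list \<Rightarrow> letter list \<Rightarrow> word_span" where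
  "shuffle_words [] w = word w"
| "shuffle_words (Ltr_y # u) v = prefix_letter Ltr_y (shuffle_words u v)"
| "shuffle_words (Ltr_d # u) [] = word (Ltr_d # u)"
| "shuffle_words (Ltr_d # u) (Ltr_y # v) = prefix_letter Ltr_y (shuffle_words (Ltr_d # u) v)"
| "shuffle_words (Ltr_d # u) (Ltr_d # v) =
     prefix_letter Ltr_d (shuffle_words u (Ltr_d # v)) - shuffle_words u (Ltr_d # Ltr_d # v)"

lemma shuffle_words_Nil_right: "shuffle_words w [] = word w"
proof (induction w)
  case (Cons a w)
  then show ?case by (cases a) auto
qed simp

lemma shuffle_words_y_right:
  "shuffle_words u (Ltr_y # v) = prefix_letter Ltr_y (shuffle_words u v)"
proof (induction u)
  case (Cons a u)
  then show ?case by (cases a) auto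
qed simp

definition shuffle :: "word_span \<Rightarrow> word_span \<Rightarrow> word_span" where
  "shuffle p q = ws_extend (\<lambda>u. ws_extend (\<lambda>v. shuffle_words u v) q) p"

subsection \<open>The quotient space\<close>

definition T_minus :: "word_span set" where
  "T_minus = ws.span {word (w @ [Ltr_d]) | w. True}"

inductive_set L_minus :: "word_span set" where
  generator:
    "(prefix_letter Ltr_d ^^ k)
       (prefix_letter Ltr_d (shuffle (word u) (word v))
        - shuffle (word (Ltr_d # u)) (word v) - shuffle (word u) (word (Ltr_d # v))) \<in> L_minus"
| zero: "0 \<in> L_minus"
| add: "p \<in> L_minus \<Longrightarrow> q \<in> L_minus \<Longrightarrow> p + q \<in> L_minus"
| scale: "p \<in> L_minus \<Longrightarrow> ws_scale c p \<in> L_minus"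
| mult_left: "p \<in> L_minus \<Longrightarrow> shuffle a p \<in> L_minus"
| mult_right: "p \<in> L_minus \<Longrightarrow> shuffle p a \<in> L_minus"

definition S_minus :: "word_span set" where
  "S_minus = {p + q | p q. p \<in> T_minus \<and> q \<in> L_minus}"

lemma subspace_L_minus: "ws.subspace L_minus"
  by (auto simp: ws.subspace_def intro: L_minus.intros)

lemma subspace_S_minus: "ws.subspace S_minus"
  unfolding S_minus_def T_minus_def
  by (rule ws.subspace_sums[OF ws.subspace_span subspace_L_minus])

quotient_type hopf = word_span / "\<lambda>p q. p - q \<in> S_minus"
proof (rule equivpI)
  show "reflp (\<lambda>p q. p - q \<in> S_minus)"
    by (auto simp: reflp_def ws.subspace_0[OF subspace_S_minus])
  show "symp (\<lambda>p q. p - q \<in> S_minus)"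
    using ws.subspace_neg[OF subspace_S_minus] by (force simp: symp_def)
  show "transp (\<lambda>p q. p - q \<in> S_minus)"
    using ws.subspace_add[OF subspace_S_minus] by (force simp: transp_def)
qed

instantiation hopf :: ab_group_add
begin

lift_definition zero_hopf :: hopf is 0 .

lift_definition plus_hopf :: "hopf \<Rightarrow> hopf \<Rightarrow> hopf" is "(+)"
  using ws.subspace_add[OF subspace_S_minus] by (force simp: add_diff_add)

lift_definition uminus_hopf :: "hopf \<Rightarrow> hopf" is uminus
  using ws.subspace_neg[OF subspace_S_minus] by force

lift_definition minus_hopf :: "hopf \<Rightarrow> hopf \<Rightarrow> hopf" is "(-)"
proof -
  fix p p' q q' :: word_span
  assume "p - p' \<in> S_minus" "q - q' \<in> S_minus"
  then have "(p - p') - (q - q') \<in> S_minus"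
    by (rule ws.subspace_diff[OF subspace_S_minus])
  moreover have "(p - p') - (q - q') = (p - q) - (p' - q')" by simp
  ultimately show "(p - q) - (p' - q') \<in> S_minus" by simp
qed

instance
  by standard (transfer, simp add: algebra_simps ws.subspace_0[OF subspace_S_minus])+

end

lift_definition hopf_scale :: "rat \<Rightarrow> hopf \<Rightarrow> hopf" is ws_scale
  using ws.subspace_scale[OF subspace_S_minus] by (force simp flip: ws.scale_right_diff_distrib)

lemma vector_space_hopf_scale: "vector_space hopf_scale"
  by unfold_locales
     (transfer, simp add: ws.subspace_0[OF subspace_S_minus] ws.scale_right_distrib ws.scale_left_distrib)+

lift_definition word_class :: "letter list \<Rightarrow> hopf" is "\<lambda>w. word w" .

subsection \<open>Linear maps and convolution\<close>

definition fls_scale :: "rat \<Rightarrow> rat fls \<Rightarrow> rat fls" where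
  "fls_scale c f = fls_const c * f"

lemma vector_space_fls_scale: "vector_space fls_scale"
  by unfold_locales (simp_all add: fls_scale_def algebra_simps flip: fls_plus_const)

abbreviation linear_fls :: "(hopf \<Rightarrow> rat fls) \<Rightarrow> bool" where
  "linear_fls \<equiv> Vector_Spaces.linear hopf_scale fls_scale"

definition counit :: "hopf \<Rightarrow> rat" where
  "counit = (THE e. Vector_Spaces.linear hopf_scale (*) e \<and> e (word_class []) = 1 \<and>
     (\<forall>w\<in>Y_words - {[]}. e (word_class w) = 0))"

text \<open>
  The indices \<open>S\<close> of the summands \<open>w\<^sub>S \<otimes> w\<^sub>S\<^sub>'\<close> of the coproduct of a word \<open>w\<close>, with \<open>S'\<close> the complement
  of \<open>S\<close>; \<^const>\<open>nths\<close> extracts subwords.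
\<close>

definition coproduct_index :: "letter list \<Rightarrow> nat set set" where
  "coproduct_index w = {S. S \<subseteq> {..<length w} \<and> nths w S \<in> Y_words \<and> nths w ({..<length w} - S) \<in> Y_words}"

text \<open>
  \<open>\<gamma>\<close> is the convolution of \<open>\<alpha>\<close> and \<open>\<beta>\<close>, that is, multiplication after \<open>\<alpha> \<otimes> \<beta>\<close> after the coproduct.
  Since the classes of the words in \<open>Y\<close> span the quotient, the formula determines the linear map \<open>\<gamma>\<close>.
\<close>

definition is_convolution ::
  "(hopf \<Rightarrow> rat fls) \<Rightarrow> (hopf \<Rightarrow> rat fls) \<Rightarrow> (hopf \<Rightarrow> rat fls) \<Rightarrow> bool" where
  "is_convolution \<alpha> \<beta> \<gamma> \<longleftrightarrow> linear_fls \<gamma> \<and>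
     (\<forall>w\<in>Y_words. \<gamma> (word_class w) =
        (\<Sum>S\<in>coproduct_index w.
           \<alpha> (word_class (nths w S)) * \<beta> (word_class (nths w ({..<length w} - S)))))"

text \<open>The neutral element for convolution is \<open>h \<mapsto> counit h \<cdot> 1\<close>.\<close>

definition is_convolution_inverse :: "(hopf \<Rightarrow> rat fls) \<Rightarrow> (hopf \<Rightarrow> rat fls) \<Rightarrow> bool" where
  "is_convolution_inverse \<alpha> \<beta> \<longleftrightarrow> linear_fls \<alpha> \<and> linear_fls \<beta> \<and>
     is_convolution \<alpha> \<beta> (\<lambda>h. fls_const (counit h)) \<and>
     is_convolution \<beta> \<alpha> (\<lambda>h. fls_const (counit h))"

subsection \<open>Birkhoff decomposition and renormalized values\<close>

definition A_plus :: "rat fls set" where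
  "A_plus = range fps_to_fls"

text \<open>Laurent series have finite principal part, so this is \<open>1/z \<rat>[1/z]\<close>.\<close>

definition A_minus :: "rat fls set" where
  "A_minus = {f. \<forall>n\<ge>0. fls_nth f n = 0}"

definition x_series :: "rat fls" where
  "x_series = fps_to_fls (fps_exp 1) / (1 - fps_to_fls (fps_exp 1))"

text \<open>The word \<open>d^k\<^sub>1 y \<cdots> d^k\<^sub>n y\<close> for the list \<open>[k\<^sub>1, \<dots>, k\<^sub>n]\<close>.\<close>

definition dy_word :: "nat list \<Rightarrow> letter list" where
  "dy_word ks = concat (map (\<lambda>k. replicate k Ltr_d @ [Ltr_y]) ks)"

fun phi_value :: "nat list \<Rightarrow> rat fls" where
  "phi_value [] = 1"
| "phi_value (k # ks) = (fls_deriv ^^ k) (x_series * phi_value ks)"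

definition phi :: "hopf \<Rightarrow> rat fls" where
  "phi = (THE f. linear_fls f \<and> (\<forall>ks. f (word_class (dy_word ks)) = phi_value ks))"

definition is_birkhoff_decomposition :: "(hopf \<Rightarrow> rat fls) \<Rightarrow> (hopf \<Rightarrow> rat fls) \<Rightarrow> bool" where
  "is_birkhoff_decomposition \<phi>\<^sub>m \<phi>\<^sub>p \<longleftrightarrow>
     linear_fls \<phi>\<^sub>m \<and> linear_fls \<phi>\<^sub>p \<and>
     range \<phi>\<^sub>p \<subseteq> A_plus \<and>
     range \<phi>\<^sub>m \<subseteq> {fls_const c + a | c a. a \<in> A_minus} \<and>
     \<phi>\<^sub>m (word_class []) = 1 \<and> (\<forall>h. counit h = 0 \<longrightarrow> \<phi>\<^sub>m h \<in> A_minus) \<and>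
     (\<exists>\<psi>. is_convolution_inverse \<phi>\<^sub>m \<psi> \<and> is_convolution \<psi> \<phi>\<^sub>p phi)"

definition phi_plus :: "hopf \<Rightarrow> rat fls" where
  "phi_plus = (THE \<phi>\<^sub>p. \<exists>\<phi>\<^sub>m. is_birkhoff_decomposition \<phi>\<^sub>m \<phi>\<^sub>p)"

text \<open>
  The renormalized value at \<open>(-k\<^sub>1, \<dots>, -k\<^sub>n)\<close>: note the reversed order in the word.  The limit \<open>z \<rightarrow> 0\<close> of
  a series without principal part is its constant coefficient.
\<close>

definition zeta_EMS :: "nat \<Rightarrow> (nat \<Rightarrow> nat) \<Rightarrow> complex" where
  "zeta_EMS n k = of_rat (fls_nth (phi_plus (word_class (dy_word (rev (map k [1..<Suc n]))))) 0)"

definition Z_EMS :: "nat \<Rightarrow> complex mps" where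
  "Z_EMS n = generating_series n (zeta_EMS n)"

end

(*
  EMS side.  In the quotient Hopf algebra d is a derivation for the shuffle product and y acts as
  multiplication by y, so every element x of a differential algebra defines a character: read a
  word as a composite of operators, d as differentiation and y as multiplication by x, and apply
  it to 1.  Convolution of two such characters adds the elements x.  Hence the Birkhoff
  decomposition of phi is the splitting e^z/(1-e^z) = X - 1/z with X regular, phi_+ is the
  character of X, and Taylor's formula gives Z_EMS(t) = prod_i X(-(t_i + ... + t_n)).

  FKMT side.  As c tends to 1, the kernel becomes prod_j h(t_j + ... + t_n) for
  h(u) = (e^u - 1 - u e^u)/(e^u - 1)^2, which is holomorphic near the half-axis.  On functions g
  holomorphic near 0, the Hankel functional 1/((e^(2 pi i s) - 1) Gamma(s)) int g(t) t^(s-1) dt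
  is the same as the integral of g against a density w_s on a ray and a circle, and w_s is entire
  in s.  Replacing the contour coordinate by coordinate gives the entire extension; at s = -k only
  the circle survives and Cauchy's formula returns (-1)^k g^(k)(0).  Hence
  Z_FKMT(t) = prod_i h(t_i + ... + t_n), and X(-u) = ((1 - e^(-u))/u) h(-u) is an identity of
  power series.
*)
theory Submission
  imports Defs
begin

section \<open>Characters of the Hopf algebra\<close>

text \<open>\<open>zeta_desing\<close> and \<open>phi_plus\<close> are THE descriptions, so
  existence and uniqueness come before any evaluation; the prefactor of the contour integral is
  meaningless at integers, where values are reached only through the entire extension. The tail sums
  t_j + ... + t_n can vanish on the product of contours, where \<open>x / 0 = 0\<close> makes the
  kernel jump; this is repaired one coordinate at a time, as a null set. The radius 1/(n+1) keeps
  all tail sums where the kernel bounds hold, and the ray begins at half that radius so that the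
  series for the density on the circle converges like 2^(-m). The decay rates form a budget (up to
  constants): T e^(-T) is bounded by e^(-T/2), scaling T by c > 1/2 leaves e^(-T/4), the powers
  t^(s-1) cost e^(t/8), and e^(-|x|/8) remains for integrability. Only the factor j = 1 contains all
  variables, so it alone supplies this decay. On both sides the coefficients are nested Taylor
  coefficients: extracting t_1, t_2, ... in turn from a product of series in tail sums gives the
  same recursion as the blocks d^k y and as successive circle integrals.\<close>

fun op_value :: "rat fls \<Rightarrow> letter list \<Rightarrow> rat fls" where
  "op_value x [] = 1"
| "op_value x (Ltr_d # w) = fls_deriv (op_value x w)"
| "op_value x (Ltr_y # w) = x * op_value x w"

definition op_eval :: "rat fls \<Rightarrow> word_span \<Rightarrow> rat fls" where
  "op_eval x p = (\<Sum>w\<in>Poly_Mapping.keys p. fls_const (Poly_Mapping.lookup p w) * op_value x w)"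

lemma op_eval_superset:
  assumes "finite A" "Poly_Mapping.keys p \<subseteq> A"
  shows "op_eval x p = (\<Sum>w\<in>A. fls_const (Poly_Mapping.lookup p w) * op_value x w)"
  unfolding op_eval_def using assms
  by (intro sum.mono_neutral_left) (auto simp: in_keys_iff)

lemma op_eval_add: "op_eval x (p + q) = op_eval x p + op_eval x q"
proof -
  let ?A = "Poly_Mapping.keys p \<union> Poly_Mapping.keys q"
  have "Poly_Mapping.keys (p + q) \<subseteq> ?A" by (rule Poly_Mapping.keys_add)
  then show ?thesis
    by (simp add: op_eval_superset[of ?A] lookup_add sum.distrib distrib_right flip: fls_plus_const)
qed

lemma op_eval_scale: "op_eval x (ws_scale c p) = fls_const c * op_eval x p"
proof -
  have "Poly_Mapping.keys (ws_scale c p) \<subseteq> Poly_Mapping.keys p" by (auto simp: in_keys_iff)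
  then show ?thesis
    by (simp add: op_eval_superset[of "Poly_Mapping.keys p"] sum_distrib_left mult.assoc
        flip: fls_const_mult_const)
qed

lemma op_eval_word [simp]: "op_eval x (word w) = op_value x w"
  by (simp add: op_eval_def)

lemma op_eval_0 [simp]: "op_eval x 0 = 0"
  by (simp add: op_eval_def)

lemma op_eval_diff: "op_eval x (p - q) = op_eval x p - op_eval x q"
  using op_eval_add[of x "p - q" q] by simp

lemma op_eval_sum: "op_eval x (sum f A) = (\<Sum>a\<in>A. op_eval x (f a))"
  by (induction A rule: infinite_finite_induct) (auto simp: op_eval_add)

lemma op_eval_extend:
  "op_eval x (ws_extend f p) =
     (\<Sum>w\<in>Poly_Mapping.keys p. fls_const (Poly_Mapping.lookup p w) * op_eval x (f w))"
  by (simp add: ws_extend_def op_eval_sum op_eval_scale)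

lemma op_eval_prefix_d: "op_eval x (prefix_letter Ltr_d p) = fls_deriv (op_eval x p)"
  unfolding prefix_letter_def op_eval_extend by (simp add: op_eval_def fls_deriv_sum)

lemma op_eval_prefix_y: "op_eval x (prefix_letter Ltr_y p) = x * op_eval x p"
  unfolding prefix_letter_def op_eval_extend by (simp add: op_eval_def sum_distrib_left mult_ac)

text \<open>The clause for two leading \<open>d\<close> is the Leibniz rule solved for f' g', namely
  (f g')' - f g''. The clauses with \<open>y\<close> hold because multiplication by x commutes with
  multiplication by the other factor.\<close>

lemma op_eval_shuffle_words: "op_eval x (shuffle_words u v) = op_value x u * op_value x v"
  by (induction u v rule: shuffle_words.induct)
     (simp_all add: op_eval_prefix_d op_eval_prefix_y op_eval_diff mult_ac)

lemma op_eval_shuffle: "op_eval x (shuffle p q) = op_eval x p * op_eval x q"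
proof -
  have "op_eval x (shuffle p q) = (\<Sum>u\<in>Poly_Mapping.keys p. \<Sum>v\<in>Poly_Mapping.keys q.
      (fls_const (Poly_Mapping.lookup p u) * op_value x u) * (fls_const (Poly_Mapping.lookup q v) *
          op_value x v))"
    unfolding shuffle_def op_eval_extend op_eval_shuffle_words
    by (simp only: sum_distrib_left mult_ac)
  then show ?thesis
    by (simp only: op_eval_def sum_product)
qed

lemma op_value_append_d: "op_value x (w @ [Ltr_d]) = 0"
proof (induction w)
  case (Cons a w)
  then show ?case by (cases a) auto
qed auto

text \<open>A generator of \<open>L_minus\<close> measures the failure of the Leibniz rule for
  \<open>d\<close>, which \<open>fls_deriv\<close> satisfies, and the ideal operations preserve the
  kernel of a multiplicative map. A word ending in \<open>d\<close> begins by differentiating the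
  constant 1.\<close>

lemma op_eval_S_minus:
  assumes "p \<in> S_minus"
  shows "op_eval x p = 0"
proof -
  have 1: "op_eval x p = 0" if "p \<in> L_minus" for p
    using that
  proof (induction rule: L_minus.induct)
    case (generator k u v)
    have *: "op_eval x ((prefix_letter Ltr_d ^^ k) p) = (fls_deriv ^^ k) (op_eval x p)" for p k
      by (induction k) (auto simp: op_eval_prefix_d)
    have "(fls_deriv ^^ k) (0 :: rat fls) = 0"
      by (induction k) auto
    then show ?case
      by (simp add: * op_eval_diff op_eval_prefix_d op_eval_shuffle)
  qed (auto simp: op_eval_add op_eval_scale op_eval_shuffle)
  have "op_eval x p = 0" if "p \<in> T_minus" for p
    using that unfolding T_minus_def
  proof (induction rule: ws.span_induct_alt)
    case (step c p q)
    then show ?case by (auto simp: op_eval_add op_eval_scale op_value_append_d)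
  qed auto
  with 1 show ?thesis
    using assms by (auto simp: S_minus_def op_eval_add)
qed

lift_definition op_hom :: "rat fls \<Rightarrow> hopf \<Rightarrow> rat fls" is op_eval
  by (metis op_eval_S_minus op_eval_diff eq_iff_diff_eq_0)

lemma op_hom_word [simp]: "op_hom x (word_class w) = op_value x w"
  by transfer simp

lemma linear_op_hom: "linear_fls (op_hom x)"
  unfolding Vector_Spaces.linear_iff
proof (intro conjI allI vector_space_hopf_scale vector_space_fls_scale)
  show "op_hom x (a + b) = op_hom x a + op_hom x b" for a b
    by transfer (rule op_eval_add)
  show "op_hom x (hopf_scale c a) = fls_scale c (op_hom x a)" for c a
    unfolding fls_scale_def by transfer (rule op_eval_scale)
qed

text \<open>Words ending in \<open>d\<close> are 0 in the quotient, so the classes of words in Y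
  span it. This is the source of every uniqueness claim for the maps on \<open>hopf\<close> that are
  described by THE.\<close>

lemma hopf_induct [consumes 0, case_names word add scale]:
  assumes word: "\<And>w. w \<in> Y_words \<Longrightarrow> P (word_class w)"
    and add: "\<And>a b. P a \<Longrightarrow> P b \<Longrightarrow> P (a + b)"
    and scale: "\<And>c a. P a \<Longrightarrow> P (hopf_scale c a)"
  shows "P h"
proof -
  interpret vector_space hopf_scale by (rule vector_space_hopf_scale)
  have zero: "P 0"
    using scale[of "word_class []" 0] word[of "[]"] by (simp add: Y_words_def scale_zero_left)
  have w: "P (word_class w)" for w
  proof (cases w rule: rev_cases)
    case Nil
    then show ?thesis by (auto intro: word simp: Y_words_def)
  next
    case (snoc v a)
    show ?thesis
    proof (cases a)
      case Ltr_d
      have "word (v @ [Ltr_d]) \<in> T_minus"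
        unfolding T_minus_def by (rule ws.span_base) auto
      moreover have "0 \<in> L_minus" by (rule L_minus.zero)
      ultimately have "word (v @ [Ltr_d]) + 0 \<in> S_minus"
        unfolding S_minus_def by blast
      then have "word_class w = 0"
        unfolding snoc Ltr_d by transfer simp
      then show ?thesis using zero by simp
    next
      case Ltr_y
      then show ?thesis using snoc by (auto intro!: word simp: Y_words_def)
    qed
  qed
  have hopf: "hopf_scale c (abs_hopf p) = abs_hopf (ws_scale c p)"
    "abs_hopf p + abs_hopf q = abs_hopf (p + q)" for c p q
    by (simp_all add: hopf_scale.abs_eq plus_hopf.abs_eq)
  have sum: "P (abs_hopf (\<Sum>w\<in>A. ws_scale (c w) (word w)))" if "finite A" for A c
    using that
  proof (induction A)
    case empty
    then show ?case using zero by (simp add: zero_hopf_def)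
  next
    case (insert w A)
    have "P (hopf_scale (c w) (word_class w) + abs_hopf (\<Sum>w\<in>A. ws_scale (c w) (word w)))"
      by (intro add scale w insert)
    then show ?case
      using insert by (simp add: word_class.abs_eq hopf)
  qed
  have "ws_extend word p = p" for p
  proof (rule poly_mapping_eqI)
    fix k
    have "Poly_Mapping.lookup (ws_extend word p) k =
        (\<Sum>x\<in>Poly_Mapping.keys p. if x = k then Poly_Mapping.lookup p x else 0)"
      unfolding ws_extend_def lookup_sum
      by (intro sum.cong) (auto simp: lookup_single when_def)
    then show "Poly_Mapping.lookup (ws_extend word p) k = Poly_Mapping.lookup p k"
      by (simp add: in_keys_iff)
  qed
  then have "P (abs_hopf p)" for p
    using sum[of "Poly_Mapping.keys p" "Poly_Mapping.lookup p"] by (simp add: ws_extend_def)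
  then show ?thesis
    by (metis Quotient_hopf Quotient_abs_rep)
qed

lemma linear_hopf_eqI:
  assumes "linear_fls f" "linear_fls g" "\<And>w. w \<in> Y_words \<Longrightarrow> f (word_class w) = g (word_class w)"
  shows "f = g"
proof
  fix h
  show "f h = g h"
    using assms(1,2) unfolding Vector_Spaces.linear_iff
    by (induction h rule: hopf_induct) (simp_all add: assms(3))
qed

section \<open>Block words, and phi as a character\<close>

lemma dy_word_Nil [simp]: "dy_word [] = []"
  and dy_word_Cons [simp]: "dy_word (k # ks) = replicate k Ltr_d @ Ltr_y # dy_word ks"
  by (simp_all add: dy_word_def)

lemma Cons_Y_words_iff: "a # w \<in> Y_words \<longleftrightarrow> w \<in> Y_words - {[]} \<or> a = Ltr_y \<and> w = []"
  by (auto simp: Y_words_def Cons_eq_append_conv)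

lemma Y_words_dy_word:
  assumes "w \<in> Y_words"
  obtains ks where "w = dy_word ks"
proof -
  have "\<exists>ks. w = dy_word ks" using assms
  proof (induction w)
    case Nil
    show ?case by (rule exI[of _ "[]"]) auto
  next
    case (Cons a w)
    then have "w \<in> Y_words"
      by (cases "w = []") (auto simp: Cons_Y_words_iff, auto simp: Y_words_def)
    then obtain ks where ks: "w = dy_word ks" using Cons by auto
    show ?case
    proof (cases a)
      case Ltr_y
      show ?thesis by (rule exI[of _ "0 # ks"]) (use ks Ltr_y in auto)
    next
      case Ltr_d
      \<comment> \<open>A further \<open>d\<close> joins the first block; there is one because the
        single letter \<open>d\<close> is not a word in Y.\<close>
      then obtain k ks' where "ks = k # ks'"
        using Cons.prems ks by (cases ks) (auto simp: Cons_Y_words_iff)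
      then show ?thesis using ks Ltr_d by (intro exI[of _ "Suc k # ks'"]) auto
    qed
  qed
  then show ?thesis using that by auto
qed

lemma op_value_replicate_d: "op_value x (replicate k Ltr_d @ w) = (fls_deriv ^^ k) (op_value x w)"
  by (induction k) auto

lemma op_value_dy_word: "op_value x_series (dy_word ks) = phi_value ks"
  by (induction ks) (auto simp: op_value_replicate_d)

text \<open>The values \<open>phi_value\<close> are prescribed on representatives only. Their
  consistency with the relations of the quotient comes from \<open>op_hom\<close>, and uniqueness
  from the fact that the words \<open>dy_word ks\<close> exhaust Y.\<close>

lemma phi_eq: "phi = op_hom x_series"
  unfolding phi_def
proof (rule the_equality)
  show "linear_fls (op_hom x_series) \<and> (\<forall>ks. op_hom x_series (word_class (dy_word ks)) = phi_value ks)"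
    by (auto simp: linear_op_hom op_value_dy_word)
next
  fix f assume f: "linear_fls f \<and> (\<forall>ks. f (word_class (dy_word ks)) = phi_value ks)"
  show "f = op_hom x_series"
  proof (rule linear_hopf_eqI)
    fix w assume "w \<in> Y_words"
    then obtain ks where "w = dy_word ks" by (rule Y_words_dy_word)
    then show "f (word_class w) = op_hom x_series (word_class w)"
      using f by (auto simp: op_value_dy_word)
  qed (use f linear_op_hom in auto)
qed

section \<open>The counit as the character of 0\<close>

lemma op_value_0: "op_value 0 w = (if w = [] then 1 else 0)"
proof (induction w)
  case (Cons a w)
  then show ?case by (cases a) auto
qed auto

lemma counit_eq: "fls_const (counit h) = op_hom 0 h"
proof -
  \<comment> \<open>The values of this character are constant series, so reading off the coefficient
    at 0 turns it into a rational functional without loss.\<close>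
  have const: "op_hom 0 h = fls_const (fls_nth (op_hom 0 h) 0)" for h
    using linear_op_hom[of 0] unfolding Vector_Spaces.linear_iff
    by (induction h rule: hopf_induct)
       (simp_all add: op_value_0 fls_scale_def, (metis fls_plus_const fls_const_mult_const)+)
  have "counit = (\<lambda>h. fls_nth (op_hom 0 h) 0)"
    unfolding counit_def
  proof (rule the_equality)
    have "vector_space ((*) :: rat \<Rightarrow> _)"
      by unfold_locales (simp_all add: algebra_simps)
    then show "Vector_Spaces.linear hopf_scale (*) (\<lambda>h. fls_nth (op_hom 0 h) 0) \<and>
      fls_nth (op_hom 0 (word_class [])) 0 = 1 \<and>
      (\<forall>w\<in>Y_words - {[]}. fls_nth (op_hom 0 (word_class w)) 0 = 0)"
      using linear_op_hom[of 0] unfolding Vector_Spaces.linear_iff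
      by (auto simp: op_value_0 fls_scale_def)
  next
    fix e assume e: "Vector_Spaces.linear hopf_scale (*) e \<and> e (word_class []) = 1 \<and>
      (\<forall>w\<in>Y_words - {[]}. e (word_class w) = 0)"
    show "e = (\<lambda>h. fls_nth (op_hom 0 h) 0)"
    proof
      fix h
      show "e h = fls_nth (op_hom 0 h) 0"
        using linear_op_hom[of 0] e unfolding Vector_Spaces.linear_iff
        by (induction h rule: hopf_induct) (auto simp: op_value_0 fls_scale_def)
    qed
  qed
  then show ?thesis using const by metis
qed

lemma counit_word:
  assumes "w \<in> Y_words" "w \<noteq> []"
  shows "counit (word_class w) = 0"
proof -
  have "fls_const (counit (word_class w)) = fls_const 0"
    using assms by (simp add: counit_eq op_value_0)
  then show ?thesis using fls_const_eq_0_iff by (metis fls_const_0)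
qed

lemma counit_empty: "counit (word_class []) = 1"
proof -
  have "fls_const (counit (word_class [])) = fls_const 1"
    by (simp add: counit_eq)
  then show ?thesis by (metis fls_const_nth)
qed

section \<open>Convolution of characters\<close>

lemma op_value_not_Y: "w \<notin> Y_words \<Longrightarrow> op_value x w = 0"
proof (cases w rule: rev_cases)
  case (snoc v a)
  assume "w \<notin> Y_words"
  with snoc show ?thesis by (cases a) (auto simp: op_value_append_d Y_words_def)
qed (auto simp: Y_words_def)

text \<open>Prepares induction on words: position 0 belongs to the new head letter, and a set of
  positions is a shifted set of positions of the tail, with or without 0.\<close>

lemma sum_Pow_lessThan_Suc:
  fixes f :: "nat set \<Rightarrow> 'a::comm_monoid_add"
  shows "(\<Sum>S\<in>Pow {..<Suc n}. f S) = (\<Sum>S\<in>Pow {..<n}. f (Suc ` S) + f (insert 0 (Suc ` S)))"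
proof -
  have "(\<Sum>S\<in>Pow {..<Suc n}. f S) = (\<Sum>S\<in>Pow (Suc ` {..<n}) \<union> insert 0 ` Pow (Suc ` {..<n}). f S)"
    by (simp add: lessThan_Suc_eq_insert_0 Pow_insert)
  also have "\<dots> = (\<Sum>S\<in>Pow (Suc ` {..<n}). f S) + (\<Sum>S\<in>insert 0 ` Pow (Suc ` {..<n}). f S)"
    by (rule sum.union_disjoint) auto
  also have "(\<Sum>S\<in>insert 0 ` Pow (Suc ` {..<n}). f S) = (\<Sum>S\<in>Pow (Suc ` {..<n}). f (insert 0 S))"
  proof (rule sum.reindex_cong[OF _ refl refl], rule inj_onI)
    fix A B assume "A \<in> Pow (Suc ` {..<n})" "B \<in> Pow (Suc ` {..<n})" "insert 0 A = insert 0 B"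
    moreover from this have "0 \<notin> A" "0 \<notin> B" by auto
    ultimately show "A = B" by blast
  qed
  also have "(\<Sum>S\<in>Pow (Suc ` {..<n}). f S) + (\<Sum>S\<in>Pow (Suc ` {..<n}). f (insert 0 S)) =
      (\<Sum>S\<in>Pow (Suc ` {..<n}). f S + f (insert 0 S))"
    by (simp add: sum.distrib)
  also have "Pow (Suc ` {..<n}) = (`) Suc ` Pow {..<n}"
    by (simp add: image_Pow_surj)
  also have "(\<Sum>S\<in>\<dots>. f S + f (insert 0 S)) = (\<Sum>S\<in>Pow {..<n}. f (Suc ` S) + f (insert 0 (Suc ` S)))"
    by (rule sum.reindex_cong[OF _ refl refl]) (auto simp: inj_on_def inj_image_eq_iff)
  finally show ?thesis .
qed

lemma nths_complement_Cons:
  assumes "S \<subseteq> {..<length w}"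
  shows "nths (a # w) (Suc ` S) = nths w S"
    and "nths (a # w) (insert 0 (Suc ` S)) = a # nths w S"
    and "nths (a # w) ({..<length (a # w)} - Suc ` S) = a # nths w ({..<length w} - S)"
    and "nths (a # w) ({..<length (a # w)} - insert 0 (Suc ` S)) = nths w ({..<length w} - S)"
proof -
  have "{j. Suc j < Suc (length w) \<and> Suc j \<notin> Suc ` S} = {..<length w} - S" by auto
  moreover have "{j. Suc j \<in> Suc ` S} = S" by auto
  ultimately show "nths (a # w) (Suc ` S) = nths w S"
    "nths (a # w) (insert 0 (Suc ` S)) = a # nths w S"
    "nths (a # w) ({..<length (a # w)} - Suc ` S) = a # nths w ({..<length w} - S)"
    "nths (a # w) ({..<length (a # w)} - insert 0 (Suc ` S)) = nths w ({..<length w} - S)"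
    by (auto simp: nths_Cons)
qed

text \<open>By the Leibniz rule (for \<open>d\<close>) and distributivity (for \<open>y\<close>,
  multiplication by a + b), a letter put in front acts on one of the two factors. This is the choice
  of placing position 0 in S or in its complement.\<close>

lemma op_value_add:
  "op_value (a + b) w = (\<Sum>S\<in>Pow {..<length w}. op_value a (nths w S) *
      op_value b (nths w ({..<length w} - S)))"
proof (induction w)
  case (Cons l w)
  have "(\<Sum>S\<in>Pow {..<length (l # w)}.
        op_value a (nths (l # w) S) * op_value b (nths (l # w) ({..<length (l # w)} - S))) =
      (\<Sum>S\<in>Pow {..<length w}. op_value a (nths w S) * op_value b (l # nths w ({..<length w} - S)) +
        op_value a (l # nths w S) * op_value b (nths w ({..<length w} - S)))"
    unfolding length_Cons sum_Pow_lessThan_Suc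
    by (intro sum.cong) (use nths_complement_Cons[of _ w l] in \<open>auto simp del: nths_Cons\<close>)
  also have "\<dots> = op_value (a + b) (l # w)"
    by (cases l)
       (simp_all add: Cons.IH fls_deriv_sum fls_deriv_mult sum_distrib_left algebra_simps sum.distrib)
  finally show ?case ..
qed auto

text \<open>
  Words ending in \<open>d\<close> evaluate to \<open>0\<close>, so the restriction of the coproduct to words in \<open>Y\<close> is harmless.
\<close>

lemma is_convolution_op_hom: "is_convolution (op_hom a) (op_hom b) (op_hom (a + b))"
  unfolding is_convolution_def
proof (intro conjI ballI linear_op_hom)
  fix w assume "w \<in> Y_words"
  have "(\<Sum>S\<in>Pow {..<length w}. op_value a (nths w S) * op_value b (nths w ({..<length w} - S))) =
      (\<Sum>S\<in>coproduct_index w. op_value a (nths w S) * op_value b (nths w ({..<length w} - S)))"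
    by (rule sum.mono_neutral_right) (auto simp: coproduct_index_def intro: ccontr dest: op_value_not_Y)
  then show "op_hom (a + b) (word_class w) = (\<Sum>S\<in>coproduct_index w.
      op_hom a (word_class (nths w S)) * op_hom b (word_class (nths w ({..<length w} - S))))"
    by (simp add: op_value_add)
qed

text \<open>The index set of the reduced coproduct.\<close>

definition proper_coproduct_index :: "letter list \<Rightarrow> nat set set" where
  "proper_coproduct_index w = coproduct_index w - {{}, {..<length w}}"

text \<open>The two extreme subsets contribute the values at w itself. All other summands involve
  strictly shorter words, which is what allows induction on the length of w.\<close>

lemma is_convolution_split:
  assumes "is_convolution \<alpha> \<beta> \<gamma>" "w \<in> Y_words" "w \<noteq> []"
    and "\<alpha> (word_class []) = 1" "\<beta> (word_class []) = 1"
  shows "\<gamma> (word_class w) = \<alpha> (word_class w) + \<beta> (word_class w) +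
    (\<Sum>S\<in>proper_coproduct_index w.
       \<alpha> (word_class (nths w S)) * \<beta> (word_class (nths w ({..<length w} - S))))"
proof -
  let ?t = "\<lambda>S. \<alpha> (word_class (nths w S)) * \<beta> (word_class (nths w ({..<length w} - S)))"
  have fin: "finite (coproduct_index w)"
    by (rule finite_subset[of _ "Pow {..<length w}"]) (auto simp: coproduct_index_def)
  have all: "nths w {..<length w} = w"
    by (simp add: nths_all)
  have ne: "{} \<noteq> {..<length w}" using assms(3) by auto
  have sub: "{{}, {..<length w}} \<subseteq> coproduct_index w"
    using assms(2) all by (auto simp: coproduct_index_def) (auto simp: Y_words_def)
  have "\<gamma> (word_class w) = sum ?t (coproduct_index w)"
    using assms(1,2) by (simp add: is_convolution_def)
  also have "\<dots> = sum ?t (proper_coproduct_index w) + sum ?t {{}, {..<length w}}"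
    unfolding proper_coproduct_index_def by (rule sum.subset_diff[OF sub fin])
  also have "sum ?t {{}, {..<length w}} = \<beta> (word_class w) + \<alpha> (word_class w)"
    using ne all assms(4,5) by simp
  finally show ?thesis by (simp add: add_ac)
qed

lemma proper_coproduct_indexD:
  assumes "S \<in> proper_coproduct_index w"
  shows "nths w S \<in> Y_words" "nths w ({..<length w} - S) \<in> Y_words"
    "nths w S \<noteq> []" "nths w ({..<length w} - S) \<noteq> []"
    "length (nths w S) < length w" "length (nths w ({..<length w} - S)) < length w"
proof -
  have S: "S \<subseteq> {..<length w}" "S \<noteq> {}" "S \<noteq> {..<length w}"
    using assms by (auto simp: proper_coproduct_index_def coproduct_index_def)
  show "nths w S \<in> Y_words" "nths w ({..<length w} - S) \<in> Y_words"
    using assms by (auto simp: proper_coproduct_index_def coproduct_index_def)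
  have len: "length (nths w A) = card A" if "A \<subseteq> {..<length w}" for A
    using that by (auto simp: length_nths intro: arg_cong[where f = card])
  have fin: "finite S" using S(1) finite_subset by blast
  have "card S < card {..<length w}"
    using S by (intro psubset_card_mono) auto
  moreover have "card S > 0" using S fin by (simp add: card_gt_0_iff)
  moreover have "card ({..<length w} - S) = length w - card S"
    using S fin by (simp add: card_Diff_subset)
  ultimately have "0 < length (nths w S)" "length (nths w S) < length w"
    "0 < length (nths w ({..<length w} - S))" "length (nths w ({..<length w} - S)) < length w"
    using S by (simp_all add: len)
  then show "nths w S \<noteq> []" "nths w ({..<length w} - S) \<noteq> []"
    "length (nths w S) < length w" "length (nths w ({..<length w} - S)) < length w"
    by auto
qed

section \<open>The two summands of the ring of Laurent series\<close>

lemma A_minus_add: "f \<in> A_minus \<Longrightarrow> g \<in> A_minus \<Longrightarrow> f + g \<in> A_minus"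
  by (simp add: A_minus_def)

lemma A_minus_uminus: "f \<in> A_minus \<Longrightarrow> - f \<in> A_minus"
  by (simp add: A_minus_def)

lemma A_minus_0: "0 \<in> A_minus"
  by (simp add: A_minus_def)

lemma A_minus_sum: "(\<And>i. i \<in> I \<Longrightarrow> f i \<in> A_minus) \<Longrightarrow> sum f I \<in> A_minus"
  by (induction I rule: infinite_finite_induct) (auto simp: A_minus_0 A_minus_add)

lemma A_minus_mult:
  assumes "f \<in> A_minus" "g \<in> A_minus"
  shows "f * g \<in> A_minus"
proof -
  have "fls_nth f i * fls_nth g (n - i) = 0" if "n \<ge> 0" for n i
    using assms that by (cases "i \<ge> 0") (auto simp: A_minus_def)
  then have "fls_nth (f * g) n = 0" if "n \<ge> 0" for n
    unfolding fls_times_nth(2) using that by (intro sum.neutral ballI)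
  then show ?thesis
    by (simp add: A_minus_def)
qed

lemma A_minus_scale: "f \<in> A_minus \<Longrightarrow> fls_const c * f \<in> A_minus"
  by (simp add: A_minus_def)

lemma A_minus_deriv: "f \<in> A_minus \<Longrightarrow> fls_deriv f \<in> A_minus"
  by (simp add: A_minus_def)

lemma A_plus_diff: "f \<in> A_plus \<Longrightarrow> g \<in> A_plus \<Longrightarrow> f - g \<in> A_plus"
  unfolding A_plus_def by (metis (no_types, lifting) fps_to_fls_minus imageE range_eqI)

lemma A_plus_A_minus: "f \<in> A_plus \<Longrightarrow> f \<in> A_minus \<Longrightarrow> f = 0"
  unfolding A_plus_def A_minus_def by (auto intro!: fps_ext simp: fls_eq_iff) 

text \<open>
  The regular part \<open>1/z + e^z / (1 - e^z)\<close>, written as the quotient of \<open>((1 - e^z) + z e^z) / z^2\<close>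
  by the unit \<open>(1 - e^z) / z\<close>.
\<close>

definition x_regular :: "'a::field_char_0 fps" where
  "x_regular = fps_shift 2 ((1 - fps_exp 1) + fps_X * fps_exp 1) *
      inverse (fps_shift 1 (1 - fps_exp 1))"

text \<open>This is 1/z + e^z/(1 - e^z) multiplied by z (1 - e^z). \<open>x_regular\<close> is used
  below only through this division-free equation, whose factor on the left can be cancelled.\<close>

lemma x_regular_eq:
  "fps_X * (1 - fps_exp 1) * x_regular = (1 - fps_exp 1) + fps_X * (fps_exp 1 :: 'a::field_char_0 fps)"
proof -
  define P where "P = fps_shift 2 ((1 - fps_exp 1) + fps_X * (fps_exp 1 :: 'a fps))"
  define D where "D = fps_shift 1 (1 - fps_exp 1 :: 'a fps)"
  \<comment> \<open>The coefficients of index 0 and 1 vanish, so the shift by 2 loses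
    nothing.\<close>
  have P: "(1 - fps_exp 1) + fps_X * (fps_exp 1 :: 'a fps) = P * fps_X ^ 2"
  proof (rule fps_ext)
    fix n
    show "((1 - fps_exp 1) + fps_X * (fps_exp 1 :: 'a fps)) $ n = (P * fps_X ^ 2) $ n"
      by (cases n; cases "n - 1") (auto simp: P_def fps_X_power_mult_right_nth)
  qed
  have D: "(1 - fps_exp 1 :: 'a fps) = D * fps_X"
  proof (rule fps_ext)
    fix n
    show "(1 - fps_exp 1 :: 'a fps) $ n = (D * fps_X) $ n"
      by (cases n) (auto simp: D_def)
  qed
  have "D * inverse D = 1"
    by (rule inverse_mult_eq_1') (simp add: D_def)
  then have "fps_X * (D * fps_X) * (P * inverse D) = P * fps_X ^ 2"
    by (simp add: power2_eq_square mult_ac)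
  then show ?thesis
    unfolding P unfolding x_regular_def P_def[symmetric] D_def[symmetric] D[symmetric] .
qed

lemma x_series_eq: "x_series = fps_to_fls x_regular - fls_X_inv"
proof -
  define e :: "rat fls" where "e = fps_to_fls (fps_exp 1)"
  have "fps_to_fls (fps_X * (1 - fps_exp 1) * x_regular) =
      fps_to_fls ((1 - fps_exp 1) + fps_X * (fps_exp 1 :: rat fps))"
    by (simp only: x_regular_eq)
  then have eq: "fls_X * (1 - e) * fps_to_fls x_regular = 1 - e + fls_X * e"
    by (simp add: fls_times_fps_to_fls e_def)
  have "fls_nth (1 - e) 1 \<noteq> 0"
    by (simp add: e_def)
  then have ne: "1 - e \<noteq> 0" by (metis fls_zero_nth)
  have X: "fls_X_inv = 1 / (fls_X :: rat fls)"
    by (metis fls_inverse_X inverse_eq_divide)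
  have solve: "X * (1 - e) * r = 1 - e + X * e \<Longrightarrow> X \<noteq> 0 \<Longrightarrow> e / (1 - e) = r - 1 / X" for X r :: "rat fls"
    using ne by (simp add: field_simps)
  show ?thesis
    unfolding X x_series_def e_def[symmetric] by (rule solve[OF eq]) simp
qed

lemma op_value_A_plus: "op_value (fps_to_fls a) w \<in> A_plus"
proof -
  have "\<exists>g. op_value (fps_to_fls a) w = fps_to_fls g"
  proof (induction w)
    case Nil
    show ?case by (rule exI[of _ 1]) simp
  next
    case (Cons l w)
    then obtain g where "op_value (fps_to_fls a) w = fps_to_fls g" by auto
    then have "op_value (fps_to_fls a) (l # w) =
        fps_to_fls (case l of Ltr_d \<Rightarrow> fps_deriv g | Ltr_y \<Rightarrow> a * g)"
      by (cases l) (simp_all add: fls_deriv_fps_to_fls fls_times_fps_to_fls)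
    then show ?case by (rule exI)
  qed
  then show ?thesis by (auto simp: A_plus_def)
qed

lemma fls_X_inv_A_minus: "fls_X_inv \<in> A_minus"
  by (simp add: A_minus_def)

lemma op_value_A_minus: 
  assumes "a \<in> A_minus" "w \<noteq> []"
  shows "op_value a w \<in> A_minus"
  using assms(2)
proof (induction w)
  case (Cons l w)
  then show ?case using assms(1)
    by (cases "w = []"; cases l) (auto simp: A_minus_0 A_minus_mult A_minus_deriv)
qed auto

lemma op_hom_A_plus: "op_hom (fps_to_fls a) h \<in> A_plus"
proof (induction h rule: hopf_induct)
  case (word w)
  then show ?case by (simp add: op_value_A_plus)
next
  case (add h g)
  then obtain p q where "op_hom (fps_to_fls a) h = fps_to_fls p" "op_hom (fps_to_fls a) g =
      fps_to_fls q"
    by (auto simp: A_plus_def)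
  then have "op_hom (fps_to_fls a) (h + g) = fps_to_fls (p + q)"
    using linear_op_hom unfolding Vector_Spaces.linear_iff by simp
  then show ?case by (simp only: A_plus_def rangeI)
next
  case (scale c h)
  then obtain p where "op_hom (fps_to_fls a) h = fps_to_fls p"
    by (auto simp: A_plus_def)
  then have "op_hom (fps_to_fls a) (hopf_scale c h) = fps_to_fls (fps_const c * p)"
    using linear_op_hom unfolding Vector_Spaces.linear_iff
    by (simp add: fls_scale_def fls_times_fps_to_fls)
  then show ?case by (simp only: A_plus_def rangeI)
qed

lemma op_hom_A_minus:
  assumes "x \<in> A_minus"
  shows "op_hom x h - fls_const (counit h) \<in> A_minus"
proof (induction h rule: hopf_induct)
  case (word w)
  then show ?case
    using assms by (cases "w = []") (auto simp: counit_empty counit_word op_value_A_minus A_minus_0)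
next
  case (add a b)
  from A_minus_add[OF this] show ?case
    using linear_op_hom unfolding Vector_Spaces.linear_iff counit_eq by (simp add: algebra_simps)
next
  case (scale c a)
  from A_minus_scale[OF this] show ?case
    using linear_op_hom unfolding Vector_Spaces.linear_iff counit_eq fls_scale_def
    by (simp add: algebra_simps)
qed

text \<open>Convolution adds parameters, so the inverse of the character of 1/z is the character of
  -1/z. Since \<open>phi\<close> contains the inverse of the negative part, that part has the
  parameter +1/z although \<open>x_series\<close> contains -1/z.\<close>

lemma birkhoff_op_hom:
  "is_birkhoff_decomposition (op_hom fls_X_inv) (op_hom (fps_to_fls x_regular))"
  unfolding is_birkhoff_decomposition_def
proof (intro conjI linear_op_hom exI)
  show "range (op_hom (fps_to_fls x_regular)) \<subseteq> A_plus"
    using op_hom_A_plus by auto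
  note minus = op_hom_A_minus[OF fls_X_inv_A_minus]
  have "op_hom fls_X_inv h = fls_const (counit h) + (op_hom fls_X_inv h - fls_const (counit h))" for h
    by simp
  then show "range (op_hom fls_X_inv) \<subseteq> {fls_const c + a |c a. a \<in> A_minus}"
    using minus by blast
  show "\<forall>h. counit h = 0 \<longrightarrow> op_hom fls_X_inv h \<in> A_minus"
    using minus by (metis diff_zero fls_const_0)
  have counit: "(\<lambda>h. fls_const (counit h)) = op_hom 0"
    by (simp add: counit_eq)
  show "is_convolution_inverse (op_hom fls_X_inv) (op_hom (- fls_X_inv))"
    unfolding is_convolution_inverse_def counit
    using is_convolution_op_hom[of fls_X_inv "- fls_X_inv"] is_convolution_op_hom[of
        "- fls_X_inv" fls_X_inv]
    by (simp add: linear_op_hom)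
  show "is_convolution (op_hom (- fls_X_inv)) (op_hom (fps_to_fls x_regular)) phi"
    using is_convolution_op_hom[of "- fls_X_inv" "fps_to_fls x_regular"]
    by (simp add: phi_eq x_series_eq)
qed simp

section \<open>Uniqueness of the Birkhoff decomposition\<close>

lemma birkhoff_normalized:
  assumes "is_birkhoff_decomposition \<phi>\<^sub>m \<phi>\<^sub>p" "is_convolution_inverse \<phi>\<^sub>m \<psi>" "is_convolution \<psi> \<phi>\<^sub>p phi"
  shows "\<phi>\<^sub>m (word_class []) = 1" "\<psi> (word_class []) = 1" "\<phi>\<^sub>p (word_class []) = 1"
proof -
  have [simp]: "coproduct_index [] = {{}}" "[] \<in> Y_words"
    by (auto simp: coproduct_index_def Y_words_def)
  show 1: "\<phi>\<^sub>m (word_class []) = 1"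
    using assms(1) by (simp add: is_birkhoff_decomposition_def)
  have "fls_const (counit (word_class [])) = \<psi> (word_class []) * \<phi>\<^sub>m (word_class [])"
    using assms(2) by (auto simp: is_convolution_inverse_def is_convolution_def)
  then show 2: "\<psi> (word_class []) = 1"
    using 1 by (simp add: counit_empty)
  have "phi (word_class []) = \<psi> (word_class []) * \<phi>\<^sub>p (word_class [])"
    using assms(3) by (auto simp: is_convolution_def)
  then show "\<phi>\<^sub>p (word_class []) = 1"
    using 2 by (simp add: phi_eq)
qed

text \<open>\<open>is_convolution_inverse\<close> says nothing about the range of \<psi>. It is
  recovered by recursion on the length from the convolution identity with the counit, because
  \<open>A_minus\<close> is closed under sums and products.\<close>

lemma birkhoff_inverse_A_minus:
  assumes "is_birkhoff_decomposition \<phi>\<^sub>m \<phi>\<^sub>p" "is_convolution_inverse \<phi>\<^sub>m \<psi>" "is_convolution \<psi> \<phi>\<^sub>p phi"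
    and "w \<in> Y_words" "w \<noteq> []"
  shows "\<psi> (word_class w) \<in> A_minus"
  using assms(4,5)
proof (induction w rule: length_induct)
  case (1 w)
  note norm = birkhoff_normalized[OF assms(1-3)]
  have m: "\<phi>\<^sub>m (word_class v) \<in> A_minus" if "v \<in> Y_words" "v \<noteq> []" for v
    using assms(1) counit_word[OF that] by (simp add: is_birkhoff_decomposition_def)
  have "is_convolution \<psi> \<phi>\<^sub>m (\<lambda>h. fls_const (counit h))"
    using assms(2) by (simp add: is_convolution_inverse_def)
  from is_convolution_split[OF this 1(2,3) norm(2,1)]
  have "\<psi> (word_class w) = - (\<phi>\<^sub>m (word_class w) + (\<Sum>S\<in>proper_coproduct_index w.
       \<psi> (word_class (nths w S)) * \<phi>\<^sub>m (word_class (nths w ({..<length w} - S)))))"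
    using 1(2,3) by (simp add: counit_word eq_neg_iff_add_eq_0 add_ac del: minus_add_distrib)
  also have "\<dots> \<in> A_minus"
    using 1 by (intro A_minus_uminus A_minus_add A_minus_sum A_minus_mult m)
      (auto dest: proper_coproduct_indexD)
  finally show ?case .
qed

text \<open>
  Comparing the two factorizations at a word, after induction on its length, needs no coassociativity:
  the difference of the values lies both in \<open>A_plus\<close> and in \<open>A_minus\<close>.
\<close>

lemma birkhoff_plus_unique:
  assumes "is_birkhoff_decomposition \<phi>\<^sub>m \<phi>\<^sub>p" "is_birkhoff_decomposition \<phi>\<^sub>m' \<phi>\<^sub>p'"
  shows "\<phi>\<^sub>p = \<phi>\<^sub>p'"
proof -
  obtain \<psi> where \<psi>: "is_convolution_inverse \<phi>\<^sub>m \<psi>" "is_convolution \<psi> \<phi>\<^sub>p phi"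
    using assms(1) by (auto simp: is_birkhoff_decomposition_def)
  obtain \<psi>' where \<psi>': "is_convolution_inverse \<phi>\<^sub>m' \<psi>'" "is_convolution \<psi>' \<phi>\<^sub>p' phi"
    using assms(2) by (auto simp: is_birkhoff_decomposition_def)
  note norm = birkhoff_normalized[OF assms(1) \<psi>] birkhoff_normalized[OF assms(2) \<psi>']
  have "\<psi> (word_class w) = \<psi>' (word_class w) \<and> \<phi>\<^sub>p (word_class w) = \<phi>\<^sub>p' (word_class w)"
    if "w \<in> Y_words" for w
    using that
  proof (induction w rule: length_induct)
    case (1 w)
    show ?case
    proof (cases "w = []")
      case False
      let ?sum = "\<lambda>\<alpha> \<beta>. \<Sum>S\<in>proper_coproduct_index w.
        \<alpha> (word_class (nths w S)) * \<beta> (word_class (nths w ({..<length w} - S))) :: rat fls"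
      have "?sum \<psi> \<phi>\<^sub>p = ?sum \<psi>' \<phi>\<^sub>p'"
        by (intro sum.cong refl) (use 1 proper_coproduct_indexD in \<open>simp\<close>)
      then have eq: "\<phi>\<^sub>p (word_class w) - \<phi>\<^sub>p' (word_class w) = \<psi>' (word_class w) + - \<psi> (word_class w)"
        using is_convolution_split[OF \<psi>(2) 1(2) False norm(2,3)]
          is_convolution_split[OF \<psi>'(2) 1(2) False norm(5,6)] by (simp add: algebra_simps)
      have "\<phi>\<^sub>p (word_class w) - \<phi>\<^sub>p' (word_class w) \<in> A_plus"
        using assms by (intro A_plus_diff) (auto simp: is_birkhoff_decomposition_def)
      moreover have "\<phi>\<^sub>p (word_class w) - \<phi>\<^sub>p' (word_class w) \<in> A_minus"
        unfolding eq using birkhoff_inverse_A_minus[OF assms(1) \<psi> 1(2) False]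
          birkhoff_inverse_A_minus[OF assms(2) \<psi>' 1(2) False]
        by (intro A_minus_add A_minus_uminus)
      ultimately have "\<phi>\<^sub>p (word_class w) - \<phi>\<^sub>p' (word_class w) = 0"
        by (rule A_plus_A_minus)
      then show ?thesis using eq by simp
    qed (use norm in simp)
  qed
  then show ?thesis
    using assms by (intro linear_hopf_eqI) (auto simp: is_birkhoff_decomposition_def)
qed

lemma phi_plus_eq: "phi_plus = op_hom (fps_to_fls x_regular)"
  unfolding phi_plus_def
  by (rule the_equality) (use birkhoff_op_hom birkhoff_plus_unique in blast)+

fun fps_iterate :: "'a::field_char_0 fps \<Rightarrow> nat list \<Rightarrow> 'a fps" where
  "fps_iterate a [] = 1"
| "fps_iterate a (k # ks) = (fps_deriv ^^ k) (a * fps_iterate a ks)"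

lemma op_value_fps_iterate: "op_value (fps_to_fls a) (dy_word ks) = fps_to_fls (fps_iterate a ks)"
proof (induction ks)
  case (Cons k ks)
  have "(fls_deriv ^^ k) (fps_to_fls g) = fps_to_fls ((fps_deriv ^^ k) g)" for g :: "rat fps"
    by (induction k) (auto simp: fls_deriv_fps_to_fls)
  then show ?case
    by (simp add: op_value_replicate_d Cons flip: fls_times_fps_to_fls)
qed auto

lemma zeta_EMS_eq:
  "zeta_EMS n k = of_rat (fps_nth (fps_iterate x_regular (rev (map k [1..<Suc n]))) 0)"
  by (simp add: zeta_EMS_def phi_plus_eq op_value_fps_iterate del: upt_Suc)

section \<open>Coefficients of products of power series in partial sums of the variables\<close>

lemma mps_coeff_Abs [simp]: "mps_coeff (Abs_mps f) = f"
  by (simp add: Abs_mps_inverse)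

lemma mps_coeff_simps [simp]:
  "mps_coeff 0 m = 0" "mps_coeff (f + g) m = mps_coeff f m + mps_coeff g m"
  "mps_coeff (f - g) m = mps_coeff f m - mps_coeff g m" "mps_coeff (- f) m = - mps_coeff f m"
  "mps_coeff 1 m = (if m = 0 then 1 else 0)"
  "mps_coeff (mps_var i) m = (if m = Poly_Mapping.single i 1 then 1 else 0)"
  by (transfer; simp)+

lemma mps_coeff_mult: "mps_coeff (f * g) m = (\<Sum>(a, b)\<in>splits m. mps_coeff f a * mps_coeff g b)"
  by (simp add: times_mps.rep_eq)

lemma mps_coeff_sum: "mps_coeff (sum f A) m = (\<Sum>i\<in>A. mps_coeff (f i) m)"
  by (induction A rule: infinite_finite_induct) auto

lemma mps_coeff_of_nat_mult: "mps_coeff (of_nat k * f) m = of_nat k * mps_coeff f m"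
  by (induction k) (auto simp: algebra_simps)

section \<open>Degrees, order of vanishing and evaluation of a power series\<close>

lemma mdegree_superset:
  assumes "finite A" "Poly_Mapping.keys m \<subseteq> A"
  shows "mdegree m = (\<Sum>i\<in>A. Poly_Mapping.lookup m i)"
  unfolding mdegree_def using assms
  by (intro sum.mono_neutral_left) (auto simp: in_keys_iff)

lemma mdegree_0 [simp]: "mdegree 0 = 0"
  by (simp add: mdegree_def)

lemma mdegree_single [simp]: "mdegree (Poly_Mapping.single i k) = k"
  by (simp add: mdegree_def)

lemma mdegree_add: "mdegree (a + b) = mdegree a + mdegree b"
proof -
  let ?A = "Poly_Mapping.keys a \<union> Poly_Mapping.keys b"
  have "Poly_Mapping.keys (a + b) \<subseteq> ?A" by (rule Poly_Mapping.keys_add)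
  then show ?thesis
    by (simp add: mdegree_superset[of ?A] lookup_add sum.distrib)
qed

lemma mps_coeff_var_power_mult:
  "mps_coeff (mps_var i ^ k * f) m =
     (if k \<le> Poly_Mapping.lookup m i then mps_coeff f (m - Poly_Mapping.single i k) else 0)"
proof (induction k arbitrary: m)
  case (Suc k)
  have one: "mps_coeff (mps_var i * f) m =
     (if 1 \<le> Poly_Mapping.lookup m i then mps_coeff f (m - Poly_Mapping.single i 1) else 0)"
         for f :: "'a mps" and m
  proof (cases "1 \<le> Poly_Mapping.lookup m i")
    case True
    have m: "m = Poly_Mapping.single i 1 + (m - Poly_Mapping.single i 1)"
      using True by (intro poly_mapping_eqI) (auto simp: lookup_add lookup_minus lookup_single when_def)
    have "mps_coeff (mps_var i * f) m =
        (\<Sum>(a, b)\<in>{(Poly_Mapping.single i 1, m - Poly_Mapping.single i 1)}. mps_coeff (mps_var i) a *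
            mps_coeff f b)"
      unfolding mps_coeff_mult
    proof (rule sum.mono_neutral_right[OF finite_splits])
      show "{(Poly_Mapping.single i 1, m - Poly_Mapping.single i 1)} \<subseteq> splits m"
        using m by (simp add: splits_def)
    qed (auto simp: splits_def split: if_splits)
    then show ?thesis using True by simp
  next
    case False
    then have "a \<noteq> Poly_Mapping.single i 1" if "a + b = m" for a b
      using that by (auto simp: lookup_add)
    then show ?thesis
      using False unfolding mps_coeff_mult by (auto simp: splits_def intro!: sum.neutral)
  qed
  have eq: "m - Poly_Mapping.single i 1 - Poly_Mapping.single i k = m - Poly_Mapping.single i (Suc k)"
    by (intro poly_mapping_eqI) (auto simp: lookup_minus lookup_single when_def)
  show ?case
    unfolding power_Suc mult.assoc one Suc eq by (auto simp: lookup_minus)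
qed simp

definition mps_ord_ge :: "nat \<Rightarrow> 'a::comm_ring_1 mps \<Rightarrow> bool" where
  "mps_ord_ge d f \<longleftrightarrow> (\<forall>m. mdegree m < d \<longrightarrow> mps_coeff f m = 0)"

lemma mps_ord_ge_mult:
  assumes "mps_ord_ge d f" "mps_ord_ge e g"
  shows "mps_ord_ge (d + e) (f * g)"
  unfolding mps_ord_ge_def
proof (intro allI impI)
  fix m assume m: "mdegree m < d + e"
  have "mps_coeff f a * mps_coeff g b = 0" if "a + b = m" for a b
  proof -
    have "mdegree a < d \<or> mdegree b < e"
      using m mdegree_add[of a b] that by auto
    then show ?thesis using assms by (auto simp: mps_ord_ge_def)
  qed
  then show "mps_coeff (f * g) m = 0"
    unfolding mps_coeff_mult by (auto simp: splits_def intro!: sum.neutral)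
qed

lemma mps_ord_ge_power: "mps_ord_ge 1 u \<Longrightarrow> mps_ord_ge j (u ^ j)"
proof (induction j)
  case (Suc j)
  then show ?case using mps_ord_ge_mult[of 1 u j "u ^ j"] by simp
qed (simp add: mps_ord_ge_def)

lemma mps_ord_ge_sum_var: "mps_ord_ge 1 (\<Sum>k\<in>A. mps_var k)"
  by (auto simp: mps_ord_ge_def mps_coeff_sum intro!: sum.neutral)

text \<open>\<open>mps_eval\<close> truncates at the degree of each monomial, which varies over the
  splittings of m. Powers of u beyond the degree contribute nothing, so one common bound N may be
  used.\<close>

lemma mps_coeff_eval_mult:
  assumes "mps_ord_ge 1 u" "mdegree m \<le> N"
  shows "mps_coeff (mps_eval a u * h) m = (\<Sum>j\<le>N. fps_nth a j * mps_coeff (u ^ j * h) m)"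
proof -
  have eval: "mps_coeff (mps_eval a u) p = (\<Sum>j\<le>N. fps_nth a j * mps_coeff (u ^ j) p)"
    if "p + q = m" for p q
  proof -
    have "mdegree p \<le> N"
      using that assms(2) mdegree_add[of p q] by auto
    then have "(\<Sum>j\<le>N. fps_nth a j * mps_coeff (u ^ j) p) =
        (\<Sum>j\<le>mdegree p. fps_nth a j * mps_coeff (u ^ j) p)"
      using mps_ord_ge_power[OF assms(1)] by (intro sum.mono_neutral_right) (auto simp: mps_ord_ge_def)
    then show ?thesis by (simp add: mps_eval_def)
  qed
  have "mps_coeff (mps_eval a u * h) m =
      (\<Sum>(p, q)\<in>splits m. (\<Sum>j\<le>N. fps_nth a j * mps_coeff (u ^ j) p) * mps_coeff h q)"
    unfolding mps_coeff_mult by (rule sum.cong) (auto simp: splits_def eval)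
  also have "\<dots> = (\<Sum>(p, q)\<in>splits m. \<Sum>j\<le>N. fps_nth a j * (mps_coeff (u ^ j) p * mps_coeff h q))"
    by (simp add: sum_distrib_right mult.assoc)
  also have "\<dots> = (\<Sum>j\<le>N. \<Sum>(p, q)\<in>splits m. fps_nth a j * (mps_coeff (u ^ j) p * mps_coeff h q))"
    unfolding case_prod_unfold by (rule sum.swap)
  also have "\<dots> = (\<Sum>j\<le>N. fps_nth a j * mps_coeff (u ^ j * h) m)"
    by (simp add: mps_coeff_mult sum_distrib_left case_prod_unfold)
  finally show ?thesis .
qed

text \<open>A Cauchy product with both sums cut at the degree N of the monomial: the pairs with i +
  j > N drop out because u^(i+j) has order at least i + j.\<close>

lemma mps_eval_mult:
  assumes "mps_ord_ge 1 u"
  shows "mps_eval (f * g) u = mps_eval f u * mps_eval g u"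
proof (rule mps_eqI)
  fix m
  define N where "N = mdegree m"
  define c where "c = (\<lambda>i j. fps_nth f i * (fps_nth g j * mps_coeff (u ^ (i + j)) m))"
  have "mps_coeff (mps_eval f u * mps_eval g u) m = (\<Sum>i\<le>N. fps_nth f i * mps_coeff (mps_eval g u *
      u ^ i) m)"
    by (subst mps_coeff_eval_mult[OF assms order_refl]) (simp add: N_def mult.commute)
  also have "\<dots> = (\<Sum>i\<le>N. \<Sum>j\<le>N. c i j)"
    unfolding N_def c_def mps_coeff_eval_mult[OF assms order_refl] sum_distrib_left
    by (simp add: power_add mult.commute)
  also have "\<dots> = (\<Sum>(i, j)\<in>{..N} \<times> {..N}. c i j)"
    by (rule sum.cartesian_product)
  also have "\<dots> = (\<Sum>(i, j)\<in>{(i, j). i + j \<le> N}. c i j)"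
  proof (intro sum.mono_neutral_right ballI)
    fix p assume p: "p \<in> {..N} \<times> {..N} - {(i, j). i + j \<le> N}"
    obtain i j where ij: "p = (i, j)" by (cases p)
    have "mps_coeff (u ^ (i + j)) m = 0"
      using mps_ord_ge_power[OF assms, of "i + j"] p by (auto simp: mps_ord_ge_def N_def ij)
    then show "(case p of (i, j) \<Rightarrow> c i j) = 0" by (simp add: c_def ij)
  qed auto
  also have "\<dots> = (\<Sum>k\<le>N. \<Sum>i\<le>k. c i (k - i))"
    by (rule sum.triangle_reindex_eq)
  also have "\<dots> = mps_coeff (mps_eval (f * g) u) m"
    by (simp add: mps_eval_def N_def c_def fps_mult_nth atMost_atLeast0 sum_distrib_right mult.assoc)
  finally show "mps_coeff (mps_eval (f * g) u) m = mps_coeff (mps_eval f u * mps_eval g u) m" ..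
qed

lemma mps_eval_1 [simp]: "mps_eval 1 u = 1"
proof (rule mps_eqI)
  fix m
  have "mps_coeff (mps_eval 1 u) m = (\<Sum>j\<le>mdegree m. if j = 0 then mps_coeff (u ^ j) m else 0)"
    unfolding mps_eval_def mps_coeff_Abs by (intro sum.cong) auto
  then show "mps_coeff (mps_eval 1 u) m = mps_coeff 1 m" by simp
qed

section \<open>Extracting the powers of the variables one after the other\<close>

definition mps_free :: "nat \<Rightarrow> 'a::comm_ring_1 mps \<Rightarrow> bool" where
  "mps_free i f \<longleftrightarrow> (\<forall>m. Poly_Mapping.lookup m i \<noteq> 0 \<longrightarrow> mps_coeff f m = 0)"

lemma mps_free_mult: "mps_free i f \<Longrightarrow> mps_free i g \<Longrightarrow> mps_free i (f * g)"
  unfolding mps_free_def mps_coeff_mult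
  by (force simp: splits_def lookup_add intro!: sum.neutral)

lemma mps_free_1 [simp]: "mps_free i 1"
  by (auto simp: mps_free_def)

lemma mps_free_power: "mps_free i f \<Longrightarrow> mps_free i (f ^ k)"
  by (induction k) (auto intro: mps_free_mult)

lemma mps_free_prod: "(\<And>j. j \<in> A \<Longrightarrow> mps_free i (f j)) \<Longrightarrow> mps_free i (prod f A)"
  by (induction A rule: infinite_finite_induct) (auto intro: mps_free_mult)

lemma mps_free_sum_var: "i \<notin> A \<Longrightarrow> mps_free i (\<Sum>k\<in>A. mps_var k)"
  by (auto simp: mps_free_def mps_coeff_sum lookup_single when_def intro!: sum.neutral split: if_splits)

lemma mps_free_eval: "mps_free i u \<Longrightarrow> mps_free i (mps_eval a u)"
  using mps_free_power[of i u] by (auto simp: mps_free_def mps_eval_def intro!: sum.neutral)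

text \<open>The Hasse derivative a^(k) / k!, written with binomial coefficients so that it makes
  sense over every commutative ring.\<close>

definition fps_taylor :: "nat \<Rightarrow> 'a::comm_ring_1 fps \<Rightarrow> 'a fps" where
  "fps_taylor k a = Abs_fps (\<lambda>j. of_nat ((j + k) choose k) * fps_nth a (j + k))"

text \<open>Taylor's formula: a(t_i + v) is the sum of t_i^k a^(k)(v) / k!, read off at the exponent
  of t_i in m.\<close>

lemma mps_coeff_taylor:
  assumes "mps_free i v" "mps_free i h" "mps_ord_ge 1 v"
  shows "mps_coeff (mps_eval a (mps_var i + v) * h) m =
    mps_coeff (mps_eval (fps_taylor (Poly_Mapping.lookup m i) a) v * h)
      (m - Poly_Mapping.single i (Poly_Mapping.lookup m i))"
proof -
  define k where "k = Poly_Mapping.lookup m i"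
  define m' where "m' = m - Poly_Mapping.single i k"
  define N where "N = mdegree m"
  have m: "m = Poly_Mapping.single i k + m'"
    by (intro poly_mapping_eqI) (auto simp: m'_def k_def lookup_add lookup_minus lookup_single when_def)
  have N: "N = k + mdegree m'"
    unfolding N_def by (subst m) (simp add: mdegree_add)
  have var: "mps_ord_ge 1 (mps_var i + v)"
    using assms(3) by (auto simp: mps_ord_ge_def)
  \<comment> \<open>Since v and h do not involve t_i, only the power of t_i equal to its exponent in
    m survives in the binomial expansion.\<close>
  have c: "mps_coeff (mps_var i ^ l * (v ^ j * h)) m = (if l = k then mps_coeff (v ^ j *
      h) m' else 0)" for l j
  proof -
    have "mps_free i (v ^ j * h)"
      by (intro mps_free_mult mps_free_power assms)
    then show ?thesis
      by (auto simp: mps_coeff_var_power_mult mps_free_def k_def m'_def lookup_minus)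
  qed
  have "mps_coeff (mps_eval a (mps_var i + v) * h) m =
      (\<Sum>j\<le>N. fps_nth a j * mps_coeff ((mps_var i + v) ^ j * h) m)"
    by (rule mps_coeff_eval_mult[OF var]) (simp add: N_def)
  also have "\<dots> = (\<Sum>j\<le>N. if k \<le> j then fps_nth a j * of_nat (j choose k) * mps_coeff (v ^ (j - k) *
      h) m' else 0)"
  proof (intro sum.cong refl)
    fix j
    have "mps_coeff ((mps_var i + v) ^ j * h) m =
        (\<Sum>l\<le>j. of_nat (j choose l) * mps_coeff (mps_var i ^ l * (v ^ (j - l) * h)) m)"
      unfolding binomial_ring sum_distrib_right mps_coeff_sum
      by (simp add: mult.assoc mps_coeff_of_nat_mult)
    then show "fps_nth a j * mps_coeff ((mps_var i + v) ^ j * h) m =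
        (if k \<le> j then fps_nth a j * of_nat (j choose k) * mps_coeff (v ^ (j - k) * h) m' else 0)"
      by (simp add: c if_distrib[where f = "\<lambda>x. _ * x"] mult.assoc cong: if_cong)
  qed
  also have "\<dots> = (\<Sum>j\<in>{k..N}. fps_nth a j * of_nat (j choose k) * mps_coeff (v ^ (j - k) * h) m')"
    by (rule sum.mono_neutral_cong_right) auto
  also have "\<dots> = (\<Sum>j\<le>mdegree m'. fps_nth (fps_taylor k a) j * mps_coeff (v ^ j * h) m')"
    by (rule sum.reindex_bij_witness[of _ "\<lambda>j. j + k" "\<lambda>j. j - k"])
       (auto simp: fps_taylor_def N)
  also have "\<dots> = mps_coeff (mps_eval (fps_taylor k a) v * h) m'"
    by (rule mps_coeff_eval_mult[OF assms(3) order_refl, symmetric])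
  finally show ?thesis by (simp add: k_def m'_def)
qed

fun iterated_taylor :: "'a::comm_ring_1 fps \<Rightarrow> (nat \<Rightarrow> nat) \<Rightarrow> nat \<Rightarrow> 'a fps" where
  "iterated_taylor a k 0 = 1"
| "iterated_taylor a k (Suc i) = fps_taylor (k (Suc i)) (a * iterated_taylor a k i)"

text \<open>The variable t_1 occurs in the first factor only. Once its power has been extracted,
  that factor is a series in t_2 + ... + t_n like the second one, the two are merged by
  \<open>mps_eval_mult\<close>, and the same argument applies to t_2.\<close>

lemma mps_coeff_prod_eval:
  fixes a :: "'a::comm_ring_1 fps"
  shows "mps_coeff (\<Prod>i=1..n. mps_eval a (\<Sum>k=i..n. mps_var k)) m =
    (if Poly_Mapping.keys m \<subseteq> {1..n} then fps_nth (iterated_taylor a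
        (Poly_Mapping.lookup m) n) 0 else 0)"
proof (cases "Poly_Mapping.keys m \<subseteq> {1..n}")
  case True
  define u where "u = (\<lambda>i. \<Sum>k=i..n. mps_var k :: 'a mps)"
  \<comment> \<open>Invariant after removing t_1, ..., t_i: m' is m without these exponents, and the
    factors met so far have merged into one series in t_(i+1) + ... + t_n.\<close>
  have "\<exists>m'. (\<forall>j. Poly_Mapping.lookup m' j = (if j > i then Poly_Mapping.lookup m j else 0)) \<and>
      mps_coeff (\<Prod>l=1..n. mps_eval a (u l)) m =
      mps_coeff (mps_eval (iterated_taylor a (Poly_Mapping.lookup m) i) (u (Suc i)) *
          (\<Prod>l=Suc i..n. mps_eval a (u l))) m'"
    if "i \<le> n" for i
    using that
  proof (induction i)
    case 0
    \<comment> \<open>Index 0 is not among the variables, so m itself already has its exponents up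
      to 0 erased.\<close>
    have "Poly_Mapping.lookup m 0 = 0"
      using True by (auto simp: in_keys_iff)
    then show ?case by (intro exI[of _ m]) auto
  next
    case (Suc i)
    then obtain m' where m': "\<And>j. Poly_Mapping.lookup m' j =
        (if j > i then Poly_Mapping.lookup m j else 0)"
      and eq: "mps_coeff (\<Prod>l=1..n. mps_eval a (u l)) m =
        mps_coeff (mps_eval (iterated_taylor a (Poly_Mapping.lookup m) i) (u (Suc i)) *
            (\<Prod>l=Suc i..n. mps_eval a (u l))) m'"
      by auto
    define h where "h = (\<Prod>l=Suc (Suc i)..n. mps_eval a (u l))"
    have ord: "mps_ord_ge 1 (u j)" for j
      unfolding u_def by (rule mps_ord_ge_sum_var)
    have "(\<Prod>l=Suc i..n. mps_eval a (u l)) = mps_eval a (u (Suc i)) * h"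
      unfolding h_def using Suc.prems by (simp add: prod.atLeast_Suc_atMost)
    then have 1: "mps_eval (iterated_taylor a (Poly_Mapping.lookup m) i) (u (Suc i)) *
        (\<Prod>l=Suc i..n. mps_eval a (u l)) =
        mps_eval (a * iterated_taylor a (Poly_Mapping.lookup m) i) (u (Suc i)) * h"
      unfolding mps_eval_mult[OF ord] by (simp add: mult_ac)
    have 2: "u (Suc i) = mps_var (Suc i) + u (Suc (Suc i))"
      unfolding u_def using Suc.prems by (simp add: sum.atLeast_Suc_atMost)
    have "mps_free (Suc i) (u l)" if "l > Suc i" for l
      using that unfolding u_def by (intro mps_free_sum_var) auto
    then have "mps_free (Suc i) (u (Suc (Suc i)))" "mps_free (Suc i) h"
      unfolding h_def by (auto intro!: mps_free_prod mps_free_eval)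
    from mps_coeff_taylor[OF this ord, of "a * iterated_taylor a (Poly_Mapping.lookup m) i" m']
    have "mps_coeff (\<Prod>l=1..n. mps_eval a (u l)) m =
        mps_coeff (mps_eval (iterated_taylor a (Poly_Mapping.lookup m) (Suc i)) (u (Suc (Suc i))) * h)
          (m' - Poly_Mapping.single (Suc i) (Poly_Mapping.lookup m' (Suc i)))"
      unfolding eq 1 unfolding 2 by (simp add: m')
    then show ?case
      unfolding h_def
      by (intro exI[of _ "m' - Poly_Mapping.single (Suc i) (Poly_Mapping.lookup m' (Suc i))"])
         (auto simp: m' lookup_minus lookup_single when_def)
  qed
  from this[OF order_refl] obtain m' where m': "\<And>j. Poly_Mapping.lookup m' j =
      (if j > n then Poly_Mapping.lookup m j else 0)"
    and eq: "mps_coeff (\<Prod>l=1..n. mps_eval a (u l)) m =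
      mps_coeff (mps_eval (iterated_taylor a (Poly_Mapping.lookup m) n) (u (Suc n))) m'"
    by auto
  have "m' = 0"
    using True by (intro poly_mapping_eqI) (auto simp: m' in_keys_iff)
  then show ?thesis
    using eq True by (simp add: u_def mps_eval_def)
next
  case False
  then obtain i where i: "i \<notin> {1..n}" "Poly_Mapping.lookup m i \<noteq> 0"
    unfolding subset_iff in_keys_iff by blast
  have "mps_free i (\<Prod>l=1..n. mps_eval a (\<Sum>k=l..n. mps_var k))"
    using i by (intro mps_free_prod mps_free_eval mps_free_sum_var) auto
  then show ?thesis
    using i False by (auto simp: mps_free_def)
qed

lemma mps_negate_vars_mult: "mps_negate_vars (f * g) = mps_negate_vars f * mps_negate_vars g"
  by (rule mps_eqI)
     (auto simp: mps_negate_vars_def mps_coeff_mult sum_distrib_left splits_def mdegree_add power_add mult_ac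
       intro!: sum.cong)

lemma mps_negate_vars_1 [simp]: "mps_negate_vars 1 = 1"
  by (rule mps_eqI) (simp add: mps_negate_vars_def)

lemma mps_negate_vars_prod: "mps_negate_vars (prod f A) = (\<Prod>i\<in>A. mps_negate_vars (f i))"
  by (induction A rule: infinite_finite_induct) (auto simp: mps_negate_vars_mult)

lemma mps_negate_vars_power: "mps_negate_vars (f ^ k) = mps_negate_vars f ^ k"
  by (induction k) (auto simp: mps_negate_vars_mult)

lemma mps_negate_vars_sum_var: "mps_negate_vars (\<Sum>k\<in>A. mps_var k) = - (\<Sum>k\<in>A. mps_var k)"
  by (rule mps_eqI) (auto simp: mps_negate_vars_def mps_coeff_sum sum_distrib_left simp flip: sum_negf intro!: sum.cong)

text \<open>For odd u, negating the variables turns u^j into (-1)^j u^j, so a sign by degree becomes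
  a sign by power.\<close>

lemma mps_negate_vars_eval:
  assumes "mps_negate_vars u = - u"
  shows "mps_negate_vars (mps_eval a u) = mps_eval (fps_compose a (- fps_X)) u"
proof (rule mps_eqI)
  fix m
  have "(-1) ^ mdegree m * mps_coeff (u ^ j) m = (-1) ^ j * mps_coeff (u ^ j) m" for j
  proof -
    have "(-1) ^ mdegree m * mps_coeff (u ^ j) m = mps_coeff ((- u) ^ j) m"
      unfolding assms[symmetric] mps_negate_vars_power[symmetric] by (simp add: mps_negate_vars_def)
    then show ?thesis by (cases "even j") auto
  qed
  then show "mps_coeff (mps_negate_vars (mps_eval a u)) m = mps_coeff (mps_eval (fps_compose a
      (- fps_X)) u) m"
    by (simp add: mps_negate_vars_def mps_eval_def sum_distrib_left fps_compose_uminus' mult_ac)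
qed

section \<open>The generating function of the renormalized values\<close>

lemma fps_nth_higher_deriv:
  "fps_nth ((fps_deriv ^^ k) f) j =
     of_nat (fact k * ((j + k) choose k)) * (fps_nth f (j + k) :: 'a::field_char_0)"
proof (induction k arbitrary: j)
  case (Suc k)
  \<comment> \<open>By the two absorption identities both sides equal (j+k+1) times the binomial
    coefficient of j+k over k.\<close>
  have "(Suc j) * ((Suc j + k) choose k) = Suc k * ((Suc j + k) choose Suc k)"
    using binomial_absorb_comp[of "Suc j + k" k] binomial_absorption[of k "Suc j + k"]
    by (simp only: diff_add_inverse2)
  then have "fact k * (Suc j * ((Suc j + k) choose k)) = fact k * (Suc k * ((Suc j + k) choose Suc k))"
    by (rule arg_cong)
  then have "fact k * (Suc j * ((Suc j + k) choose k)) = fact (Suc k) * ((j + Suc k) choose Suc k)"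
    unfolding fact_Suc of_nat_id by (simp only: mult_ac add_Suc_shift)
  then have eq: "of_nat (Suc j) * of_nat (fact k * ((Suc j + k) choose k)) =
      (of_nat (fact (Suc k) * ((j + Suc k) choose Suc k)) :: 'a)"
    unfolding of_nat_mult[symmetric] by (simp add: mult_ac)
  have "fps_nth ((fps_deriv ^^ Suc k) f) j = of_nat (Suc j) * fps_nth ((fps_deriv ^^ k) f) (Suc j)"
    by simp
  also have "\<dots> = of_nat (Suc j) * of_nat (fact k * ((Suc j + k) choose k)) * fps_nth f (Suc j + k)"
    unfolding Suc by (simp only: mult.assoc)
  also have "\<dots> = of_nat (fact (Suc k) * ((j + Suc k) choose Suc k)) * fps_nth f (j + Suc k)"
    unfolding eq by simp
  finally show ?case .
qed simp

text \<open>The chain rule for t \<mapsto> -t. The resulting constant is the weight that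
  \<open>generating_series\<close> attaches to the exponent k.\<close>

lemma fps_taylor_reflect:
  fixes f :: "'a::field_char_0 fps"
  shows "fps_taylor k (fps_compose f (- fps_X)) =
    fps_const ((-1) ^ k / fact k) * fps_compose ((fps_deriv ^^ k) f) (- fps_X)"
  by (rule fps_ext) (simp add: fps_taylor_def fps_compose_uminus' fps_nth_higher_deriv power_add)

lemma fps_taylor_scale: "fps_taylor k (fps_const c * f) = fps_const c * fps_taylor k f"
  by (rule fps_ext) (simp add: fps_taylor_def algebra_simps)

text \<open>The exponent treated last belongs to the outermost derivative on both sides, and
  \<open>fps_iterate\<close> reads it at the head of its list. This accounts for the reversed word
  in \<open>zeta_EMS\<close>.\<close>

lemma iterated_taylor_reflect:
  fixes a :: "'a::field_char_0 fps"
  shows "iterated_taylor (fps_compose a (- fps_X)) k i =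
    fps_const (\<Prod>l=1..i. (-1) ^ k l / fact (k l)) * fps_compose (fps_iterate a (rev
        (map k [1..<Suc i]))) (- fps_X)"
proof (induction i)
  case (Suc i)
  define c where "c = (\<Prod>l=1..i. (-1) ^ k l / fact (k l) :: 'a)"
  define g where "g = fps_iterate a (rev (map k [1..<Suc i]))"
  have rev: "rev (map k [1..<Suc (Suc i)]) = k (Suc i) # rev (map k [1..<Suc i])"
    by simp
  have "iterated_taylor (fps_compose a (- fps_X)) k (Suc i) =
      fps_taylor (k (Suc i)) (fps_const c * fps_compose (a * g) (- fps_X))"
    using Suc by (simp add: c_def g_def fps_compose_mult_distrib mult_ac del: upt_Suc)
  also have "\<dots> = fps_const c * (fps_const ((-1) ^ k (Suc i) / fact (k (Suc i))) *
      fps_compose ((fps_deriv ^^ k (Suc i)) (a * g)) (- fps_X))"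
    unfolding fps_taylor_scale fps_taylor_reflect ..
  also have "\<dots> = fps_const (\<Prod>l=1..Suc i. (-1) ^ k l / fact (k l)) *
      fps_compose (fps_iterate a (rev (map k [1..<Suc (Suc i)]))) (- fps_X)"
    unfolding rev by (simp add: c_def g_def mult.assoc flip: fps_const_mult del: upt_Suc)
  finally show ?case .
qed simp

text \<open>Base change: the Hopf algebra has coefficients in \<open>rat\<close>, the generating
  series in \<open>complex\<close>.\<close>

definition fps_of_rat :: "rat fps \<Rightarrow> 'a::field_char_0 fps" where
  "fps_of_rat f = Abs_fps (\<lambda>n. of_rat (fps_nth f n))"

lemma fps_nth_of_rat [simp]: "fps_nth (fps_of_rat f) n = of_rat (fps_nth f n)"
  by (simp add: fps_of_rat_def)

lemma of_rat_fact [simp]: "of_rat (fact n) = (fact n :: 'a::field_char_0)"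
  by (metis of_nat_fact of_rat_of_nat_eq)

lemma fps_of_rat_mult: "fps_of_rat (f * g) = fps_of_rat f * fps_of_rat g"
  by (rule fps_ext) (simp add: fps_mult_nth of_rat_sum of_rat_mult)

lemma fps_of_rat_iterate: "fps_of_rat (fps_iterate a ks) = fps_iterate (fps_of_rat a) ks"
proof (induction ks)
  case Nil
  show ?case by (rule fps_ext) simp
next
  case (Cons k ks)
  have deriv: "fps_of_rat ((fps_deriv ^^ k) f) = (fps_deriv ^^ k) (fps_of_rat f)" for f
    by (rule fps_ext) (simp add: fps_nth_higher_deriv of_rat_mult)
  show ?case by (simp add: deriv fps_of_rat_mult Cons)
qed

text \<open>Both series solve \<open>x_regular_eq\<close> over the larger field, where the factor in
  front is cancellable. This avoids the base change of \<open>inverse\<close>.\<close>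

lemma fps_of_rat_x_regular: "fps_of_rat x_regular = (x_regular :: 'a::field_char_0 fps)"
proof -
  define e where "e = (fps_exp 1 :: 'a fps)"
  have hom: "fps_of_rat 1 = (1 :: 'a fps)" "fps_of_rat fps_X = (fps_X :: 'a fps)"
    "fps_of_rat (f + g) = (fps_of_rat f + fps_of_rat g :: 'a fps)"
    "fps_of_rat (f - g) = (fps_of_rat f - fps_of_rat g :: 'a fps)" 
    "fps_of_rat (fps_exp 1) = e" for f g
    by (rule fps_ext; simp add: of_rat_add of_rat_diff of_rat_divide e_def fps_X_def)+
  have "fps_of_rat (fps_X * (1 - fps_exp 1) * x_regular) = (fps_of_rat ((1 - fps_exp 1) + fps_X *
      fps_exp 1) :: 'a fps)"
    by (simp only: x_regular_eq)
  then have "fps_X * (1 - e) * fps_of_rat x_regular = (1 - e) + fps_X * e"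
    by (simp only: fps_of_rat_mult hom)
  also have "\<dots> = fps_X * (1 - e) * x_regular"
    unfolding e_def by (simp only: x_regular_eq)
  finally have eq: "fps_X * (1 - e) * fps_of_rat x_regular = fps_X * (1 - e) * x_regular" .
  have "fps_nth (1 - e) 1 \<noteq> 0"
    by (simp add: e_def)
  then have "1 - e \<noteq> 0" by (metis fps_zero_nth)
  then show ?thesis using eq by simp
qed

text \<open>Composition with -t leaves the constant coefficient unchanged, so the coefficient of the
  product is the nested derivative of \<open>x_regular\<close> at 0 times the weights of the
  generating series.\<close>

lemma Z_EMS_eq: "Z_EMS n = (\<Prod>i=1..n. mps_eval (fps_compose x_regular (- fps_X)) (\<Sum>k=i..n. mps_var k))"
proof (rule mps_eqI)
  fix m
  show "mps_coeff (Z_EMS n) m = mps_coeff (\<Prod>i=1..n. mps_eval (fps_compose x_regular (- fps_X))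
      (\<Sum>k=i..n. mps_var k)) m"
    unfolding mps_coeff_prod_eval Z_EMS_def generating_series_def mps_coeff_Abs iterated_taylor_reflect zeta_EMS_eq
    by (simp add: fps_compose_uminus' fps_of_rat_iterate fps_of_rat_x_regular flip: fps_nth_of_rat del: upt_Suc)
qed

text \<open>The assumption is h(t) = (e^t - 1 - t e^t) / (e^t - 1)^2 with the denominator cleared.
  Multiplying the claim by the nonzero series t (1 - e^(-t)) reduces it to this equation and
  \<open>x_regular_eq\<close>, both reflected.\<close>

lemma x_regular_reflect:
  fixes h :: "'a::field_char_0 fps"
  assumes "h * (fps_exp 1 - 1) ^ 2 = fps_exp 1 - 1 - fps_X * fps_exp 1"
  shows "fps_compose x_regular (- fps_X) = Abs_fps (\<lambda>m. (- 1) ^ m / fact (m + 1)) *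
      fps_compose h (- fps_X)"
proof -
  define A where "A = (Abs_fps (\<lambda>m. (- 1) ^ m / fact (m + 1)) :: 'a fps)"
  define e where "e = fps_compose (fps_exp 1 :: 'a fps) (- fps_X)"
  define hr where "hr = fps_compose h (- fps_X)"
  define x where "x = fps_compose x_regular (- fps_X :: 'a fps)"
  note compose = fps_compose_mult_distrib fps_compose_sub_distrib fps_compose_add_distrib fps_compose_power
  have A: "fps_X * A = 1 - e"
  proof (rule fps_ext)
    fix n show "fps_nth (fps_X * A) n = fps_nth (1 - e) n"
      by (cases n) (auto simp: A_def e_def fps_compose_uminus' field_simps)
  qed
  have "fps_compose (h * (fps_exp 1 - 1) ^ 2) (- fps_X) = fps_compose (fps_exp 1 - 1 - fps_X *
      fps_exp 1) (- fps_X)"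
    using assms by simp
  then have h: "hr * (e - 1) ^ 2 = e - 1 + fps_X * e"
    by (simp add: compose e_def hr_def power2_eq_square)
  have "fps_compose (fps_X * (1 - fps_exp 1) * x_regular) (- fps_X :: 'a fps) =
      fps_compose ((1 - fps_exp 1) + fps_X * fps_exp 1) (- fps_X)"
    by (simp only: x_regular_eq)
  then have x: "- fps_X * (1 - e) * x = 1 - e - fps_X * e"
    by (simp add: compose e_def x_def)
  have "fps_nth (1 - e) 1 \<noteq> 0"
    by (simp add: e_def fps_compose_uminus')
  then have ne: "fps_X * (1 - e) \<noteq> 0" by (metis fps_zero_nth fps_X_neq_zero no_zero_divisors)
  have "fps_X * (1 - e) * (A * hr) = (fps_X * A) * (1 - e) * hr"
    by (simp add: mult_ac)
  also have "\<dots> = hr * (e - 1) ^ 2"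
    unfolding A by (simp add: algebra_simps power2_eq_square)
  also have "\<dots> = fps_X * (1 - e) * x"
    unfolding h using x by (simp add: algebra_simps)
  finally show ?thesis
    using ne unfolding A_def hr_def x_def by simp
qed

lemma Z_EMS_eq_FKMT:
  assumes "h * (fps_exp 1 - 1) ^ 2 = fps_exp 1 - 1 - fps_X * fps_exp 1"
    and "Z_FKMT n = (\<Prod>i=1..n. mps_eval h (\<Sum>k=i..n. mps_var k))"
  shows "Z_EMS n =
    (\<Prod>i=1..n. mps_eval (Abs_fps (\<lambda>m. (- 1) ^ m / fact (m + 1))) (\<Sum>k=i..n. mps_var k))
    * mps_negate_vars (Z_FKMT n)"
  unfolding Z_EMS_eq assms(2) x_regular_reflect[OF assms(1)]
  by (simp add: mps_negate_vars_prod mps_negate_vars_eval mps_negate_vars_sum_var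
      mps_eval_mult[OF mps_ord_ge_sum_var] prod.distrib)

section \<open>The limit kernel\<close>

text \<open>
  The derivative of \<open>c / (e^{cT} - 1)\<close> at \<open>c = 1\<close>.  Its removable singularity at \<open>T = 0\<close> has the value
  \<open>-1/2\<close>, while \<open>x / 0 = 0\<close> makes \<open>desing_quotient\<close> vanish there, in accordance with the junk value of
  \<^const>\<open>desing_kernel\<close>, whose limit it describes.
\<close>

definition desing_quotient :: "complex \<Rightarrow> complex" where
  "desing_quotient T = (exp T - 1 - T * exp T) / (exp T - 1) ^ 2"

definition desing_limit :: "complex \<Rightarrow> complex" where
  "desing_limit T = (if T = 0 then - 1 / 2 else desing_quotient T)"

definition desing_fps :: "complex fps" where
  "desing_fps = (fps_exp 1 - 1 - fps_X * fps_exp 1) / (fps_exp 1 - 1) ^ 2"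

section \<open>Expansion, holomorphy and decay of the limit kernel\<close>

lemma subdegree_exp_minus_1: "subdegree ((fps_exp 1 - 1 :: complex fps) ^ 2) = 2"
proof -
  have "subdegree (fps_exp 1 - 1 :: complex fps) = 1"
    by (rule subdegreeI) auto
  then show ?thesis by simp
qed

lemma subdegree_desing_numerator: "subdegree (fps_exp 1 - 1 - fps_X * fps_exp 1 :: complex fps) = 2"
proof (rule subdegreeI)
  fix i :: nat assume "i < 2"
  then have "i = 0 \<or> i = 1" by auto
  then show "fps_nth (fps_exp 1 - 1 - fps_X * fps_exp 1 :: complex fps) i = 0" by auto
qed (simp add: fps_exp_def)

lemma exp_minus_1_sq_neq_0: "(fps_exp 1 - 1 :: complex fps) ^ 2 \<noteq> 0"
  using subdegree_exp_minus_1 by force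

lemma desing_fps_eq: "desing_fps * (fps_exp 1 - 1) ^ 2 = fps_exp 1 - 1 - fps_X * fps_exp 1"
  unfolding desing_fps_def
  by (metis dvd_div_mult_self exp_minus_1_sq_neq_0 fps_dvd_iff order_refl subdegree_0 subdegree_desing_numerator subdegree_exp_minus_1 zero_neq_numeral)

text \<open>Numerator and denominator vanish to order exactly 2 at 0, with leading coefficients -1/2
  and 1; this is the origin of the value -1/2 in \<open>desing_limit\<close>.\<close>

lemma desing_limit_has_fps_expansion: "desing_limit has_fps_expansion desing_fps"
proof -
  define F G where "F = (fps_exp 1 - 1 - fps_X * fps_exp 1 :: complex fps)"
    and "G = (fps_exp 1 - 1 :: complex fps) ^ 2"
  have sub: "subdegree F = 2" "subdegree G = 2" "G \<noteq> 0"
    unfolding F_def G_def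
    by (fact subdegree_desing_numerator subdegree_exp_minus_1 exp_minus_1_sq_neq_0)+
  have G2: "fps_nth G 2 = 1"
    by (simp add: G_def power2_eq_square fps_mult_nth numeral_2_eq_2)
  have F2: "fps_nth F 2 = - 1 / 2"
    by (simp add: F_def fps_exp_def)
  have F: "(\<lambda>T. exp T - 1 - T * exp T) has_fps_expansion F"
    unfolding F_def by (intro fps_expansion_intros)
  have G: "(\<lambda>T. (exp T - 1) ^ 2) has_fps_expansion G"
    unfolding G_def by (intro fps_expansion_intros)
  have "(\<lambda>T. if T = 0 then - 1 / 2 else (exp T - 1 - T * exp T) / (exp T - 1) ^ 2) has_fps_expansion
      (F / G)"
    by (rule has_fps_expansion_divide[OF F G]) (simp_all add: sub F2 G2)
  then have "(\<lambda>T. if T = 0 then - 1 / 2 else (exp T - 1 - T *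
      exp T) / (exp T - 1) ^ 2) has_fps_expansion desing_fps"
    by (simp only: desing_fps_def F_def G_def)
  then show ?thesis
    unfolding desing_limit_def desing_quotient_def by (simp cong: if_cong)
qed

text \<open>The largest open strip symmetric about the real axis in which 0 is the only zero of exp
  z - 1.\<close>

abbreviation kernel_strip :: "complex set" where
  "kernel_strip \<equiv> {z. \<bar>Im z\<bar> < 2 * pi}"

lemma exp_neq_1: "\<bar>Im z\<bar> < 2 * pi \<Longrightarrow> z \<noteq> 0 \<Longrightarrow> exp z \<noteq> 1"
proof
  assume z: "\<bar>Im z\<bar> < 2 * pi" "z \<noteq> 0" "exp z = 1"
  then obtain n :: int where n: "Re z = 0" "Im z = of_int (2 * n) * pi"
    by (auto simp: exp_eq_1)
  then have "\<bar>of_int n\<bar> < (1::real)"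
    using z(1) by (simp add: abs_mult)
  then have "n = 0" by linarith
  then show False using z n by (simp add: complex_eq_iff)
qed

lemma desing_limit_holomorphic: "desing_limit holomorphic_on kernel_strip"
proof -
  have op: "open kernel_strip"
    by (intro open_Collect_less continuous_intros)
  have "desing_limit analytic_on {z}" if z: "\<bar>Im z\<bar> < 2 * pi" for z
  proof (cases "z = 0")
    case True
    then show ?thesis
      using has_fps_expansion_imp_analytic_0[OF desing_limit_has_fps_expansion] by simp
  next
    case False
    have op': "open (kernel_strip - {0})" by (intro open_Diff op) auto
    have "(\<lambda>T. (exp T - 1 - T * exp T) / (exp T - 1) ^ 2) holomorphic_on kernel_strip - {0}"
      by (intro holomorphic_intros) (auto dest: exp_neq_1)
    then have "desing_limit holomorphic_on kernel_strip - {0}"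
      by (rule holomorphic_transform) (auto simp: desing_limit_def desing_quotient_def)
    then have "desing_limit analytic_on kernel_strip - {0}"
      using analytic_on_open[OF op'] by blast
    then show ?thesis
      by (rule analytic_on_subset) (use z False in auto)
  qed
  then have "desing_limit analytic_on kernel_strip"
    using analytic_on_analytic_at by blast
  then show ?thesis using analytic_imp_holomorphic by blast
qed

text \<open>For large Re T the quotient behaves like T exp (-T), and half of the exponential absorbs
  the linear factor; a compact rectangle remains. The domain is larger than in
  \<open>kernel_bound\<close> so as to contain c T for 0 < c < 3/2.\<close>

lemma desing_limit_bound: "\<exists>C>0. \<forall>T. \<bar>Im T\<bar> \<le> 2 \<longrightarrow> Re T \<ge> -2 \<longrightarrow> norm (desing_limit T)
    \<le> C * exp (- Re T / 2)"
proof -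
  define K where "K = cbox (Complex (-2) (-2)) (Complex 2 2)"
  have pi2: "2 < 2 * pi" using pi_gt3 by linarith
  have "K \<subseteq> kernel_strip"
    using pi2 by (auto simp: K_def in_cbox_complex_iff)
  then have "continuous_on K desing_limit"
    using desing_limit_holomorphic holomorphic_on_imp_continuous_on continuous_on_subset by blast
  moreover have "compact K" by (simp add: K_def)
  ultimately have "bounded (desing_limit ` K)"
    using compact_continuous_image compact_imp_bounded by blast
  then obtain B where B: "B > 0" "\<And>T. T \<in> K \<Longrightarrow> norm (desing_limit T) \<le> B"
    by (auto simp: bounded_pos)
  have large: "norm (desing_limit T) \<le> 24 * exp (- Re T / 2)" if "Re T > 2" "\<bar>Im T\<bar> \<le> 2" for T
  proof -
    define x where "x = Re T"
    have x: "x > 2" using that by (simp add: x_def)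
    have e2: "exp x \<ge> 2"
      using exp_ge_add_one_self[of x] x by linarith
    have D: "norm (exp T - 1) \<ge> exp x / 2"
      using norm_triangle_ineq2[of "exp T" 1] e2 by (simp add: x_def)
    have "norm T \<le> x + 2"
      using cmod_le[of T] that by (simp add: x_def)
    also have "\<dots> \<le> 4 * exp (x / 2)"
      using exp_ge_add_one_self[of "x / 2"] x by linarith
    finally have T: "norm T \<le> 4 * exp (x / 2)" .
    have "norm (exp T - 1 - T * exp T) \<le> norm (exp T - 1) + norm (T * exp T)"
      by (rule norm_triangle_ineq4)
    also have "\<dots> \<le> (exp x + 1) + 4 * exp (x / 2) * exp x"
      using norm_triangle_ineq4[of "exp T" 1] T
          by (auto simp: norm_mult x_def intro!: add_mono mult_right_mono)
    also have "\<dots> \<le> 6 * exp (x / 2) * exp x"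
    proof -
      have "exp (x / 2) \<ge> 1" using x by simp
      then have "exp x * 1 \<le> exp x * exp (x / 2)" by (intro mult_left_mono) auto
      then show ?thesis using e2 unfolding mult.commute[of "exp x"] by linarith
    qed
    finally have N: "norm (exp T - 1 - T * exp T) \<le> 6 * exp (x / 2) * exp x" .
    have "norm (desing_limit T) = norm (exp T - 1 - T * exp T) / norm (exp T - 1) ^ 2"
      using that by (auto simp: desing_limit_def desing_quotient_def norm_divide norm_power)
    also have "\<dots> \<le> 6 * exp (x / 2) * exp x / (exp x / 2) ^ 2"
      using N D by (intro frac_le power_mono) auto
    also have "\<dots> = 24 * exp (- x / 2)"
    proof -
      have "exp x = exp (x / 2) ^ 2"
        using exp_double[of "x / 2"] by simp
      moreover have "exp (- x / 2) = inverse (exp (x / 2))"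
        by (simp add: exp_minus)
      moreover have "6 * a * a ^ 2 / (a ^ 2 / 2) ^ 2 = 24 * inverse a" if "a > 0" for a :: real
        using that by (simp add: field_simps power2_eq_square)
      ultimately show ?thesis by (metis exp_gt_zero)
    qed
    finally show ?thesis by (simp add: x_def)
  qed
  show ?thesis
  proof (intro exI[of _ "B * exp 1 + 24"] conjI allI impI)
    show "B * exp 1 + 24 > 0" using B by (auto intro: add_pos_pos)
    fix T assume T: "\<bar>Im T\<bar> \<le> 2" "Re T \<ge> -2"
    show "norm (desing_limit T) \<le> (B * exp 1 + 24) * exp (- Re T / 2)"
    proof (cases "Re T \<le> 2")
      case True
      then have "T \<in> K" using T by (auto simp: K_def in_cbox_complex_iff)
      then have "norm (desing_limit T) \<le> B * 1" using B by auto
      also have "\<dots> \<le> B * exp (1 - Re T / 2)" using True B by (intro mult_left_mono) auto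
      also have "\<dots> = (B * exp 1) * exp (- Re T / 2)" by (simp add: mult.assoc flip: exp_add)
      also have "\<dots> \<le> (B * exp 1 + 24) * exp (- Re T / 2)" by (intro mult_right_mono) auto
      finally show ?thesis .
    next
      case False
      then have "norm (desing_limit T) \<le> 24 * exp (- Re T / 2)" using large T by simp
      also have "\<dots> \<le> (B * exp 1 + 24) * exp (- Re T / 2)" using B by (intro mult_right_mono) auto
      finally show ?thesis .
    qed
  qed
qed

text \<open>
  The exponential bound is used for the factor that sees all variables, the constant bound for the
  other factors.
\<close>

definition kernel_bound :: "real \<Rightarrow> (complex \<Rightarrow> complex) \<Rightarrow> bool" where
  "kernel_bound C q \<longleftrightarrow> (\<forall>T. \<bar>Im T\<bar> \<le> 1 \<longrightarrow> Re T \<ge> -1 \<longrightarrow>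
     norm (q T) \<le> C \<and> norm (q T) \<le> C * exp (- Re T / 4))"

text \<open>One factor of \<open>desing_kernel\<close> with its share of the prefactor
  \<open>1 / (1 - c) ^ n\<close>: a difference quotient at c = 1 of the function c / (exp (c T) -
  1).\<close>

definition desing_factor :: "real \<Rightarrow> complex \<Rightarrow> complex" where
  "desing_factor c T = (1 / (exp T - 1) - of_real c / (exp (of_real c * T) - 1)) / (1 - of_real c)"

lemma desing_factor_deriv:
  assumes "exp (c * T) \<noteq> (1::complex)"
  shows "((\<lambda>c. c / (exp (c * T) - 1)) has_field_derivative desing_quotient (c * T)) (at c)"
  using assms unfolding desing_quotient_def
  by (auto intro!: derivative_eq_intros simp: power2_eq_square divide_simps algebra_simps)

lemma desing_factor_tendsto:
  assumes "\<bar>Im T\<bar> < 2 * pi"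
  shows "((\<lambda>c. desing_factor c T) \<longlongrightarrow> desing_quotient T) (at 1)"
proof (cases "T = 0")
  case True
  then show ?thesis by (simp add: desing_factor_def desing_quotient_def)
next
  case False
  define f where "f = (\<lambda>c. c / (exp (c * T) - 1))"
  have "(f has_field_derivative desing_quotient (1 * T)) (at 1)"
    unfolding f_def using exp_neq_1[OF assms False] by (intro desing_factor_deriv) auto
  then have "((\<lambda>y. (f y - f 1) / (y - 1)) \<longlongrightarrow> desing_quotient T) (at 1)"
    by (simp add: has_field_derivative_iff)
  moreover have "filterlim complex_of_real (at 1) (at 1)"
    by (auto simp: filterlim_at eventually_at_filter intro!: tendsto_eq_intros)
  ultimately have "((\<lambda>c. (f (of_real c) - f 1) / (of_real c - 1)) \<longlongrightarrow> desing_quotient T) (at 1)"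
    by (rule filterlim_compose)
  moreover have "(f (of_real c) - f 1) / (of_real c - 1) = desing_factor c T" for c
    unfolding desing_factor_def f_def
        by (simp add: minus_divide_left[symmetric] minus_divide_divide[of _ "1 - of_real c",
        symmetric] del: minus_divide_divide)
  ultimately show ?thesis by simp
qed

text \<open>The function c / (exp (c T) - 1) has the derivative
  \<open>desing_quotient (c * T)\<close> in c, so the mean value inequality bounds its difference
  quotients uniformly in c. Dominated convergence for c \<rightarrow> 1 rests on this
  uniformity.\<close>

lemma kernel_bounds:
  obtains C where "C > 0" "kernel_bound C desing_limit" "kernel_bound C desing_quotient"
    "\<And>c. \<bar>c - 1\<bar> < 1 / 2 \<Longrightarrow> kernel_bound C (desing_factor c)"
proof -
  obtain C where C: "C > 0" "\<And>T. \<bar>Im T\<bar> \<le> 2 \<Longrightarrow> Re T \<ge> -2 \<Longrightarrow> norm (desing_limit T) \<le> C * exp (- Re T / 2)"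
    using desing_limit_bound by blast
  define C' where "C' = C * exp 1"
  have C': "C' > 0" using C by (simp add: C'_def)
  \<comment> \<open>Since c > 1/2, the rate 1/2 drops to 1/4. For negative real part c Re T \<ge>
    -3/2, which the extra factor exp 1 in C' absorbs.\<close>
  have scaled: "norm (desing_limit (of_real c * T)) \<le> C' \<and> norm (desing_limit (of_real c * T))
      \<le> C' * exp (- Re T / 4)"
    if c: "\<bar>c - 1\<bar> < 1 / 2" and T: "\<bar>Im T\<bar> \<le> 1" "Re T \<ge> -1" for c :: real and T
  proof -
    have c': "1 / 2 < c" "c < 3 / 2" using c by linarith+
    have "\<bar>c * Im T\<bar> \<le> (3 / 2) * 1"
      unfolding abs_mult using c' T by (intro mult_mono) auto
    moreover have neg: "c * Re T \<ge> - (3 / 2)"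
    proof (cases "Re T \<ge> 0")
      case True
      then have "c * Re T \<ge> 0" using c' by simp
      then show ?thesis by linarith
    next
      case False
      have "c * (- Re T) \<le> (3 / 2) * 1" using c' T False by (intro mult_mono) auto
      then show ?thesis by simp
    qed
    ultimately have 1: "norm (desing_limit (of_real c * T)) \<le> C * exp (- (c * Re T) / 2)"
      using C(2)[of "of_real c * T"] by simp
    also have "\<dots> \<le> C * exp 1" using C neg by (intro mult_left_mono) auto
    finally have 2: "norm (desing_limit (of_real c * T)) \<le> C'" by (simp add: C'_def)
    have "- (c * Re T) / 2 \<le> 1 + (- Re T / 4)"
    proof (cases "Re T \<ge> 0")
      case True
      then have "(1 / 2) * Re T \<le> c * Re T" using c' by (intro mult_right_mono) auto
      then show ?thesis by simp
    next
      case False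
      then show ?thesis using neg by simp
    qed
    then have "C * exp (- (c * Re T) / 2) \<le> C * exp (1 + (- Re T / 4))"
      using C by (intro mult_left_mono) auto
    also have "C * exp (1 + (- Re T / 4)) = C' * exp (- Re T / 4)"
      unfolding C'_def exp_add by simp
    finally have "norm (desing_limit (of_real c * T)) \<le> C' * exp (- Re T / 4)"
      using 1 by (rule order_trans[rotated])
    with 2 show ?thesis by blast
  qed
  have le: "norm (desing_quotient T) \<le> norm (desing_limit T)" for T
    by (simp add: desing_limit_def desing_quotient_def)
  have desing_limit: "kernel_bound C' desing_limit"
    using scaled[of 1] by (simp add: kernel_bound_def)
  then have "kernel_bound C' desing_quotient"
    unfolding kernel_bound_def using le order_trans by blast
  moreover have "kernel_bound C' (desing_factor c)" if c: "\<bar>c - 1\<bar> < 1 / 2" for c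
    unfolding kernel_bound_def
  proof (intro allI impI)
    fix T assume T: "\<bar>Im T\<bar> \<le> 1" "Re T \<ge> -1"
    \<comment> \<open>With the minimum, a single application of the mean value inequality gives both
      bounds.\<close>
    define M where "M = min C' (C' * exp (- Re T / 4))"
    have M: "M \<ge> 0" using C' by (simp add: M_def)
    have "norm (desing_factor c T) \<le> M"
    proof (cases "T = 0 \<or> c = 1")
      case True
      then show ?thesis using M by (auto simp: desing_factor_def)
    next
      case False
      define f where "f = (\<lambda>c. c / (exp (c * T) - 1))"
      \<comment> \<open>The inequality is applied in a complex variable c, along a real segment
        regarded as a convex set in the plane.\<close>
      define S where "S = complex_of_real ` {1/2<..<3/2}"
      have S: "convex S" unfolding S_def by (intro convex_linear_image convex_real_interval)
          (auto intro: linear_of_real bounded_linear.linear bounded_linear_of_real)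
      have "norm (f 1 - f (of_real c)) \<le> M * norm (1 - complex_of_real c)"
      proof (rule field_differentiable_bound[OF S])
        fix z assume "z \<in> S"
        then obtain r where r: "z = of_real r" "1/2 < r" "r < 3/2" by (auto simp: S_def)
        have "\<bar>r * Im T\<bar> \<le> (3 / 2) * 1"
          unfolding abs_mult using r T by (intro mult_mono) auto
        then have "\<bar>Im (z * T)\<bar> < 2 * pi" using r pi_gt3 by simp
        moreover have "z * T \<noteq> 0" using r False by auto
        ultimately have "exp (z * T) \<noteq> 1" by (rule exp_neq_1)
        then show "(f has_field_derivative desing_quotient (z * T)) (at z within S)"
          unfolding f_def
            by (rule has_field_derivative_at_within[OF desing_factor_deriv])
        have "norm (desing_limit (z * T)) \<le> M"
        proof -
          have "\<bar>r - 1\<bar> < 1 / 2" using r by linarith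
          from scaled[OF this T] show ?thesis by (simp add: M_def r)
        qed
        then show "norm (desing_quotient (z * T)) \<le> M" using le order_trans by blast
      next
        have "c > 1 / 2" "c < 3 / 2" using c by linarith+
        then have "c \<in> {1/2<..<3/2}" by simp
        then show "of_real c \<in> S" by (simp add: S_def)
        show "1 \<in> S" unfolding S_def by (rule image_eqI[of _ _ 1]) auto
      qed
      moreover have "desing_factor c T = (f 1 - f (of_real c)) / (1 - of_real c)"
        by (simp add: desing_factor_def f_def)
      moreover have "norm (1 - complex_of_real c) > 0" using False by simp
      ultimately show ?thesis by (simp add: norm_divide divide_le_eq)
    qed
    then show "norm (desing_factor c T) \<le> C' \<and> norm (desing_factor c T) \<le> C' * exp (- Re T / 4)"
      by (simp add: M_def)
  qed
  ultimately show ?thesis using that C' desing_limit by blast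
qed

section \<open>Integrals over products of paths\<close>

text \<open>The constant 1/(n+1) is chosen so that a sum of at most n such points lies in the domain
  of \<open>kernel_bound\<close>.\<close>

definition in_strip :: "nat \<Rightarrow> complex \<Rightarrow> bool" where
  "in_strip n t \<longleftrightarrow> \<bar>Im t\<bar> \<le> 1 / (real n + 1) \<and> Re t \<ge> - (1 / (real n + 1))"

lemma in_strip_sum:
  assumes "\<And>k. k \<in> A \<Longrightarrow> in_strip n (t k)" "card A \<le> n"
  shows "\<bar>Im (\<Sum>k\<in>A. t k)\<bar> \<le> 1" "Re (\<Sum>k\<in>A. t k) \<ge> - 1"
proof -
  have le: "real (card A) * (1 / (real n + 1)) \<le> 1"
    using assms(2) by (simp add: field_simps)
  have "\<bar>Im (\<Sum>k\<in>A. t k)\<bar> \<le> (\<Sum>k\<in>A. \<bar>Im (t k)\<bar>)" by (simp add: sum_abs)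
  also have "\<dots> \<le> real (card A) * (1 / (real n + 1))"
    using assms(1) by (intro sum_bounded_above) (auto simp: in_strip_def)
  finally show "\<bar>Im (\<Sum>k\<in>A. t k)\<bar> \<le> 1" using le by linarith
  have "(\<Sum>k\<in>A. - Re (t k)) \<le> real (card A) * (1 / (real n + 1))"
    using assms(1) by (intro sum_bounded_above) (force simp: in_strip_def)
  then show "Re (\<Sum>k\<in>A. t k) \<ge> - 1" using le
      by (simp add: sum_negf del: times_divide_eq_right mult_1_right)
qed

text \<open>Kernels, paths and weights may differ from one coordinate to the next; this allows the
  contour to be exchanged in a single coordinate.\<close>

definition chain :: "nat \<Rightarrow> (nat \<Rightarrow> complex \<Rightarrow> complex) \<Rightarrow> (nat \<Rightarrow> real \<Rightarrow> complex) \<Rightarrow>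
    (nat \<Rightarrow> real \<Rightarrow> complex) \<Rightarrow> (nat \<Rightarrow> real) \<Rightarrow> complex" where
  "chain n Q P w \<tau> = (\<Prod>j=1..n. Q j (\<Sum>k=j..n. P k (\<tau> k))) * (\<Prod>k=1..n. w k (\<tau> k))"

text \<open>In the last condition, exp (- Re / 4) is the decay that the kernel hands to each
  coordinate; together with it the weight has to be integrable over the parameter line.\<close>

definition path_weight :: "nat \<Rightarrow> real \<Rightarrow> (real \<Rightarrow> complex) \<Rightarrow> (real \<Rightarrow> complex) \<Rightarrow> bool" where
  "path_weight n K P w \<longleftrightarrow> P \<in> borel_measurable borel \<and> w \<in> borel_measurable borel \<and>
     (\<forall>x. in_strip n (P x)) \<and> (\<forall>x. exp (- Re (P x) / 4) * norm (w x) \<le> K * exp (- \<bar>x\<bar> / 8))"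

abbreviation lborel_n :: "nat \<Rightarrow> (nat \<Rightarrow> real) measure" where
  "lborel_n n \<equiv> (\<Pi>\<^sub>M k\<in>{1..n}. lborel)"

text \<open>Only the factor j = 1 is estimated with decay: its argument is the sum over all
  coordinates, so its exponential splits into one factor per coordinate. The other factors are
  bounded by C.\<close>

lemma norm_chain_le:
  assumes n: "n \<ge> 1" and C: "C \<ge> 0" "\<And>j. j \<in> {1..n} \<Longrightarrow> kernel_bound C (Q j)"
    and pw: "\<And>k. k \<in> {1..n} \<Longrightarrow> path_weight n K (P k) (w k)"
  shows "norm (chain n Q P w \<tau>) \<le> C ^ n * (\<Prod>k=1..n. K * exp (- \<bar>\<tau> k\<bar> / 8))"
proof -
  define T where "T = (\<lambda>j. \<Sum>k=j..n. P k (\<tau> k))"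
  have strip: "in_strip n (P k (\<tau> k))" if "k \<in> {1..n}" for k
    using pw[OF that] by (simp add: path_weight_def)
  have T: "\<bar>Im (T j)\<bar> \<le> 1" "Re (T j) \<ge> -1" if "j \<in> {1..n}" for j
    unfolding T_def using that by (intro in_strip_sum[where n = n] strip; auto)+
  have "norm (\<Prod>j=1..n. Q j (T j)) \<le> (\<Prod>j=1..n. C * (if j = 1 then exp (- Re (T 1) / 4) else 1))"
    using C(2) T by (auto simp: prod_norm[symmetric] kernel_bound_def intro!: prod_mono)
  also have "\<dots> = C ^ n * exp (- Re (T 1) / 4)"
    using n by (simp add: prod.distrib prod.delta)
  also have "exp (- Re (T 1) / 4) = (\<Prod>k=1..n. exp (- Re (P k (\<tau> k)) / 4))"
    by (simp add: T_def exp_sum[symmetric] sum_negf sum_divide_distrib)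
  finally have 1: "norm (\<Prod>j=1..n. Q j (T j)) \<le> C ^ n * (\<Prod>k=1..n. exp (- Re (P k (\<tau> k)) / 4))" .
  have "norm (chain n Q P w \<tau>) = norm (\<Prod>j=1..n. Q j (T j)) * (\<Prod>k=1..n. norm (w k (\<tau> k)))"
    by (simp add: chain_def T_def norm_mult prod_norm[symmetric])
  also have "\<dots> \<le> C ^ n * (\<Prod>k=1..n. exp (- Re (P k (\<tau> k)) / 4)) * (\<Prod>k=1..n. norm (w k (\<tau> k)))"
    using 1 by (intro mult_right_mono prod_nonneg) auto
  also have "\<dots> = C ^ n * (\<Prod>k=1..n. exp (- Re (P k (\<tau> k)) / 4) * norm (w k (\<tau> k)))"
    by (simp add: prod.distrib)
  also have "\<dots> \<le> C ^ n * (\<Prod>k=1..n. K * exp (- \<bar>\<tau> k\<bar> / 8))"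
    using C(1) pw by (intro mult_left_mono prod_mono) (auto simp: path_weight_def)
  finally show ?thesis .
qed

lemma chain_measurable [measurable]:
  assumes "\<And>j. j \<in> {1..n} \<Longrightarrow> Q j \<in> borel_measurable borel"
    and "\<And>k. k \<in> {1..n} \<Longrightarrow> path_weight n K (P k) (w k)"
  shows "chain n Q P w \<in> borel_measurable (lborel_n n)"
proof -
  have comp: "(\<lambda>\<tau>. f (\<tau> k)) \<in> borel_measurable (lborel_n n)"
    if "f \<in> borel_measurable borel" "k \<in> {1..n}" for f :: "real \<Rightarrow> complex" and k
    using that by measurable
  have P: "(\<lambda>\<tau>. P k (\<tau> k)) \<in> borel_measurable (lborel_n n)" if "k \<in> {1..n}" for k
    using assms(2)[OF that] that by (intro comp) (auto simp: path_weight_def)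
  have w: "(\<lambda>\<tau>. w k (\<tau> k)) \<in> borel_measurable (lborel_n n)" if "k \<in> {1..n}" for k
    using assms(2)[OF that] that by (intro comp) (auto simp: path_weight_def)
  show ?thesis
    unfolding chain_def
    by (intro borel_measurable_times borel_measurable_prod w
        measurable_compose[OF _ assms(1)] borel_measurable_sum P) auto
qed

lemma integrable_exp_minus_abs: "integrable lborel (\<lambda>x::real. exp (- \<bar>x\<bar> / 8))"
proof -
  have "(\<lambda>x::real. exp (- (1 / 8) * x)) integrable_on {0..}"
    using integrable_on_exp_minus_to_infinity[of "1 / 8" 0] by simp
  then have "(\<lambda>x::real. exp (- (1 / 8) * x)) absolutely_integrable_on {0..}"
    by (intro nonnegative_absolutely_integrable_1) auto
  then have r: "set_integrable lborel {0..} (\<lambda>x::real. exp (- (1 / 8) * x))"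
    by (subst (asm) set_integrable_def, subst set_integrable_def,
        subst (asm) integrable_completion) auto
  have i1: "integrable lborel (\<lambda>x::real. indicator {0..} x * exp (- (1 / 8) * x))"
    using r by (simp add: set_integrable_def)
  then have "integrable lborel (\<lambda>x::real. indicator {0..} (0 + (-1) * x) * exp (- (1 / 8) * (0 +
      (-1) * x)))"
    by (intro lborel_integrable_real_affine) auto
  then have "integrable lborel (\<lambda>x::real. indicator {0..} x * exp (- (1 / 8) * x) +
      indicator {0..} (0 + (-1) * x) * exp (- (1 / 8) * (0 + (-1) * x)))"
    by (intro Bochner_Integration.integrable_add i1)
  then show ?thesis
    by (rule Bochner_Integration.integrable_bound) (auto intro!: AE_I2 simp: indicator_def)
qed

lemma product_sigma_finite_lborel: "product_sigma_finite (\<lambda>_::nat. lborel :: real measure)"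
  by (simp add: product_sigma_finite_def lborel.sigma_finite_measure_axioms)

lemma integrable_prod_exp:
  "integrable (lborel_n n) (\<lambda>\<tau>. B * (\<Prod>k=1..n. (K::real) * exp (- \<bar>\<tau> k\<bar> / 8)))"
proof -
  interpret product_sigma_finite "\<lambda>_::nat. lborel :: real measure"
    by (rule product_sigma_finite_lborel)
  show ?thesis
    by (intro integrable_mult_right product_integrable_prod)
       (use integrable_exp_minus_abs in auto)
qed

lemma integrable_chain:
  assumes "n \<ge> 1" "C \<ge> 0" "\<And>j. j \<in> {1..n} \<Longrightarrow> kernel_bound C (Q j)"
    and "\<And>j. j \<in> {1..n} \<Longrightarrow> Q j \<in> borel_measurable borel"
    and "\<And>k. k \<in> {1..n} \<Longrightarrow> path_weight n K (P k) (w k)"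
  shows "integrable (lborel_n n) (chain n Q P w)"
proof (rule Bochner_Integration.integrable_bound[OF integrable_prod_exp])
  show "chain n Q P w \<in> borel_measurable (lborel_n n)"
    using assms(4,5) by (rule chain_measurable)
  show "AE \<tau> in lborel_n n. norm (chain n Q P w \<tau>) \<le> norm (C ^ n * (\<Prod>k=1..n. K * exp (- \<bar>\<tau> k\<bar> / 8)))"
    by (rule AE_I2, rule order_trans[OF norm_chain_le[OF assms(1-3,5)]]) auto
qed

lemma chain_dominated_convergence:
  assumes "n \<ge> 1" "C \<ge> 0" "\<And>m j. j \<in> {1..n} \<Longrightarrow> kernel_bound C (Q m j)"
    and "\<And>m j. j \<in> {1..n} \<Longrightarrow> Q m j \<in> borel_measurable borel"
    and "\<And>j. j \<in> {1..n} \<Longrightarrow> Q' j \<in> borel_measurable borel"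
    and "\<And>m k. k \<in> {1..n} \<Longrightarrow> path_weight n K (P k) (w m k)"
    and "\<And>k. k \<in> {1..n} \<Longrightarrow> path_weight n K (P k) (w' k)"
    and "\<And>j T. j \<in> {1..n} \<Longrightarrow> \<bar>Im T\<bar> \<le> 1 \<Longrightarrow> Re T \<ge> - 1 \<Longrightarrow> (\<lambda>m. Q m j T) \<longlonglongrightarrow> Q' j T"
    and "\<And>k x. k \<in> {1..n} \<Longrightarrow> (\<lambda>m. w m k x) \<longlonglongrightarrow> w' k x"
  shows "(\<lambda>m. integral\<^sup>L (lborel_n n) (chain n (Q m) P (w m))) \<longlonglongrightarrow> integral\<^sup>L (lborel_n n)
      (chain n Q' P w')"
proof (rule integral_dominated_convergence[OF _ _ integrable_prod_exp])
  show "chain n Q' P w' \<in> borel_measurable (lborel_n n)"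
    using assms(5,7) by (rule chain_measurable)
  show "chain n (Q m) P (w m) \<in> borel_measurable (lborel_n n)" for m
    using assms(4,6) by (rule chain_measurable)
  show "AE \<tau> in lborel_n n. norm (chain n (Q m) P (w m) \<tau>) \<le> C ^ n * (\<Prod>k=1..n. K * exp
      (- \<bar>\<tau> k\<bar> / 8))" for m
    by (rule AE_I2, rule norm_chain_le[OF assms(1-3,6)])
  show "AE \<tau> in lborel_n n. (\<lambda>m. chain n (Q m) P (w m) \<tau>) \<longlonglongrightarrow> chain n Q' P w' \<tau>"
  proof (rule AE_I2)
    fix \<tau> :: "nat \<Rightarrow> real"
    have "in_strip n (P k (\<tau> k))" if "k \<in> {1..n}" for k
      using assms(7)[OF that] by (simp add: path_weight_def)
    then have "\<bar>Im (\<Sum>k=j..n. P k (\<tau> k))\<bar> \<le> 1" "Re (\<Sum>k=j..n. P k (\<tau> k)) \<ge> -1" if "j \<in> {1..n}" for j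
      using that by (intro in_strip_sum[where n = n]; auto)+
    then show "(\<lambda>m. chain n (Q m) P (w m) \<tau>) \<longlonglongrightarrow> chain n Q' P w' \<tau>"
      unfolding chain_def by (intro tendsto_mult tendsto_prod assms(8,9))
  qed
qed

text \<open>Cauchy's estimate on discs of radius 1/2 inside \<open>cball z0 1\<close> bounds the
  derivative by 2 B, hence also the difference quotients near z0, and dominated convergence allows
  differentiation under the integral.\<close>

lemma holomorphic_integral:
  fixes f :: "complex \<Rightarrow> 'a \<Rightarrow> complex"
  assumes meas: "\<And>z. f z \<in> borel_measurable M"
    and hol: "\<And>x. x \<in> space M \<Longrightarrow> (\<lambda>z. f z x) holomorphic_on UNIV"
    and dom: "\<And>z0. \<exists>B. integrable M B \<and> (\<forall>z\<in>cball z0 1. \<forall>x\<in>space M. norm (f z x) \<le> B x)"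
  shows "(\<lambda>z. integral\<^sup>L M (f z)) holomorphic_on UNIV"
proof -
  have "\<exists>D. ((\<lambda>z. integral\<^sup>L M (f z)) has_field_derivative D) (at z0)" for z0
  proof -
    obtain B where B: "integrable M B" "\<And>z x. z \<in> cball z0 1 \<Longrightarrow> x \<in> space M \<Longrightarrow> norm (f z x) \<le> B x"
      using dom[of z0] by auto
    have integrable: "integrable M (f z)" if "z \<in> cball z0 1" for z
      by (rule Bochner_Integration.integrable_bound[OF B(1) meas])
         (rule AE_I2, use order_trans[OF B(2)[OF that] abs_ge_self] in simp)
    define D where "D = (\<lambda>x. deriv (\<lambda>z. f z x) z0)"
    have deriv: "((\<lambda>z. f z x) has_field_derivative deriv (\<lambda>z. f z x) z) (at z)" if "x \<in> space M" for x z
      using hol[OF that] by (auto intro: holomorphic_derivI[of _ UNIV])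
    define q where "q = (\<lambda>h x. (f (z0 + h) x - f z0 x) / h)"
    have q_bound: "norm (q h x) \<le> 2 * B x" if h: "norm h \<le> 1 / 2" "h \<noteq> 0" and x: "x \<in> space M" for h x
    proof -
      have "norm (deriv (\<lambda>z. f z x) z) \<le> 2 * B x" if z: "z \<in> cball z0 (1 / 2)" for z
      proof -
        have sub: "cball z (1 / 2) \<subseteq> cball z0 1"
        proof
          fix y assume "y \<in> cball z (1 / 2)"
          then show "y \<in> cball z0 1"
            using z dist_triangle[of z0 y z] by (simp add: dist_commute)
        qed
        have "norm ((deriv ^^ 1) (\<lambda>z. f z x) z) \<le> (fact 1) * B x / (1 / 2) ^ 1"
        proof (rule Cauchy_inequality)
          show "(\<lambda>z. f z x) holomorphic_on ball z (1 / 2)"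
            by (rule holomorphic_on_subset[OF hol[OF x]]) simp
          show "continuous_on (cball z (1 / 2)) (\<lambda>z. f z x)"
            by (rule continuous_on_subset[OF holomorphic_on_imp_continuous_on[OF hol[OF x]]]) simp
          fix y assume "norm (z - y) = 1 / 2"
          then have "y \<in> cball z (1 / 2)" by (simp add: dist_norm)
          then have "y \<in> cball z0 1" using sub by (rule subsetD[rotated])
          then show "norm (f y x) \<le> B x" using x by (rule B(2))
        qed auto
        then show ?thesis by simp
      qed
      then have "norm (f (z0 + h) x - f z0 x) \<le> 2 * B x * norm (z0 + h - z0)"
        using h by (intro field_differentiable_bound[of "cball z0 (1 / 2)" _ "deriv (\<lambda>z. f z x)",
            OF _ has_field_derivative_at_within[OF deriv[OF x]]]) (auto simp: dist_norm)
      then show ?thesis using h by (simp add: q_def norm_divide divide_le_eq)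
    qed
    have q_lim: "((\<lambda>h. q h x) \<longlongrightarrow> D x) (at 0)" if "x \<in> space M" for x
      using deriv[OF that, of z0] by (simp add: q_def D_def DERIV_def)
    have D_meas: "D \<in> borel_measurable M"
    proof (rule borel_measurable_LIMSEQ_metric)
      show "(\<lambda>x. q (of_real (1 / real (Suc m))) x) \<in> borel_measurable M" for m
        unfolding q_def by (intro borel_measurable_divide borel_measurable_diff meas) auto
      fix x assume x: "x \<in> space M"
      have "(\<lambda>m. complex_of_real (1 / real (Suc m))) \<longlonglongrightarrow> of_real 0"
        by (intro tendsto_of_real LIMSEQ_Suc lim_1_over_n)
      then have "filterlim (\<lambda>m. complex_of_real (1 / real (Suc m))) (at 0) sequentially"
        by (auto simp: filterlim_at simp del: of_nat_Suc intro!: always_eventually)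
      then show "(\<lambda>m. q (of_real (1 / real (Suc m))) x) \<longlonglongrightarrow> D x"
        using filterlim_compose[OF q_lim[OF x]] by blast
    qed
    have "((\<lambda>h. integral\<^sup>L M (q h)) \<longlongrightarrow> integral\<^sup>L M D) (at 0)"
      unfolding tendsto_at_iff_sequentially comp_def
    proof (intro allI impI)
      fix X :: "nat \<Rightarrow> complex" assume X: "\<forall>i. X i \<in> UNIV - {0}" "X \<longlonglongrightarrow> 0"
      have "\<forall>\<^sub>F m in sequentially. norm (X m) < 1 / 2"
        using X(2) by (intro order_tendstoD(2)[OF tendsto_norm_zero]) auto
      then obtain N where N: "\<And>m. m \<ge> N \<Longrightarrow> norm (X m) < 1 / 2"
        by (auto simp: eventually_sequentially)
      have "(\<lambda>m. integral\<^sup>L M (q (X (m + N)))) \<longlonglongrightarrow> integral\<^sup>L M D"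
      proof (rule integral_dominated_convergence[OF D_meas])
        show "q (X (m + N)) \<in> borel_measurable M" for m
          unfolding q_def by (intro borel_measurable_divide borel_measurable_diff meas) auto
        show "integrable M (\<lambda>x. 2 * B x)" using B(1) by simp
        show "AE x in M. norm (q (X (m + N)) x) \<le> 2 * B x" for m
          using X(1) N[of "m + N"] by (intro AE_I2 q_bound) auto
        have "filterlim (\<lambda>m. X (m + N)) (at 0) sequentially"
          using X LIMSEQ_ignore_initial_segment[OF X(2), of N] by (auto simp: filterlim_at)
        then show "AE x in M. (\<lambda>m. q (X (m + N)) x) \<longlonglongrightarrow> D x"
          using filterlim_compose[OF q_lim] by (intro AE_I2) blast
      qed
      then show "(\<lambda>m. integral\<^sup>L M (q (X m))) \<longlonglongrightarrow> integral\<^sup>L M D"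
        by (rule LIMSEQ_offset)
    qed
    moreover have "\<forall>\<^sub>F h in at 0. integral\<^sup>L M (q h) = (integral\<^sup>L M (f (z0 + h)) - integral\<^sup>L M
        (f z0)) / h"
    proof -
      have "integral\<^sup>L M (q h) = (integral\<^sup>L M (f (z0 + h)) - integral\<^sup>L M (f z0)) / h"
          if "norm h < 1" for h
        unfolding q_def using that by (simp add: Bochner_Integration.integral_diff integrable dist_norm)
      moreover have "\<forall>\<^sub>F h in at 0. norm (h :: complex) < 1"
        using eventually_at_ball[of 1 "0::complex" UNIV] by (auto elim: eventually_mono)
      ultimately show ?thesis by (auto elim: eventually_mono)
    qed
    ultimately have "((\<lambda>h. (integral\<^sup>L M (f (z0 + h)) - integral\<^sup>L M (f z0)) / h) \<longlongrightarrow> integral\<^sup>L M D)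
        (at 0)"
      by (rule Lim_transform_eventually)
    then show ?thesis by (auto simp: DERIV_def)
  qed
  then show ?thesis
    by (simp add: holomorphic_on_open) 
qed

section \<open>The Hankel contour and its regularization\<close>

text \<open>For t \<ge> 1 this is ln (t d) \<le> t d - 1 with d so small that M d \<le> 1/8. The
  slope 1/8 is the gap between the rates 1/4 and 1/8 in \<open>path_weight\<close>.\<close>

lemma ln_growth:
  assumes "e > 0" "M \<ge> 0"
  obtains K where "\<And>t. t \<ge> e \<Longrightarrow> M * \<bar>ln t\<bar> \<le> t / 8 + (K::real)"
proof -
  define d where "d = 1 / (8 * (M + 1))"
  have d: "d > 0" "M * d \<le> 1 / 8" using assms by (auto simp: d_def field_simps)
  have "M * \<bar>ln t\<bar> \<le> t / 8 + M * (\<bar>ln d\<bar> + \<bar>ln e\<bar>)" if t: "t \<ge> e" for t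
  proof (cases "t \<ge> 1")
    case True
    have "ln (t * d) \<le> t * d - 1"
      using d True by (intro ln_le_minus_one) auto
    then have "\<bar>ln t\<bar> \<le> t * d + (\<bar>ln d\<bar> + \<bar>ln e\<bar>)"
      using d True by (simp add: ln_mult)
    then have "M * \<bar>ln t\<bar> \<le> M * (t * d + (\<bar>ln d\<bar> + \<bar>ln e\<bar>))"
      using assms by (intro mult_left_mono) auto
    also have "\<dots> = (M * d) * t + M * (\<bar>ln d\<bar> + \<bar>ln e\<bar>)"
      by (simp add: algebra_simps)
    also have "(M * d) * t \<le> (1 / 8) * t" using d True by (intro mult_right_mono) auto
    finally show ?thesis by simp
  next
    case False
    then have "ln e \<le> ln t" "ln t \<le> 0"
      using t assms by auto
    then have "\<bar>ln t\<bar> \<le> \<bar>ln d\<bar> + \<bar>ln e\<bar>"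
      by linarith
    then have "M * \<bar>ln t\<bar> \<le> M * (\<bar>ln d\<bar> + \<bar>ln e\<bar>)"
      using assms by (intro mult_left_mono) auto
    then show ?thesis using t assms by simp
  qed
  then show ?thesis by (rule that)
qed

section \<open>Estimates along the Hankel contour\<close>

lemma hankel_neg: "e > 0 \<Longrightarrow> x \<le> 0 \<Longrightarrow> hankel e x = of_real (e - x)"
  by (simp add: hankel_def hankel_log_def exp_of_real)

lemma hankel_mid: "e > 0 \<Longrightarrow> 0 \<le> x \<Longrightarrow> x \<le> 2 * pi \<Longrightarrow> hankel e x = of_real e * exp (\<i> * of_real x)"
  by (simp add: hankel_def hankel_log_def exp_of_real exp_add)

lemma hankel_pos: "e > 0 \<Longrightarrow> x \<ge> 2 * pi \<Longrightarrow> hankel e x = of_real (e + (x - 2 * pi))"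
proof -
  assume *: "e > 0" "x \<ge> 2 * pi"
  have "exp (\<i> * of_real (2 * pi)) = 1"
    using exp_two_pi_i' by (simp add: mult_ac)
  moreover have "\<not> x \<le> 0" using * pi_gt_zero by linarith
  ultimately show ?thesis using *
    by (cases "x = 2 * pi") (auto simp: hankel_def hankel_log_def exp_of_real exp_add)
qed

text \<open>By the last two estimates Re t controls, up to constants, both norm t and the parameter
  x, so that decay in Re t becomes decay in x.\<close>

lemma hankel_bounds:
  assumes "e > 0"
  shows "norm (hankel e x) \<ge> e" "\<bar>Im (hankel e x)\<bar> \<le> e" "Re (hankel e x) \<ge> - e"
    "norm (hankel e x) \<le> Re (hankel e x) + 2 * e" "\<bar>x\<bar> \<le> Re (hankel e x) + 2 * pi + 2 * e"
proof -
  have "norm (hankel e x) \<ge> e \<and> \<bar>Im (hankel e x)\<bar> \<le> e \<and> Re (hankel e x) \<ge> - e \<and>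
    norm (hankel e x) \<le> Re (hankel e x) + 2 * e \<and> \<bar>x\<bar> \<le> Re (hankel e x) + 2 * pi + 2 * e"
  proof -
    consider "x \<le> 0" | "0 \<le> x" "x \<le> 2 * pi" | "x \<ge> 2 * pi" by linarith
    then show ?thesis
    proof cases
      case 1
      then show ?thesis using assms pi_gt_zero
          by (simp add: hankel_neg[OF assms] norm_of_real del: of_real_diff)
    next
      case 3
      moreover have "x > 0" using 3 pi_gt_zero by linarith
      ultimately show ?thesis using assms
        by (simp add: hankel_pos[OF assms] norm_of_real del: of_real_diff of_real_add)
    next
      case 2
      have n: "norm (hankel e x) = e" using assms by (simp add: hankel_mid[OF assms 2] norm_mult)
      moreover have "\<bar>Im (hankel e x)\<bar> \<le> e" "\<bar>Re (hankel e x)\<bar> \<le> e"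
        using abs_Im_le_cmod[of "hankel e x"] abs_Re_le_cmod[of "hankel e x"] n by auto
      ultimately show ?thesis using 2 by auto
    qed
  qed
  then show "norm (hankel e x) \<ge> e" "\<bar>Im (hankel e x)\<bar> \<le> e" "Re (hankel e x) \<ge> - e"
    "norm (hankel e x) \<le> Re (hankel e x) + 2 * e" "\<bar>x\<bar> \<le> Re (hankel e x) + 2 * pi + 2 * e"
    by blast+
qed

lemma hankel_log_measurable: "hankel_log e \<in> borel_measurable borel"
  unfolding hankel_log_def by measurable

lemma hankel_measurable: "hankel e \<in> borel_measurable borel"
  unfolding hankel_def using hankel_log_measurable by measurable

lemma hankel_power_measurable: "hankel_power e s \<in> borel_measurable borel"
  unfolding hankel_power_def using hankel_log_measurable by measurable

lemma hankel_derivative: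
  assumes "e > 0"
  shows "x < 0 \<Longrightarrow> vector_derivative (hankel e) (at x) = -1"
    and "0 < x \<Longrightarrow> x < 2 * pi \<Longrightarrow> vector_derivative (hankel e) (at x) = \<i> * of_real e * exp (\<i> * of_real x)"
    and "x > 2 * pi \<Longrightarrow> vector_derivative (hankel e) (at x) = 1"
proof -
  assume x: "x < 0"
  have "((\<lambda>x. of_real (e - x)) has_vector_derivative - 1) (at x)"
    by (auto intro!: derivative_eq_intros has_vector_derivative_real_field)
  then have "(hankel e has_vector_derivative - 1) (at x)"
    by (rule has_vector_derivative_transform_within_open[of _ _ _
        "{..<0}"]) (use x assms in \<open>auto simp: hankel_neg\<close>)
  then show "vector_derivative (hankel e) (at x) = -1" by (rule vector_derivative_at)
next
  assume x: "0 < x" "x < 2 * pi"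
  have "((\<lambda>x. of_real e * exp (\<i> * of_real x)) has_vector_derivative \<i> * of_real e * exp (\<i> *
      of_real x)) (at x)"
    by (auto intro!: derivative_eq_intros has_vector_derivative_real_field)
  then have "(hankel e has_vector_derivative \<i> * of_real e * exp (\<i> * of_real x)) (at x)"
    by (rule has_vector_derivative_transform_within_open[of _ _ _ "{0<..<2 *
        pi}"]) (use x assms in \<open>auto simp: hankel_mid\<close>)
  then show "vector_derivative (hankel e) (at x) = \<i> * of_real e * exp (\<i> * of_real x)"
    by (rule vector_derivative_at)
next
  assume x: "x > 2 * pi"
  have "((\<lambda>x. of_real (e + (x - 2 * pi))) has_vector_derivative 1) (at x)"
    by (auto intro!: derivative_eq_intros has_vector_derivative_real_field)
  then have "(hankel e has_vector_derivative 1) (at x)"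
    by (rule has_vector_derivative_transform_within_open[of _ _ _ "{2 *
        pi<..}"]) (use x assms in \<open>auto simp: hankel_pos\<close>)
  then show "vector_derivative (hankel e) (at x) = 1" by (rule vector_derivative_at)
qed

text \<open>The path has corners at 0 and 2 pi, where \<open>vector_derivative\<close> takes
  unspecified values c0 and c1. Naming them makes measurability and boundedness visible.\<close>

lemma hankel_derivative_cases:
  assumes "e > 0"
  obtains c0 c1 where "(\<lambda>x. vector_derivative (hankel e) (at x)) =
    (\<lambda>x. if x < 0 then -1 else if x = 0 then c0 else if x < 2 * pi then \<i> * of_real e * exp (\<i> *
        of_real x)
      else if x = 2 * pi then c1 else 1)"
  by (rule that[of "vector_derivative (hankel e) (at 0)" "vector_derivative (hankel e) (at (2 * pi))"])
     (auto simp: fun_eq_iff hankel_derivative[OF assms])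

lemma norm_hankel_power_le:
  assumes "norm s \<le> M"
  shows "norm (hankel_power e s x) \<le> exp (M * \<bar>ln (norm (hankel e x))\<bar> + M * (2 * pi))"
proof -
  have M: "M \<ge> 0" using assms norm_ge_zero order_trans by blast
  have Re: "Re (hankel_log e x) = ln (norm (hankel e x))"
    by (simp add: hankel_def)
  have Im: "\<bar>Im (hankel_log e x)\<bar> \<le> 2 * pi"
    using pi_gt_zero by (auto simp: hankel_log_def)
  have "Re (s * hankel_log e x) \<le> \<bar>Re s\<bar> * \<bar>Re (hankel_log e x)\<bar> + \<bar>Im s\<bar> * \<bar>Im (hankel_log e x)\<bar>"
    by (simp add: abs_mult[symmetric])
  also have "\<dots> \<le> M * \<bar>ln (norm (hankel e x))\<bar> + M * (2 * pi)"
    unfolding Re using M Im assms abs_Re_le_cmod[of s] abs_Im_le_cmod[of s]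
    by (intro add_mono mult_mono) auto
  finally show ?thesis by (simp add: hankel_power_def)
qed

text \<open>By \<open>ln_growth\<close> the power costs at most a constant times exp (Re t / 8),
  which is half of the decay exp (- Re t / 4) supplied by the kernel.\<close>

lemma path_weight_hankel:
  assumes "0 < e" "e \<le> 1 / (real n + 1)"
  obtains K where "path_weight n K (hankel e)
    (\<lambda>x. c * (hankel_power e s x * vector_derivative (hankel e) (at x)))"
proof -
  let ?d = "\<lambda>x. vector_derivative (hankel e) (at x)"
  define M where "M = norm s"
  obtain K1 where K1: "\<And>t. t \<ge> e \<Longrightarrow> M * \<bar>ln t\<bar> \<le> t / 8 + K1"
    using ln_growth[OF assms(1), of M] by (auto simp: M_def)
  obtain c0 c1 where hd: "(\<lambda>x. ?d x) =
    (\<lambda>x. if x < 0 then -1 else if x = 0 then c0 else if x < 2 * pi then \<i> * of_real e * exp (\<i> *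
        of_real x)
      else if x = 2 * pi then c1 else 1)"
    using hankel_derivative_cases[OF assms(1)] by blast
  define D where "D = 1 + e + norm c0 + norm c1"
  have D: "norm (?d x) \<le> D" for x
    unfolding fun_cong[OF hd] D_def using assms(1) by (auto simp: norm_mult)
  have D0: "D \<ge> 0" using assms by (simp add: D_def)
  have meas: "(\<lambda>x. ?d x) \<in> borel_measurable borel"
    unfolding hd by measurable
  define K where "K = norm c * exp (K1 + M * (2 * pi) + e / 4 + (2 * pi + 2 * e) / 8) * D"
  have bound: "exp (- Re (hankel e x) / 4) * norm (c * (hankel_power e s x * ?d x))
      \<le> K * exp (- \<bar>x\<bar> / 8)" for x
  proof -
    define h where "h = Re (hankel e x)"
    note b = hankel_bounds[OF assms(1), of x]
    have "M * \<bar>ln (norm (hankel e x))\<bar> + M * (2 * pi) \<le> h / 8 + e / 4 + K1 + M * (2 * pi)"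
      using K1[OF b(1)] b(4) by (simp add: h_def)
    then have "norm (hankel_power e s x) \<le> exp (h / 8 + e / 4 + K1 + M * (2 * pi))"
      using order_trans[OF norm_hankel_power_le[of s M e x]] by (simp add: M_def)
    then have "exp (- h / 4) * norm (c * (hankel_power e s x * ?d x)) \<le>
        exp (- h / 4) * (norm c * (exp (h / 8 + e / 4 + K1 + M * (2 * pi)) * D))"
      unfolding norm_mult using D D0 by (intro mult_left_mono mult_mono) auto
    also have "\<dots> = norm c * D * exp (- h / 8 + e / 4 + K1 + M * (2 * pi))"
    proof -
      have "exp (- h / 4) * exp (h / 8 + e / 4 + K1 + M * (2 * pi)) = exp (- h / 8 + e / 4 + K1 +
          M * (2 * pi))"
        by (simp flip: exp_add)
      then show ?thesis by (simp add: mult_ac)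
    qed
    also have "\<dots> \<le> norm c * D * exp ((- \<bar>x\<bar> / 8) + (K1 + M * (2 * pi) + e / 4 + (2 * pi + 2 * e) / 8))"
    proof -
      have "- h / 8 \<le> - \<bar>x\<bar> / 8 + (2 * pi + 2 * e) / 8"
      proof -
        have "(- h) / 8 \<le> (- \<bar>x\<bar> + (2 * pi + 2 * e)) / 8"
          using b(5) by (intro divide_right_mono) (auto simp: h_def)
        then show ?thesis by (simp only: add_divide_distrib)
      qed
      then show ?thesis using D0 by (intro mult_left_mono iffD2[OF exp_le_cancel_iff]) auto
    qed
    also have "\<dots> = K * exp (- \<bar>x\<bar> / 8)"
      unfolding K_def exp_add by simp
    finally show ?thesis by (simp add: h_def)
  qed
  have "in_strip n (hankel e x)" for x
    using hankel_bounds(2,3)[OF assms(1), of x] assms(2) by (auto simp: in_strip_def)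
  then have "path_weight n K (hankel e) (\<lambda>x. c * (hankel_power e s x * ?d x))"
    unfolding path_weight_def using bound hankel_measurable hankel_power_measurable meas by auto
  then show ?thesis by (rule that)
qed

text \<open>
  For a power series \<open>g t = (\<Sum>m. a m * t ^ m)\<close> and \<open>l > 0\<close> the Hankel functional equals
  \<open>(\<integral> t > l. g t * t powr (s - 1)) / \<Gamma>(s) + (\<Sum>m. a m * l powr (m + s) / ((m + s) * \<Gamma>(s)))\<close>,
  where \<open>1 / ((m + s) * \<Gamma>(s))\<close> is the entire function \<open>reg_coeff s m\<close>.  Extracting \<open>a m\<close> by Cauchy's
  formula on a circle of radius \<open>2 * l\<close> turns this into the integral of \<open>g\<close> along \<open>reg_path\<close> against the
  density \<open>reg_weight\<close>.
\<close>

definition reg_path :: "nat \<Rightarrow> real \<Rightarrow> complex" where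
  "reg_path n x = (if x < 0 then of_real (1 / (2 * (real n + 1)) - x)
     else if x \<le> 1 then of_real (1 / (real n + 1)) * exp (2 * of_real pi * \<i> * of_real x) else 0)"

definition reg_coeff :: "complex \<Rightarrow> nat \<Rightarrow> complex" where
  "reg_coeff s m = pochhammer s m * rGamma (s + of_nat (Suc m))"

text \<open>With l = 1/(2(n+1)), Cauchy's formula on the radius 2 l gives the m-th Taylor
  coefficient as (2 l)^(-m) times a Fourier coefficient. The functional multiplies it by l^(m+s), so
  (1/2)^m l^s remains.\<close>

definition circ_term :: "nat \<Rightarrow> complex \<Rightarrow> nat \<Rightarrow> real \<Rightarrow> complex" where
  "circ_term n s m x = (1 / 2) ^ m * exp (- (2 * of_real pi * \<i> * of_nat m * of_real x)) *
     (exp (s * of_real (ln (1 / (2 * (real n + 1))))) * reg_coeff s m)"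

abbreviation circ_weight :: "nat \<Rightarrow> complex \<Rightarrow> real \<Rightarrow> complex" where
  "circ_weight n s x \<equiv> suminf (\<lambda>m. circ_term n s m x)"

text \<open>The ray t = l - x for x < 0 and the circle for x in [0,1] share one real parameter, so
  that the functional is a single integral over \<open>lborel\<close>, as on the Hankel contour.
  Beyond 1 the weight vanishes.\<close>

definition reg_weight :: "nat \<Rightarrow> complex \<Rightarrow> real \<Rightarrow> complex" where
  "reg_weight n s x = (if x < 0 then rGamma s * exp ((s - 1) * of_real (ln (1 / (2 * (real n +
      1)) - x)))
     else if x \<le> 1 then circ_weight n s x else 0)"

text \<open>The expression of 1/Gamma(s) by a Pochhammer symbol has s + m as its last factor;
  \<open>reg_coeff\<close> omits it, which divides by s + m without creating a singularity.\<close>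

lemma reg_coeff_eq: "reg_coeff s m * (s + of_nat m) = rGamma s"
  using pochhammer_rGamma[of s "Suc m"] by (simp add: reg_coeff_def pochhammer_Suc mult_ac)

lemma reg_coeff_holomorphic: "(\<lambda>s. reg_coeff s m) holomorphic_on A"
  unfolding reg_coeff_def pochhammer_prod by (intro holomorphic_intros)

text \<open>For large m the divisor s + m has norm at least 1, so \<open>rGamma s\<close> is a
  bound; the finitely many other m are covered by compactness of the disc.\<close>

lemma reg_coeff_bound:
  obtains K where "K \<ge> 0" "\<And>s m. norm s \<le> M \<Longrightarrow> norm (reg_coeff s m) \<le> K"
proof -
  define N where "N = nat \<lceil>M\<rceil> + 1"
  define f where "f = (\<lambda>s. (\<Sum>m\<le>N. norm (reg_coeff s m)) + norm (rGamma s))"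
  have "continuous_on (cball 0 M) f"
    unfolding f_def
    by (intro continuous_intros holomorphic_on_imp_continuous_on reg_coeff_holomorphic)
  then have "bounded (f ` cball 0 M)"
    by (intro compact_imp_bounded compact_continuous_image) auto
  then obtain K where K: "K > 0" "\<And>s. norm s \<le> M \<Longrightarrow> norm (f s) \<le> K"
    by (auto simp: bounded_pos)
  have "norm (reg_coeff s m) \<le> K" if s: "norm s \<le> M" for s m
  proof (cases "m \<le> N")
    case True
    then have "norm (reg_coeff s m) \<le> (\<Sum>m\<le>N. norm (reg_coeff s m))"
      by (intro member_le_sum) auto
    also have "\<dots> \<le> f s" by (simp add: f_def)
    also have "\<dots> \<le> norm (f s)" by simp
    finally show ?thesis using K(2)[OF s] by linarith
  next
    case False
    then have "real m \<ge> M + 1" by (simp add: N_def) linarith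
    then have "norm (s + of_nat m) \<ge> 1"
      using norm_triangle_ineq4[of "s + of_nat m" s] s by simp
    then have "norm (reg_coeff s m) * 1 \<le> norm (reg_coeff s m) * norm (s + of_nat m)"
      by (intro mult_left_mono) auto
    also have "\<dots> = norm (rGamma s)" by (simp flip: norm_mult add: reg_coeff_eq)
    also have "\<dots> \<le> norm (f s)" by (simp add: f_def sum_nonneg)
    finally show ?thesis using K(2)[OF s] by simp
  qed
  then show ?thesis using K(1) that[of K] by simp
qed

lemma circ_term_bound:
  obtains K where "K \<ge> 0" "\<And>s m x. norm s \<le> M \<Longrightarrow> norm (circ_term n s m x) \<le> K * (1 / 2) ^ m"
proof -
  obtain K where K: "K \<ge> 0" "\<And>s m. norm s \<le> M \<Longrightarrow> norm (reg_coeff s m) \<le> K"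
    using reg_coeff_bound by blast
  define L where "L = ln (1 / (2 * (real n + 1)))"
  have "norm (circ_term n s m x) \<le> (exp (M * \<bar>L\<bar>) * K) * (1 / 2) ^ m" if s: "norm s \<le> M" for s m x
  proof -
    have "Re s * L \<le> \<bar>Re s\<bar> * \<bar>L\<bar>" by (simp flip: abs_mult)
    also have "\<dots> \<le> M * \<bar>L\<bar>" using s abs_Re_le_cmod[of s] by (intro mult_right_mono) auto
    finally have "norm (exp (s * of_real L)) \<le> exp (M * \<bar>L\<bar>)" by simp
    then have "(1 / 2) ^ m * (norm (exp (s * of_real L)) * norm (reg_coeff s m))
        \<le> (1 / 2) ^ m * (exp (M * \<bar>L\<bar>) * K)"
      using K s by (intro mult_left_mono mult_mono) auto
    then show ?thesis unfolding circ_term_def L_def[symmetric] norm_mult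
        by (simp add: norm_power norm_divide mult_ac)
  qed
  then show ?thesis using K(1) that[of "exp (M * \<bar>L\<bar>) * K"] by simp
qed

lemma summable_circ_bound: "summable (\<lambda>m. (K::real) * (1 / 2) ^ m)"
  by (intro summable_mult summable_geometric) auto

lemma summable_circ_term: "summable (\<lambda>m. norm (circ_term n s m x))"
proof -
  obtain K where K: "\<And>m. norm (circ_term n s m x) \<le> K * (1 / 2) ^ m"
    using circ_term_bound[of "norm s" n] by (metis order_refl)
  then show ?thesis
    by (intro summable_comparison_test'[OF summable_circ_bound[of K], of 0]) auto
qed

lemma suminf_circ_term_bound:
  obtains K where "K \<ge> 0" "\<And>s x. norm s \<le> M \<Longrightarrow> norm (circ_weight n s x) \<le> K"
proof -
  obtain K where K: "K \<ge> 0" "\<And>s m x. norm s \<le> M \<Longrightarrow> norm (circ_term n s m x) \<le> K * (1 / 2) ^ m"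
    using circ_term_bound[of M n] by metis
  have "norm (circ_weight n s x) \<le> suminf (\<lambda>m. K * (1 / 2) ^ m)" if "norm s \<le> M" for s x
    by (rule norm_suminf_le[OF K(2)[OF that] summable_circ_bound]) 
  moreover have "suminf (\<lambda>m. K * (1 / 2) ^ m) \<ge> 0" using K(1)
      by (intro suminf_nonneg summable_circ_bound) auto
  ultimately show ?thesis using that by blast
qed

lemma circ_term_holomorphic: "(\<lambda>s. circ_term n s m x) holomorphic_on A"
  unfolding circ_term_def by (intro holomorphic_intros reg_coeff_holomorphic)

lemma suminf_circ_term_holomorphic: "(\<lambda>s. circ_weight n s x) holomorphic_on UNIV"
proof -
  have "(\<lambda>s. circ_weight n s x) holomorphic_on ball 0 M" for M
  proof -
    obtain K where K: "K \<ge> 0" "\<And>s m x. norm s \<le> M \<Longrightarrow> norm (circ_term n s m x) \<le> K * (1 / 2) ^ m"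
      using circ_term_bound[of M n] by metis
    have *: "uniform_limit (ball 0 M) (\<lambda>N s. \<Sum>m<N. circ_term n s m x)
        (\<lambda>s. circ_weight n s x) sequentially"
      using K(2) by (intro Weierstrass_m_test[OF _ summable_circ_bound[of K]]) auto
    show ?thesis
    proof (rule holomorphic_uniform_sequence[of "ball 0 M" "\<lambda>N s. \<Sum>m<N. circ_term n s m x"])
      fix z :: complex assume "z \<in> ball 0 M"
      then obtain d where d: "d > 0" "cball z d \<subseteq> ball 0 M"
        using open_contains_cball_eq[OF open_ball] by metis
      show "\<exists>d>0. cball z d \<subseteq> ball 0 M \<and>
          uniform_limit (cball z d) (\<lambda>N s. \<Sum>m<N. circ_term n s m x)
              (\<lambda>s. circ_weight n s x) sequentially"
        by (intro exI[of _ d] conjI d uniform_limit_on_subset[OF * d(2)])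
    next
      show "(\<lambda>s. \<Sum>m<N. circ_term n s m x) holomorphic_on ball 0 M" for N
        by (intro holomorphic_on_sum circ_term_holomorphic)
    qed simp
  qed
  then have "(\<lambda>s. circ_weight n s x) holomorphic_on (\<Union>M. ball 0 M)"
    by (intro holomorphic_on_UN_open) auto
  moreover have "(\<Union>M. ball (0::complex) M) = UNIV"
  proof -
    have "z \<in> ball 0 (norm z + 1)" for z :: complex by simp
    then show ?thesis by blast
  qed
  ultimately show ?thesis by simp
qed

lemma reg_weight_holomorphic: "(\<lambda>s. reg_weight n s x) holomorphic_on UNIV"
proof -
  have "(\<lambda>s. rGamma s * exp ((s - 1) * of_real (ln (1 / (2 * (real n + 1)) - x)))) holomorphic_on UNIV"
    by (intro holomorphic_intros)
  then show ?thesis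
    unfolding reg_weight_def
    by (cases "x < 0"; cases "x \<le> 1")
        (simp_all only: if_True if_False suminf_circ_term_holomorphic holomorphic_on_const)
qed

text \<open>One constant K serves all s in a disc, as dominated convergence requires for continuity
  and holomorphy in s. On the ray the power again costs exp (t / 8); on the circle everything is
  bounded.\<close>

lemma path_weight_reg:
  obtains K where "\<And>s. norm s \<le> M \<Longrightarrow> path_weight n K (reg_path n) (reg_weight n s)"
proof -
  define R where "R = 1 / (real n + 1)"
  have R: "R > 0" "R \<le> 1" by (auto simp: R_def)
  define M' where "M' = \<bar>M\<bar> + 1"
  obtain K1 where K1: "\<And>t. t \<ge> R / 2 \<Longrightarrow> M' * \<bar>ln t\<bar> \<le> t / 8 + K1"
    using ln_growth[of "R / 2" M'] R by (auto simp: M'_def)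
  have "bounded (rGamma ` cball (0::complex) M)"
    by (intro compact_imp_bounded compact_continuous_image continuous_intros) auto
  then obtain G where G: "G > 0" "\<And>s. norm (s::complex) \<le> M \<Longrightarrow> norm (rGamma s) \<le> G"
    by (auto simp: bounded_pos)
  obtain K2 where K2: "K2 \<ge> 0" "\<And>s x. norm s \<le> M \<Longrightarrow> norm (circ_weight n s x) \<le> K2"
    using suminf_circ_term_bound by blast
  have half: "1 / (2 * (real n + 1)) = R / 2" by (simp add: R_def)
  have ray: "reg_path n x = of_real (R / 2 - x)" "R / 2 - x \<ge> R / 2" if "x < 0" for x
    using that by (simp_all only: reg_path_def half if_True)
  have circ: "reg_path n x = of_real R * exp (2 * of_real pi * \<i> * of_real x)" if "0 \<le> x" "x \<le> 1" for x
    using that by (simp add: reg_path_def R_def)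
  have circ_norm: "norm (reg_path n x) = R" if "0 \<le> x" "x \<le> 1" for x
    using R by (simp add: circ[OF that] norm_mult)
  have strip: "in_strip n (reg_path n x)" for x
  proof -
    consider "x < 0" | "0 \<le> x" "x \<le> 1" | "x > 1" by linarith
    then show ?thesis
    proof cases
      case 1
      then show ?thesis using R by (simp add: in_strip_def ray R_def[symmetric])
    next
      case 2
      then show ?thesis using circ_norm[OF 2] abs_Re_le_cmod[of "reg_path n x"] abs_Im_le_cmod[of
          "reg_path n x"]
        by (auto simp: in_strip_def R_def[symmetric])
    qed (simp add: in_strip_def reg_path_def)
  qed
  define K where "K = G * exp K1 + exp (R / 4) * K2 * exp (1 / 8)"
  have bound: "exp (- Re (reg_path n x) / 4) * norm (reg_weight n s x) \<le> K * exp (- \<bar>x\<bar> / 8)"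
    if s: "norm s \<le> M" for s x
  proof -
    consider "x < 0" | "0 \<le> x" "x \<le> 1" | "x > 1" by linarith
    then show ?thesis
    proof cases
      case 1
      define t where "t = R / 2 - x"
      have t: "t \<ge> R / 2" "t > 0" "t \<ge> \<bar>x\<bar>" using 1 R by (auto simp: t_def)
      have w: "reg_weight n s x = rGamma s * exp ((s - 1) * of_real (ln t))"
        using 1 by (simp_all only: reg_weight_def t_def half if_True)
      have "Re (s - 1) * ln t \<le> \<bar>Re (s - 1)\<bar> * \<bar>ln t\<bar>" by (simp flip: abs_mult)
      also have "\<dots> \<le> M' * \<bar>ln t\<bar>"
        using s abs_Re_le_cmod[of s] by (intro mult_right_mono) (auto simp: M'_def)
      also have "\<dots> \<le> t / 8 + K1" using K1 t by blast
      finally have "norm (exp ((s - 1) * of_real (ln t))) \<le> exp (t / 8 + K1)" by simp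
      then have "norm (reg_weight n s x) \<le> G * exp (t / 8 + K1)"
        unfolding w norm_mult using G(1) G(2)[OF s] by (intro mult_mono) auto
      then have "exp (- t / 4) * norm (reg_weight n s x) \<le> exp (- t / 4) * (G * exp (t / 8 + K1))"
        by (intro mult_left_mono) auto
      also have "\<dots> = G * exp K1 * exp (- t / 8)"
        by (simp add: mult.left_commute mult.assoc flip: exp_add)
      also have "\<dots> \<le> K * exp (- \<bar>x\<bar> / 8)"
        using G K2 t by (intro mult_mono) (auto simp: K_def)
      finally show ?thesis using 1 by (simp add: ray t_def)
    next
      case 2
      have w: "reg_weight n s x = circ_weight n s x" using 2 by (simp add: reg_weight_def)
      have "- Re (reg_path n x) / 4 \<le> R / 4"
        using circ_norm[OF 2] abs_Re_le_cmod[of "reg_path n x"] by auto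
      then have "exp (- Re (reg_path n x) / 4) * norm (reg_weight n s x) \<le> exp (R / 4) * K2"
        unfolding w using K2(2)[OF s] by (intro mult_mono) auto
      also have "\<dots> \<le> exp (R / 4) * K2 * (exp (1 / 8) * exp (- \<bar>x\<bar> / 8))"
      proof -
        have "1 \<le> exp (1 / 8) * exp (- \<bar>x\<bar> / 8)" using 2 by (simp flip: exp_add)
        then show ?thesis using K2(1) mult_left_mono[of 1 _ "exp (R / 4) * K2"] by simp
      qed
      also have "\<dots> \<le> K * exp (- \<bar>x\<bar> / 8)"
        using G(1) by (simp add: K_def algebra_simps)
      finally show ?thesis .
    next
      case 3
      then show ?thesis using G K2 by (simp add: reg_weight_def K_def)
    qed
  qed
  have meas: "reg_path n \<in> borel_measurable borel" "reg_weight n s \<in> borel_measurable borel" for s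
    unfolding reg_path_def reg_weight_def circ_term_def by measurable
  show ?thesis
    using that[of K] strip bound meas by (simp add: path_weight_def)
qed

section \<open>The functional on the regularized path\<close>

lemma integrable_path_weight:
  assumes "path_weight n K P w" "g \<in> borel_measurable borel"
    and "\<And>t. in_strip n t \<Longrightarrow> norm (g t) \<le> C * exp (- Re t / 4)" "C \<ge> 0"
  shows "integrable lborel (\<lambda>x. g (P x) * w x)"
proof (rule Bochner_Integration.integrable_bound)
  show "integrable lborel (\<lambda>x. C * (K * exp (- \<bar>x\<bar> / 8)))"
    by (intro integrable_mult_right integrable_exp_minus_abs)
  show "(\<lambda>x. g (P x) * w x) \<in> borel_measurable lborel"
    using assms(1,2) by (auto simp: path_weight_def)
  have "norm (g (P x) * w x) \<le> norm (C * (K * exp (- \<bar>x\<bar> / 8)))" for x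
  proof -
    have "norm (g (P x) * w x) \<le> (C * exp (- Re (P x) / 4)) * norm (w x)"
      unfolding norm_mult using assms(1,3) by (intro mult_right_mono) (auto simp: path_weight_def)
    also have "\<dots> \<le> C * (K * exp (- \<bar>x\<bar> / 8))"
      unfolding mult.assoc using assms(1,4) by (intro mult_left_mono) (auto simp: path_weight_def)
    finally show ?thesis by (simp only: real_norm_def)
  qed
  then show "AE x in lborel. norm (g (P x) * w x) \<le> norm (C * (K * exp (- \<bar>x\<bar> / 8)))"
    by (rule AE_I2)
qed

text \<open>Cauchy's formula for the m-th derivative in the parametrization t = r e^(2 pi i x),
  where dt / t = 2 pi i dx.\<close>

lemma circle_fourier_coeff:
  assumes g: "g holomorphic_on ball 0 (2 * r)" and r: "r > 0"
  shows "((\<lambda>x. g (of_real r * exp (2 * of_real pi * \<i> * of_real x)) * exp (- (2 * of_real pi * \<i> *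
      of_nat m * of_real x)))
    has_integral (deriv ^^ m) g 0 / fact m * of_real r ^ m) {0..1}"
proof -
  let ?c = "circlepath 0 r" and ?k = "of_real r ^ m / (2 * of_real pi * \<i>)"
  let ?d = "\<lambda>x. vector_derivative ?c (at x)"
  have "continuous_on (cball 0 r) g"
    using g r by (intro holomorphic_on_imp_continuous_on holomorphic_on_subset[OF g]) auto
  moreover have "g holomorphic_on ball 0 r"
    using r by (intro holomorphic_on_subset[OF g]) auto
  ultimately have "((\<lambda>u. g u / (u - 0) ^ Suc m) has_contour_integral (2 * pi * \<i>) / fact m *
      (deriv ^^ m) g 0) (circlepath 0 r)"
    using r by (intro Cauchy_has_contour_integral_higher_derivative_circlepath) auto
  then have "((\<lambda>x. g (?c x) / (?c x) ^ Suc m * ?d x)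
      has_integral (2 * pi * \<i>) / fact m * (deriv ^^ m) g 0) {0..1}"
    by (simp add: has_contour_integral)
  then have "((\<lambda>x. ?k * (g (?c x) / (?c x) ^ Suc m * ?d x))
      has_integral ?k * ((2 * pi * \<i>) / fact m * (deriv ^^ m) g 0)) {0..1}"
    by (rule has_integral_mult_right)
  moreover have "?k * (g (?c x) / (?c x) ^ Suc m * ?d x) =
      g (of_real r * exp (2 * of_real pi * \<i> * of_real x)) * exp (- (2 * of_real pi * \<i> * of_nat m *
          of_real x))" for x
  proof -
    define E where "E = exp (2 * of_real pi * \<i> * of_real x)"
    have E: "E \<noteq> 0" by (simp add: E_def)
    have p: "?c x = of_real r * E"
      by (simp add: circlepath E_def)
    have p': "?d x = 2 * of_real pi * \<i> * of_real r * E"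
      by (simp only: vector_derivative_circlepath E_def) simp
    have "exp (- (2 * of_real pi * \<i> * of_nat m * of_real x)) = inverse (E ^ m)"
      by (simp add: E_def exp_minus mult_ac flip: exp_of_nat_mult)
    then show ?thesis
      unfolding p p' E_def[symmetric] using r E by (simp add: field_simps)
  qed
  moreover have "?k * ((2 * pi * \<i>) / fact m * (deriv ^^ m) g 0) =
      (deriv ^^ m) g 0 / fact m * of_real r ^ m"
    by (simp add: field_simps)
  ultimately show ?thesis by simp
qed

text \<open>The integral of g(t) t^(s-1) from l = 1/(2(n+1)) to infinity, after the substitution t =
  l - x.\<close>

definition ray_integral :: "nat \<Rightarrow> (complex \<Rightarrow> complex) \<Rightarrow> complex \<Rightarrow> complex" where
  "ray_integral n g s = (\<integral>x. indicator {..<0} x *\<^sub>R (g (of_real (1 / (2 * (real n + 1)) - x)) *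
     exp ((s - 1) * of_real (ln (1 / (2 * (real n + 1)) - x)))) \<partial>lborel)"

text \<open>The ray is split off. On the circle the series for the density may be integrated
  termwise because its terms decay like 2^(-m), and each term extracts one Taylor coefficient of
  g.\<close>

lemma reg_functional:
  assumes g: "g holomorphic_on ball 0 (2 / (real n + 1))" "g \<in> borel_measurable borel"
    and bound: "\<And>t. in_strip n t \<Longrightarrow> norm (g t) \<le> C * exp (- Re t / 4)" "C \<ge> 0"
  shows "(\<lambda>m. exp ((s + of_nat m) * of_real (ln (1 / (2 * (real n + 1))))) * reg_coeff s m *
      ((deriv ^^ m) g 0 / fact m))
    sums ((\<integral>x. g (reg_path n x) * reg_weight n s x \<partial>lborel) - rGamma s * ray_integral n g s)"
proof -
  define R where "R = 1 / (real n + 1)"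
  have R: "R > 0" by (simp add: R_def)
  have half: "1 / (2 * (real n + 1)) = R / 2" "2 / (real n + 1) = 2 * R" by (simp_all add: R_def)
  define L where "L = ln (R / 2)"
  let ?q = "\<lambda>x. g (of_real (R / 2 - x)) * exp ((s - 1) * of_real (ln (R / 2 - x)))"
  define a where "a = (\<lambda>m. (deriv ^^ m) g 0 / fact m)"
  define p where "p = (\<lambda>x::real. of_real R * exp (2 * of_real pi * \<i> * of_real x))"
  obtain K where K: "path_weight n K (reg_path n) (reg_weight n s)"
    using path_weight_reg[of "norm s" n] by (metis order_refl)
  define F where "F = (\<lambda>x. g (reg_path n x) * reg_weight n s x)"
  have F: "integrable lborel F"
    unfolding F_def by (rule integrable_path_weight[OF K g(2) bound])
  have split: "F x = indicator {..<0} x *\<^sub>R F x + indicator {0..1} x *\<^sub>R F x" for x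
    by (auto simp: F_def reg_weight_def indicator_def)
  have int: "integrable lborel (\<lambda>x. indicator {..<0} x *\<^sub>R F x)"
      "integrable lborel (\<lambda>x. indicator {0..1} x *\<^sub>R F x)"
    using F by (auto intro!: integrable_mult_indicator)
  have "integral\<^sup>L lborel F = (\<integral>x. indicator {..<0} x *\<^sub>R F x \<partial>lborel) +
      (\<integral>x. indicator {0..1} x *\<^sub>R F x \<partial>lborel)"
    unfolding Bochner_Integration.integral_add[OF int, symmetric] split[symmetric] ..
  also have "(\<integral>x. indicator {..<0} x *\<^sub>R F x \<partial>lborel) =
      (\<integral>x. rGamma s * (indicator {..<0} x *\<^sub>R ?q x) \<partial>lborel)"
  proof (rule Bochner_Integration.integral_cong[OF refl])
    fix x :: real
    have "F x = rGamma s * ?q x" if "x < 0"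
      using that unfolding F_def reg_path_def reg_weight_def half by (simp only: if_True mult_ac)
    then show "indicator {..<0} x *\<^sub>R F x = rGamma s * (indicator {..<0} x *\<^sub>R ?q x)"
      by (cases "x < 0") auto
  qed
  also have "\<dots> = rGamma s * ray_integral n g s"
    unfolding ray_integral_def half by (rule integral_mult_right_zero)
  finally have total: "integral\<^sup>L lborel F - rGamma s * ray_integral n g s =
      (\<integral>x. indicator {0..1} x *\<^sub>R F x \<partial>lborel)"
    by simp
  have p_norm: "norm (p x) = R" for x using R by (simp add: p_def norm_mult)
  have p_strip: "in_strip n (p x)" for x
    using p_norm[of x] abs_Re_le_cmod[of "p x"] abs_Im_le_cmod[of "p x"]
    by (auto simp: in_strip_def R_def[symmetric])
  define B where "B = C * exp (R / 4)"
  have gp: "norm (g (p x)) \<le> B" for x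
  proof -
    have "norm (g (p x)) \<le> C * exp (- Re (p x) / 4)" by (rule bound(1)[OF p_strip])
    also have "\<dots> \<le> B" unfolding B_def
      using p_norm[of x] abs_Re_le_cmod[of "p x"] bound(2) by (intro mult_left_mono) auto
    finally show ?thesis .
  qed
  have B: "B \<ge> 0" using gp[of 0] norm_ge_zero order_trans by blast
  obtain K2 where K2: "K2 \<ge> 0" "\<And>m x. norm (circ_term n s m x) \<le> K2 * (1 / 2) ^ m"
    using circ_term_bound[of "norm s" n] by (metis order_refl)
  define f where "f = (\<lambda>m x. indicator {0..1} x *\<^sub>R (g (p x) * circ_term n s m x))"
  have pm: "p \<in> borel_measurable borel" unfolding p_def by measurable
  have cm: "circ_term n s m \<in> borel_measurable borel" for m unfolding circ_term_def by measurable
  have gpm: "(\<lambda>x. g (p x)) \<in> borel_measurable borel" using measurable_compose[OF pm g(2)] .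
  have fm: "f m \<in> borel_measurable lborel" for m
    unfolding f_def using gpm cm by measurable
  have ind: "integrable lborel (\<lambda>x::real. indicator {0..1} x *\<^sub>R c)" for c :: real
    by (intro integrable_indicator) auto
  have fb: "norm (f m x) \<le> indicator {0..1} x *\<^sub>R (B * (K2 * (1 / 2) ^ m))" for m x
    using mult_mono[OF gp K2(2) B norm_ge_zero] by (auto simp: f_def indicator_def norm_mult)
  have fi: "integrable lborel (f m)" for m
    by (rule Bochner_Integration.integrable_bound[OF ind[of "B * (K2 * (1 / 2) ^ m)"] fm])
       (rule AE_I2, rule order_trans[OF fb], simp only: real_norm_def abs_ge_self)
  have fs: "summable (\<lambda>m. norm (f m x))" for x
    by (rule summable_comparison_test'[of "\<lambda>m. indicator {0..1} x *\<^sub>R (B * (K2 * (1 / 2) ^ m))" 0])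
       (use fb in \<open>auto intro!: summable_mult summable_geometric\<close>)
  have fis: "summable (\<lambda>m. \<integral>x. norm (f m x) \<partial>lborel)"
  proof (rule summable_comparison_test'[of "\<lambda>m. B * (K2 * (1 / 2) ^ m)" 0])
    show "summable (\<lambda>m. B * (K2 * (1 / 2) ^ m))" by (intro summable_mult summable_geometric) auto
    fix m
    have "(\<integral>x. norm (f m x) \<partial>lborel) \<le> (\<integral>x. indicator {0..1::real} x *\<^sub>R (B * (K2 *
        (1 / 2) ^ m)) \<partial>lborel)"
      using fb fi by (intro integral_mono ind) auto
    also have "\<dots> = B * (K2 * (1 / 2) ^ m)" by simp
    finally show "norm (\<integral>x. norm (f m x) \<partial>lborel) \<le> B * (K2 * (1 / 2) ^ m)" by simp
  qed
  have sums: "(\<lambda>m. integral\<^sup>L lborel (f m)) sums (\<integral>x. suminf (\<lambda>m. f m x) \<partial>lborel)"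
    by (rule sums_integral[OF fi _ fis]) (use fs in auto)
  have "suminf (\<lambda>m. f m x) = indicator {0..1} x *\<^sub>R F x" for x
  proof (cases "x \<in> {0..1}")
    case True
    have "suminf (\<lambda>m. f m x) = g (p x) * circ_weight n s x"
      unfolding f_def using True summable_norm_cancel[OF summable_circ_term] by (simp add: suminf_mult)
    then show ?thesis
      using True by (simp add: F_def reg_path_def reg_weight_def p_def R_def)
  qed (simp add: f_def)
  moreover have "integral\<^sup>L lborel (f m) = exp ((s + of_nat m) * of_real L) * reg_coeff s m * a m" for m
  proof -
    define c where "c = (1 / 2) ^ m * (exp (s * of_real L) * reg_coeff s m)"
    define h where "h = (\<lambda>x. g (p x) * exp (- (2 * of_real pi * \<i> * of_nat m * of_real x)))"
    have fh: "f m x = c * (indicator {0..1} x *\<^sub>R h x)" for x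
      unfolding f_def circ_term_def half L_def[symmetric] c_def h_def by (simp add: mult_ac)
    have hm: "h \<in> borel_measurable borel" unfolding h_def using gpm by measurable
    have hb: "norm (h x) \<le> B" for x using gp[of x] by (simp add: h_def norm_mult)
    have "set_integrable lborel {0..1} h"
      unfolding set_integrable_def
    proof (rule Bochner_Integration.integrable_bound[OF ind[of B]])
      show "(\<lambda>x. indicat_real {0..1} x *\<^sub>R h x) \<in> borel_measurable lborel" using hm by measurable
      show "AE x in lborel. norm (indicat_real {0..1} x *\<^sub>R h x) \<le> norm (indicat_real {0..1} x *\<^sub>R B)"
        using hb B by (intro AE_I2) (auto simp: indicator_def)
    qed
    then have "(\<integral>x. indicator {0..1} x *\<^sub>R h x \<partial>lborel) = integral {0..1} h"
      by (simp add: set_borel_integral_eq_integral(2)[symmetric] set_lebesgue_integral_def)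
    also have "\<dots> = a m * of_real R ^ m"
      unfolding h_def p_def a_def
      by (rule integral_unique, rule circle_fourier_coeff) (use g(1) R in \<open>simp_all only: half\<close>)
    finally have "integral\<^sup>L lborel (f m) = c * (a m * of_real R ^ m)"
      unfolding fh by (simp only: integral_mult_right_zero)
    \<comment> \<open>The Fourier coefficient brings R^m and \<open>circ_term\<close> brings
      (1/2)^m; together they are (R/2)^m = exp (m L).\<close>
    also have "exp ((s + of_nat m) * of_real L) = exp (s * of_real L) * of_real R ^ m * (1 / 2) ^ m"
    proof -
      have "exp (of_real L) = complex_of_real (R / 2)"
        using R by (simp add: L_def exp_of_real)
      then have "exp (of_nat m * of_real L) = complex_of_real (R / 2) ^ m"
        by (simp only: exp_of_nat_mult)
      then show ?thesis by (simp add: distrib_right exp_add power_divide)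
    qed
    ultimately show ?thesis by (simp add: c_def mult_ac)
  qed
  ultimately have "(\<lambda>m. exp ((s + of_nat m) * of_real L) * reg_coeff s m * a m) sums
      (integral\<^sup>L lborel F - rGamma s * ray_integral n g s)"
    unfolding total using sums by simp
  then show ?thesis
    unfolding half L_def[symmetric] F_def a_def .
qed

text \<open>Permits changing an integrand at one point of the contour: the parameters that reach
  this point form a null set.\<close>

lemma finite_hankel_fiber: "e > 0 \<Longrightarrow> finite {x. hankel e x = z}"
proof -
  assume e: "e > 0"
  define A where "A = {x. 0 \<le> x \<and> x \<le> 2 * pi \<and> hankel e x = z}"
  have "finite A"
  proof (cases "A = {}")
    case False
    then obtain x0 where x0: "x0 \<in> A" by blast
    have "A \<subseteq> {x0 - 2 * pi, x0, x0 + 2 * pi}"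
    proof
      fix x assume x: "x \<in> A"
      then have "exp (\<i> * of_real x) = exp (\<i> * of_real x0)"
        using x0 e by (auto simp: A_def hankel_mid)
      then obtain k :: int where "\<i> * of_real x = \<i> * of_real x0 + (of_int (2 * k) * pi) * \<i>"
        unfolding exp_eq by blast
      then have "Im (\<i> * of_real x) = Im (\<i> * of_real x0 + (of_int (2 * k) * pi) * \<i>)"
          by (rule arg_cong)
      then have k: "x = x0 + 2 * of_int k * pi" by simp
      have "\<bar>2 * of_int k * pi\<bar> \<le> 2 * pi"
        using x x0 unfolding k A_def by auto
      then have "\<bar>of_int k\<bar> \<le> (1::real)" by (simp add: abs_mult)
      then have "k = -1 \<or> k = 0 \<or> k = 1" by linarith
      then show "x \<in> {x0 - 2 * pi, x0, x0 + 2 * pi}" using k by auto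
    qed
    then show ?thesis using finite_subset by blast
  qed simp
  moreover have "{x. hankel e x = z} \<subseteq> insert (e - Re z) (insert (Re z - e + 2 * pi) A)"
  proof
    fix x assume x: "x \<in> {x. hankel e x = z}"
    consider "x \<le> 0" | "0 \<le> x" "x \<le> 2 * pi" | "x \<ge> 2 * pi" by linarith
    then show "x \<in> insert (e - Re z) (insert (Re z - e + 2 * pi) A)"
      using x e by cases (auto simp: hankel_neg hankel_pos A_def)
  qed
  ultimately show ?thesis by (meson finite.insertI finite_subset)
qed

section \<open>The Hankel functional at non-integral s\<close>

lemma hankel_log_alt:
  "hankel_log e x = of_real (ln (e + max 0 (- x) + max 0 (x - 2 * pi))) + \<i> *
      of_real (min (max x 0) (2 * pi))"
proof -
  consider "x \<le> 0" | "0 < x" "x \<le> 2 * pi" | "x > 2 * pi" by linarith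
  then show ?thesis
  proof cases
    case 1
    then have "x \<le> 2 * pi" using pi_gt_zero by linarith
    with 1 show ?thesis by (simp add: hankel_log_def)
  next
    case 3
    then have "x > 0" using pi_gt_zero by linarith
    with 3 show ?thesis by (simp add: hankel_log_def)
  qed (simp add: hankel_log_def)
qed

lemma continuous_hankel_log: "e > 0 \<Longrightarrow> continuous_on A (hankel_log e)"
proof -
  assume "e > 0"
  then have "e + max 0 (- x) + max 0 (x - 2 * pi) \<noteq> 0" for x
    by (auto simp: max_def)
  then have "continuous_on A (\<lambda>x. of_real (ln (e + max 0 (- x) + max 0 (x - 2 * pi))) + \<i> *
      of_real (min (max x 0) (2 * pi)))"
    by (intro continuous_intros) auto
  then show ?thesis by (simp add: hankel_log_alt[abs_def])
qed

lemma hankel_log_has_derivative: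
  assumes "e > 0" "x \<notin> {0, 2 * pi}"
  obtains D where "(hankel_log e has_vector_derivative D) (at x)"
proof -
  consider "x < 0" | "0 < x" "x < 2 * pi" | "x > 2 * pi" using assms(2) by fastforce
  then show ?thesis
  proof cases
    case 1
    have "((\<lambda>x. complex_of_real (ln (e - x))) has_vector_derivative of_real (inverse (e - x) *
        (- 1))) (at x)"
      using 1 assms(1) by (intro has_vector_derivative_of_real)
          (auto intro!: derivative_eq_intros simp: inverse_eq_divide simp flip: has_real_derivative_iff_has_vector_derivative)
    then have "(hankel_log e has_vector_derivative of_real (inverse (e - x) * (- 1))) (at x)"
      by (rule has_vector_derivative_transform_within_open[of _ _ _
          "{..<0}"]) (use 1 in \<open>auto simp: hankel_log_def\<close>)
    then show ?thesis by (rule that)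
  next
    case 2
    have "((\<lambda>x. complex_of_real (ln e) + \<i> * of_real x) has_vector_derivative \<i>) (at x)"
      by (auto intro!: derivative_eq_intros has_vector_derivative_real_field)
    then have "(hankel_log e has_vector_derivative \<i>) (at x)"
      by (rule has_vector_derivative_transform_within_open[of _ _ _
          "{0<..<2*pi}"]) (use 2 in \<open>auto simp: hankel_log_def\<close>)
    then show ?thesis by (rule that)
  next
    case 3
    have "((\<lambda>x. complex_of_real (ln (e + (x - 2 * pi)))) has_vector_derivative of_real (inverse (e +
        (x - 2 * pi)) * 1)) (at x)"
      using 3 assms(1) by (intro has_vector_derivative_of_real)
          (auto intro!: derivative_eq_intros simp: inverse_eq_divide simp flip: has_real_derivative_iff_has_vector_derivative)
    then have "((\<lambda>x. complex_of_real (ln (e + (x - 2 * pi))) + \<i> * of_real (2 * pi))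
        has_vector_derivative of_real (inverse (e + (x - 2 * pi)) * 1)) (at x)"
      unfolding has_vector_derivative_add_const .
    moreover have "\<not> y \<le> 0" if "y > 2 * pi" for y
      using that pi_gt_zero by linarith
    ultimately have "(hankel_log e has_vector_derivative of_real (inverse (e + (x - 2 * pi)) *
        1)) (at x)"
      using 3 by (elim has_vector_derivative_transform_within_open[of _ _ _
          "{2*pi<..}"]) (auto simp: hankel_log_def)
    then show ?thesis by (rule that)
  qed
qed

text \<open>
  The function \<open>l \<mapsto> exp (s * l) * P (exp l)\<close> is an antiderivative of
  \<open>l \<mapsto> exp (s * l) * g (exp l)\<close>; it is evaluated along the logarithm of the contour.
\<close>

lemma powser_shifted_antiderivative:
  fixes a :: "nat \<Rightarrow> complex"
  assumes s: "s \<notin> \<int>" and sums: "\<And>t. norm t < r \<Longrightarrow> (\<lambda>m. a m * t ^ m) sums g t"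
  defines "P \<equiv> (\<lambda>t. suminf (\<lambda>m. (a m / (of_nat m + s)) * t ^ m))"
  assumes t: "norm t < r"
  shows "summable (\<lambda>m. (a m / (of_nat m + s)) * t ^ m)"
    and "\<exists>D. (P has_field_derivative D) (at t) \<and> s * P t + t * D = g t"
proof -
  define b where "b = (\<lambda>m. a m / (of_nat m + s))"
  have ne: "of_nat m + s \<noteq> 0" for m
    using s by (metis Ints_minus Ints_of_nat add_eq_0_iff minus_minus)
  obtain q where q: "norm t < q" "q < r" using dense[OF t] by blast
  have q0: "q > 0" using q(1) norm_ge_zero[of t] by linarith
  have sum_b: "summable (\<lambda>m. b m * z ^ m)" if z: "norm z < r" for z
  proof -
    obtain q where q: "norm z < q" "q < r" using dense[OF z] by blast
    have "q > 0" using q(1) norm_ge_zero[of z] by linarith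
    then have q': "norm (complex_of_real q) = q" by simp
    have "summable (\<lambda>m. a m * of_real q ^ m)"
      using sums[of "of_real q"] q' q by (simp add: sums_iff)
    then have "summable (\<lambda>m. norm (a m * z ^ m))"
      by (rule powser_insidea) (use q q' in simp)
    \<comment> \<open>For m \<ge> norm s + 1 the divisor m + s has norm at least 1, so the new terms
      are eventually no larger than the old ones.\<close>
    moreover have "\<exists>N. \<forall>m\<ge>N. norm (b m * z ^ m) \<le> norm (a m * z ^ m)"
    proof (intro exI allI impI)
      fix m assume "nat \<lceil>norm s + 1\<rceil> \<le> m"
      then have "real m \<ge> norm s + 1" by linarith
      then have "norm (of_nat m + s) \<ge> 1"
        using norm_triangle_ineq4[of "of_nat m + s" s] by simp
      then have "norm (a m) / norm (of_nat m + s) \<le> norm (a m) / 1"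
        by (intro divide_left_mono) (auto simp: ne intro!: mult_pos_pos)
      then show "norm (b m * z ^ m) \<le> norm (a m * z ^ m)"
        unfolding b_def norm_mult norm_divide by (intro mult_right_mono) auto
    qed
    ultimately show ?thesis by (rule summable_comparison_test[rotated])
  qed
  show "summable (\<lambda>m. (a m / (of_nat m + s)) * t ^ m)"
    using sum_b[OF t] by (simp add: b_def)
  have qc: "norm (complex_of_real q) < r" "norm t < norm (complex_of_real q)" using q q0 by auto
  have P_alt: "P = (\<lambda>t. suminf (\<lambda>m. b m * t ^ m))"
    by (simp only: P_def b_def)
  have deriv: "(P has_field_derivative suminf (\<lambda>m. diffs b m * t ^ m)) (at t)"
    unfolding P_alt using sum_b[OF qc(1)] qc(2) by (intro termdiffs_strong[of b "of_real q"]) auto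
  have "summable (\<lambda>m. diffs b m * t ^ m)"
    by (rule termdiff_converges[of t q b]) (use q sum_b in auto)
  then have "(\<lambda>m. of_nat m * b m * t ^ (m - Suc 0)) sums suminf (\<lambda>m. diffs b m * t ^ m)"
    by (rule diffs_equiv)
  then have "(\<lambda>m. t * (of_nat m * b m * t ^ (m - Suc 0))) sums (t * suminf (\<lambda>m. diffs b m * t ^ m))"
    by (rule sums_mult)
  moreover have "t * (of_nat m * b m * t ^ (m - Suc 0)) = of_nat m * b m * t ^ m" for m
    by (cases m) auto
  ultimately have 1: "(\<lambda>m. of_nat m * b m * t ^ m) sums (t * suminf (\<lambda>m. diffs b m * t ^ m))"
    by simp
  have "(\<lambda>m. s * (b m * t ^ m)) sums (s * P t)"
    unfolding P_alt by (intro sums_mult summable_sums sum_b t)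
  from sums_add[OF this 1] have "(\<lambda>m. (of_nat m + s) * b m * t ^ m) sums (s * P t + t * suminf
      (\<lambda>m. diffs b m * t ^ m))"
    by (simp add: algebra_simps)
  moreover have "(of_nat m + s) * b m = a m" for m
    using ne by (simp add: b_def)
  ultimately have "(\<lambda>m. a m * t ^ m) sums (s * P t + t * suminf (\<lambda>m. diffs b m * t ^ m))"
    by simp
  then have "s * P t + t * suminf (\<lambda>m. diffs b m * t ^ m) = g t"
    using sums[OF t] sums_unique2 by blast
  with deriv show "\<exists>D. (P has_field_derivative D) (at t) \<and> s * P t + t * D = g t" by blast
qed

text \<open>The parameter line is cut where the contour passes l = 1/(2(n+1)) on its way in and out.
  The outer pieces are one ray, traversed in opposite directions with logarithms differing by 2 pi
  i; the inner piece is given by an antiderivative whose end values differ by the factor exp (2 pi i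
  s).\<close>

lemma hankel_functional:
  assumes g: "g holomorphic_on ball 0 (2 / (real n + 1))" "g \<in> borel_measurable borel"
    and bound: "\<And>t. in_strip n t \<Longrightarrow> norm (g t) \<le> C * exp (- Re t / 4)" "C \<ge> 0"
    and s: "s \<notin> \<int>" and e: "0 < e" "e < 1 / (2 * (real n + 1))"
  shows "(\<integral>x. g (hankel e x) * (hankel_power e (s - 1) x * vector_derivative (hankel e)
      (at x)) \<partial>lborel) =
    (exp (2 * of_real pi * \<i> * s) - 1) * (ray_integral n g s +
      exp (s * of_real (ln (1 / (2 * (real n + 1))))) *
        suminf (\<lambda>m. (deriv ^^ m) g 0 / fact m / (of_nat m + s) * of_real (1 / (2 * (real n + 1))) ^ m))"
proof -
  define R where "R = 1 / (real n + 1)"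
  have R: "R > 0" by (simp add: R_def)
  have half: "1 / (2 * (real n + 1)) = R / 2" "2 / (real n + 1) = 2 * R" by (simp_all add: R_def)
  define L where "L = ln (R / 2)"
  let ?E = "exp (2 * of_real pi * \<i> * s)"
  let ?q = "\<lambda>x. g (of_real (R / 2 - x)) * exp ((s - 1) * of_real (ln (R / 2 - x)))"
  define P where "P = (\<lambda>t. suminf (\<lambda>m. ((deriv ^^ m) g 0 / fact m / (of_nat m + s)) * t ^ m))"
  have "(\<lambda>m. (deriv ^^ m) g 0 / fact m * t ^ m) sums g t" if "norm t < 2 * R" for t
    using holomorphic_power_series[of g 0 "2 * R" t] g(1) that unfolding half by simp
  then have P: "\<exists>D. (P has_field_derivative D) (at t) \<and> s * P t + t * D = g t" if "norm t < 2 * R" for t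
    unfolding P_def by (rule powser_shifted_antiderivative(2)[OF s _ that])
  \<comment> \<open>At the parameters -d and 2 pi + d the contour is at the point R/2 = l.\<close>
  define d where "d = R / 2 - e"
  have d: "d > 0" using e(2) unfolding half by (simp add: d_def)
  define F where "F = (\<lambda>x. g (hankel e x) * (hankel_power e (s - 1) x * vector_derivative (hankel e)
      (at x)))"
  obtain K where "path_weight n K (hankel e) (\<lambda>x. 1 * (hankel_power e (s - 1) x *
      vector_derivative (hankel e) (at x)))"
    using path_weight_hankel[of e n 1 "s - 1"] e half R unfolding R_def[symmetric]
        by (auto simp: R_def[symmetric])
  then have F: "integrable lborel F"
    unfolding F_def using integrable_path_weight[OF _ g(2) bound] by simp
  define A where "A = {- d..2 * pi + d}"
  let ?I = "\<lambda>B. \<integral>x. indicator B x *\<^sub>R F x \<partial>lborel"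
  have split: "F x = indicator {..<- d} x *\<^sub>R F x + indicator A x *\<^sub>R F x + indicator {2 * pi +
      d<..} x *\<^sub>R F x" for x
  proof -
    have "- d < 2 * pi + d" using d pi_gt_zero by linarith
    then show ?thesis by (cases "x < - d"; cases "x > 2 * pi + d") (auto simp: A_def)
  qed
  have int: "integrable lborel (\<lambda>x. indicator B x *\<^sub>R F x)" if "B \<in> sets lborel" for B
    using F that by (auto intro!: integrable_mult_indicator)
  have meas: "{..<- d} \<in> sets lborel" "A \<in> sets lborel" "{2 * pi + d<..} \<in> sets lborel"
    by (auto simp: A_def)
  have "integral\<^sup>L lborel F = (\<integral>x. indicator {..<- d} x *\<^sub>R F x + indicator A x *\<^sub>R F x +
      indicator {2 * pi + d<..} x *\<^sub>R F x \<partial>lborel)"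
    unfolding split[symmetric] ..
  also have "\<dots> = ?I {..<- d} + ?I A + ?I {2 * pi + d<..}"
    using int[OF meas(1)] int[OF meas(2)] int[OF meas(3)]
    by (simp only: Bochner_Integration.integral_add Bochner_Integration.integrable_add)
  also have "?I {..<- d} = - ray_integral n g s"
  proof -
    have "?I {..<- d} = (\<integral>x. indicator {..<- d} (- d + 1 * x) *\<^sub>R F (- d + 1 * x) \<partial>lborel)"
      using lborel_integral_real_affine[of 1 "\<lambda>x. indicator {..<- d} x *\<^sub>R F x" "- d"] by simp
    also have "\<dots> = (\<integral>x. - (indicator {..<0} x *\<^sub>R ?q x) \<partial>lborel)"
    proof (rule Bochner_Integration.integral_cong[OF refl])
      fix x :: real
      have "F (- d + 1 * x) = - ?q x" if x: "x < 0"
      proof -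
        have y: "- d + 1 * x < 0" "e - (- d + 1 * x) = R / 2 - x" using x d by (auto simp: d_def)
        have l: "hankel_log e (- d + 1 * x) = of_real (ln (R / 2 - x))"
          using y by (simp add: hankel_log_def d_def)
        have h: "hankel e (- d + 1 * x) = of_real (R / 2 - x)"
          unfolding hankel_neg[OF e(1) less_imp_le[OF y(1)]] y(2) ..
        show ?thesis
          unfolding F_def h hankel_power_def l hankel_derivative(1)[OF e(1) y(1)] by simp
      qed
      then show "indicator {..<- d} (- d + 1 * x) *\<^sub>R F (- d + 1 * x) =
          - (indicator {..<0} x *\<^sub>R ?q x)"
        by (cases "x < 0") (simp_all add: indicator_def del: of_real_diff)
    qed
    also have "\<dots> = - ray_integral n g s"
      unfolding ray_integral_def half by (rule integral_minus)
    finally show ?thesis .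
  qed
  also have "?I {2 * pi + d<..} = ?E * ray_integral n g s"
  proof -
    have "?I {2 * pi + d<..} =
        (\<integral>x. indicator {2 * pi + d<..} (2 * pi + d + (- 1) * x) *\<^sub>R F (2 * pi + d + (- 1) * x) \<partial>lborel)"
      using lborel_integral_real_affine[of "- 1" "\<lambda>x. indicator {2 * pi + d<..} x *\<^sub>R F x" "2 * pi +
          d"] by simp
    also have "\<dots> = (\<integral>x. ?E * (indicator {..<0} x *\<^sub>R ?q x) \<partial>lborel)"
    proof (rule Bochner_Integration.integral_cong[OF refl])
      fix x :: real
      have "F (2 * pi + d + (- 1) * x) = ?E * ?q x" if x: "x < 0"
      proof -
        define y where "y = 2 * pi + d + (- 1) * x"
        have y: "y > 2 * pi" "e + (y - 2 * pi) = R / 2 - x" using x d by (auto simp: y_def d_def)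
        have y0: "\<not> y \<le> 0" "\<not> y \<le> 2 * pi" using y pi_gt_zero by linarith+
        have l: "hankel_log e y = of_real (ln (R / 2 - x)) + \<i> * of_real (2 * pi)"
          unfolding hankel_log_def y(2) using y0 by simp
        have h: "hankel e y = of_real (R / 2 - x)"
          unfolding hankel_pos[OF e(1) less_imp_le[OF y(1)]] y(2) ..
        have "exp ((s - 1) * (\<i> * of_real (2 * pi))) = ?E"
        proof -
          have "(s - 1) * (\<i> * of_real (2 * pi)) = 2 * of_real pi * \<i> * s - \<i> * (of_real pi * 2)"
            by (simp add: algebra_simps)
          then show ?thesis by (simp only: exp_diff exp_two_pi_i') simp
        qed
        then show ?thesis
          unfolding y_def[symmetric] F_def h hankel_power_def l hankel_derivative(3)[OF e(1) y(1)]
          by (simp only: distrib_left exp_add mult_1_right mult_1_left mult_ac)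
      qed
      then show "indicator {2 * pi + d<..} (2 * pi + d + (- 1) * x) *\<^sub>R F (2 * pi + d + (- 1) * x) =
          ?E * (indicator {..<0} x *\<^sub>R ?q x)"
        by (cases "x < 0") (simp_all add: indicator_def del: of_real_diff)
    qed
    also have "\<dots> = ?E * ray_integral n g s"
      unfolding ray_integral_def half by (rule integral_mult_right_zero)
    finally show ?thesis .
  qed
  also have "?I A = (?E - 1) * (exp (s * of_real L) * P (of_real (R / 2)))"
  proof -
    define psi where "psi = (\<lambda>x. exp (s * hankel_log e x) * P (hankel e x))"
    have hn: "norm (hankel e x) < 2 * R" if "x \<in> A" for x
    proof -
      consider "x \<le> 0" | "0 \<le> x" "x \<le> 2 * pi" | "x \<ge> 2 * pi" by linarith
      then show ?thesis
        using that e R d by cases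
          (auto simp: hankel_neg hankel_mid hankel_pos A_def d_def half norm_mult simp del: of_real_diff of_real_add)
    qed
    have deriv: "(psi has_vector_derivative F x) (at x)" if x: "x \<in> {- d<..<2 * pi + d} - {0, 2 *
        pi}" for x
    proof -
      obtain D where D: "(hankel_log e has_vector_derivative D) (at x)"
        using hankel_log_has_derivative[OF e(1)] x by blast
      have hankel: "hankel e x = exp (hankel_log e x)" for x by (simp add: hankel_def)
      let ?l = "hankel_log e x" and ?h = "exp (hankel_log e x)"
      have "(exp \<circ> hankel_log e has_vector_derivative D * ?h) (at x)"
        by (rule field_vector_diff_chain_at[OF D DERIV_exp])
      then have vd: "vector_derivative (hankel e) (at x) = D * hankel e x"
        unfolding hankel by (intro vector_derivative_at) (simp add: o_def hankel_def[abs_def])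
      have "norm (?h) < 2 * R"
        using hn[of x] x by (simp add: hankel A_def)
      from P[OF this] obtain D' where D': "(P has_field_derivative D') (at (?h))"
        "s * P (?h) + ?h * D' = g (?h)" by blast
      have "((\<lambda>l. exp (s * l) * P (exp l)) has_field_derivative exp (s * ?l) * g (?h)) (at ?l)"
      proof -
        have "((\<lambda>l. P (exp l)) has_field_derivative D' * ?h) (at ?l)"
          by (rule DERIV_chain2[where f = P and g = exp, OF D'(1) DERIV_exp])
        moreover have "((\<lambda>l. exp (s * l)) has_field_derivative s * exp (s * ?l)) (at ?l)"
          by (auto intro!: derivative_eq_intros)
        ultimately show ?thesis
          unfolding D'(2)[symmetric] by (auto intro!: derivative_eq_intros simp: algebra_simps)
      qed
      from field_vector_diff_chain_at[OF D this]
      have "(psi has_vector_derivative D * (exp (s * ?l) * g (?h))) (at x)"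
        by (simp add: psi_def o_def hankel)
      \<comment> \<open>This is t^(s-1) dt = t^s d(log t), with D the derivative of the logarithm
        along the contour.\<close>
      moreover have "F x = D * (exp (s * ?l) * g (?h))"
      proof -
        have "exp ((s - 1) * ?l) = exp (s * ?l) / ?h"
          by (simp add: left_diff_distrib exp_diff)
        then show ?thesis
          unfolding F_def vd hankel_power_def hankel by simp
      qed
      ultimately show ?thesis by simp
    qed
    have "continuous_on A psi"
    proof -
      have Pc: "continuous_on (ball 0 (2 * R)) P"
      proof (intro continuous_at_imp_continuous_on ballI)
        fix t :: complex assume "t \<in> ball 0 (2 * R)"
        then show "isCont P t" using P[of t] DERIV_isCont by fastforce
      qed
      have hc: "continuous_on A (hankel e)"
        unfolding hankel_def by (intro continuous_intros continuous_hankel_log e)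
      have "continuous_on A (\<lambda>x. P (hankel e x))"
        by (rule continuous_on_compose2[OF Pc hc]) (use hn in auto)
      then show ?thesis
        unfolding psi_def by (intro continuous_intros continuous_hankel_log e)
    qed
    \<comment> \<open>The corners 0 and 2 pi are the exceptional points of the fundamental theorem;
      continuity of \<open>psi\<close> bridges them.\<close>
    then have "(F has_integral psi (2 * pi + d) - psi (- d)) A"
      unfolding A_def using deriv d pi_gt_zero
      by (intro fundamental_theorem_of_calculus_interior_strong[of "{0, 2 * pi}"]) auto
    moreover have "set_integrable lborel A F"
      unfolding set_integrable_def using int[OF meas(2)] .
    ultimately have "?I A = psi (2 * pi + d) - psi (- d)"
      using set_borel_integral_eq_integral(2)[of A F] integral_unique
      by (simp add: set_lebesgue_integral_def)
    moreover have "psi (- d) = exp (s * of_real L) * P (of_real (R / 2))"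
    proof -
      have "e - - d = R / 2" by (simp add: d_def)
      then have "hankel e (- d) = of_real (R / 2)" using hankel_neg[OF e(1), of "- d"] d by (simp only:)
      moreover have "hankel_log e (- d) = of_real L" using d by (simp add: hankel_log_def d_def L_def)
      ultimately show ?thesis by (simp only: psi_def)
    qed
    moreover have "psi (2 * pi + d) = ?E * (exp (s * of_real L) * P (of_real (R / 2)))"
    proof -
      have n: "\<not> 2 * pi + d \<le> 0" "\<not> 2 * pi + d \<le> 2 * pi" using d pi_gt_zero by linarith+
      have x: "e + (2 * pi + d - 2 * pi) = R / 2" by (simp add: d_def)
      have "hankel e (2 * pi + d) = of_real (R / 2)"
        using hankel_pos[OF e(1), of "2 * pi + d"] d unfolding x by simp
      moreover have "hankel_log e (2 * pi + d) = of_real L + \<i> * of_real (2 * pi)"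
        unfolding hankel_log_def x L_def using n by simp
      ultimately have "psi (2 * pi + d) = exp (s * (of_real L + \<i> * of_real (2 * pi))) *
          P (of_real (R / 2))"
        by (simp only: psi_def)
      then show ?thesis by (simp add: distrib_left exp_add mult_ac)
    qed
    ultimately show ?thesis by (simp add: left_diff_distrib)
  qed
  finally show ?thesis
    unfolding F_def half L_def P_def by (simp add: algebra_simps)
qed

text \<open>Both functionals equal the ray integral plus the same series in the Taylor coefficients
  of g, times 1/Gamma(s). The function g0 stands for the kernel with its default value at a zero of
  the denominator.\<close>

lemma hankel_eq_reg:
  assumes g: "g holomorphic_on ball 0 (2 / (real n + 1))" "g \<in> borel_measurable borel"
    and bound: "\<And>t. in_strip n t \<Longrightarrow> norm (g t) \<le> C * exp (- Re t / 4)" "C \<ge> 0"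
    and s: "s \<notin> \<int>" and e: "0 < e" "e < 1 / (2 * (real n + 1))"
    and g0: "g0 \<in> borel_measurable borel" "\<And>t. t \<noteq> z \<Longrightarrow> g0 t = g t"
  shows "(\<integral>x. g0 (hankel e x) * (1 / ((exp (2 * of_real pi * \<i> * s) - 1) * Gamma s) *
      (hankel_power e (s - 1) x * vector_derivative (hankel e) (at x))) \<partial>lborel) =
    (\<integral>x. g (reg_path n x) * reg_weight n s x \<partial>lborel)"
proof -
  let ?E = "exp (2 * of_real pi * \<i> * s)"
  define c where "c = 1 / ((?E - 1) * Gamma s)"
  define l where "l = 1 / (2 * (real n + 1))"
  let ?a = "\<lambda>m. (deriv ^^ m) g 0 / fact m / (of_nat m + s) * of_real l ^ m"
  have l: "l > 0" by (simp add: l_def)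
  define w where "w = (\<lambda>x. hankel_power e (s - 1) x * vector_derivative (hankel e) (at x))"
  have wm: "w \<in> borel_measurable borel"
  proof -
    obtain K where "path_weight n K (hankel e) (\<lambda>x. 1 * (hankel_power e (s - 1) x *
        vector_derivative (hankel e) (at x)))"
    proof (rule path_weight_hankel[OF e(1)])
      show "e \<le> 1 / (real n + 1)" using e by (simp add: field_simps)
    qed
    then show ?thesis by (simp add: path_weight_def w_def)
  qed
  have null: "AE x in lborel. x \<notin> {x. hankel e x = z}"
    by (intro AE_not_in finite_imp_null_set_lborel finite_hankel_fiber e)
  have "(\<integral>x. g0 (hankel e x) * (c * w x) \<partial>lborel) = (\<integral>x. g (hankel e x) * (c * w x) \<partial>lborel)"
  proof (rule integral_cong_AE)
    show "AE x in lborel. g0 (hankel e x) * (c * w x) = g (hankel e x) * (c * w x)"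
      using null by eventually_elim (simp add: g0)
  qed (use wm in \<open>auto intro!: borel_measurable_times measurable_compose[OF hankel_measurable] g0 g\<close>)
  also have "\<dots> = c * (\<integral>x. g (hankel e x) * w x \<partial>lborel)"
    by (simp add: mult.left_commute)
  also have "\<dots> = c * (?E - 1) * (ray_integral n g s +
      exp (s * of_real (ln l)) * suminf ?a)"
    unfolding w_def l_def by (simp only: hankel_functional[OF g bound s e] mult.assoc)
  also have "c * (?E - 1) = rGamma s"
  proof -
    \<comment> \<open>Non-integrality of s enters here: the factor E - 1 cancels and
      \<open>rGamma s\<close> is left.\<close>
    have "?E \<noteq> 1"
    proof
      assume "?E = 1"
      then have "?E = exp 0" by simp
      then obtain k :: int where "2 * of_real pi * \<i> * s = (of_int (2 * k) * pi) * \<i>"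
        unfolding exp_eq by auto
      then have "s = of_int k" by (simp add: field_simps)
      then show False using s by simp
    qed
    then show ?thesis by (simp add: c_def Gamma_def inverse_eq_divide)
  qed
  also have "rGamma s * (ray_integral n g s + exp (s * of_real (ln l)) *
      suminf ?a) =
      (\<integral>x. g (reg_path n x) * reg_weight n s x \<partial>lborel)"
  proof -
    have ne: "of_nat m + s \<noteq> 0" for m
      using s by (metis Ints_minus Ints_of_nat add_eq_0_iff minus_minus)
    have tm: "exp ((s + of_nat m) * of_real (ln l)) * reg_coeff s m * ((deriv ^^ m) g 0 / fact m) =
        (rGamma s * exp (s * of_real (ln l))) * (?a m)" for m
    proof -
      have rc: "reg_coeff s m = rGamma s / (of_nat m + s)"
        using reg_coeff_eq[of s m] ne[of m] by (simp add: field_simps)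
      moreover have "exp (of_nat m * complex_of_real (ln l)) = of_real l ^ m"
        using l by (simp add: exp_of_nat_mult exp_of_real)
      ultimately have "exp ((s + of_nat m) * of_real (ln l)) = exp (s * of_real (ln l)) * of_real l ^ m"
        by (simp add: distrib_right exp_add)
      then show ?thesis by (simp only: rc) (simp add: mult_ac)
    qed
    have "(\<lambda>m. (deriv ^^ m) g 0 / fact m * t ^ m) sums g t" if "norm t < 2 / (real n + 1)" for t
      using holomorphic_power_series[of g 0 "2 / (real n + 1)" t] g(1) that by simp
    moreover have "norm (complex_of_real l) < 2 / (real n + 1)" using l
      by (simp only: norm_of_real abs_of_pos) (simp add: l_def field_simps)
    ultimately have "summable (\<lambda>m. ?a m)"
      by (intro powser_shifted_antiderivative(1)[OF s])
    then have "(\<lambda>m. (rGamma s * exp (s * of_real (ln l))) * (?a m)) sums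
        ((rGamma s * exp (s * of_real (ln l))) * suminf ?a)"
      by (intro sums_mult summable_sums)
    from sums_unique2[OF this, folded tm, OF reg_functional[OF g bound, of s, folded l_def]]
    show ?thesis by (simp add: algebra_simps)
  qed
  finally show ?thesis by (simp add: c_def w_def)
qed

section \<open>The entire extension\<close>

lemma path_weight_mono: "path_weight n K P w \<Longrightarrow> K \<le> K' \<Longrightarrow> path_weight n K' P w"
  unfolding path_weight_def by (meson exp_ge_zero mult_right_mono order_trans)

lemma path_weight_common:
  assumes "finite A" "\<And>k. k \<in> A \<Longrightarrow> \<exists>K. path_weight n K (P k) (w k)"
  obtains K where "\<And>k. k \<in> A \<Longrightarrow> path_weight n K (P k) (w k)"
proof -
  have "\<exists>K. \<forall>k\<in>A. path_weight n K (P k) (w k)"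
    using assms
  proof (induction A)
    case (insert a A)
    obtain K where K: "\<forall>k\<in>A. path_weight n K (P k) (w k)" using insert by blast
    obtain K' where K': "path_weight n K' (P a) (w a)" using insert.prems by blast
    show ?case
      using K K' by (intro exI[of _ "max K K'"]) (auto intro: path_weight_mono)
  qed simp
  then show ?thesis using that by blast
qed

lemma desing_quotient_measurable: "desing_quotient \<in> borel_measurable borel"
  unfolding desing_quotient_def by measurable

lemma desing_limit_measurable: "desing_limit \<in> borel_measurable borel"
  unfolding desing_limit_def desing_quotient_def by measurable

lemma desing_factor_measurable: "desing_factor c \<in> borel_measurable borel"
  unfolding desing_factor_def by measurable

lemma chain_cong:
  assumes "\<And>k. k \<in> {1..n} \<Longrightarrow> Q k = Q' k" "\<And>k. k \<in> {1..n} \<Longrightarrow> P k = P' k" "\<And>k. k \<in> {1..n} \<Longrightarrow> w k = w' k"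
  shows "chain n Q P w = chain n Q' P' w'"
proof
  fix \<tau>
  have "Q j (\<Sum>k=j..n. P k (\<tau> k)) = Q' j (\<Sum>k=j..n. P' k (\<tau> k))" if "j \<in> {1..n}" for j
  proof -
    have "(\<Sum>k=j..n. P k (\<tau> k)) = (\<Sum>k=j..n. P' k (\<tau> k))"
      using that by (intro sum.cong refl) (simp add: assms(2))
    then show ?thesis by (simp add: assms(1)[OF that])
  qed
  then show "chain n Q P w \<tau> = chain n Q' P' w' \<tau>"
    unfolding chain_def by (intro arg_cong2[where f = "(*)"] prod.cong refl) (auto simp: assms(3))
qed

text \<open>Isolates the dependence on one coordinate: c occurs exactly in the tail sums that start
  at j \<le> c.\<close>

lemma chain_upd:
  assumes c: "c \<in> {1..n}"
  shows "chain n Q P w (\<tau>(c := y)) =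
    (\<Prod>j=1..c. Q j (P c y + (\<Sum>k\<in>{j..n} - {c}. P k (\<tau> k)))) * w c y *
    ((\<Prod>j=Suc c..n. Q j (\<Sum>k=j..n. P k (\<tau> k))) * (\<Prod>k\<in>{1..n} - {c}. w k (\<tau> k)))"
proof -
  have 1: "(\<Sum>k=j..n. P k ((\<tau>(c := y)) k)) = P c y + (\<Sum>k\<in>{j..n} - {c}. P k (\<tau> k))" if "j \<in> {1..c}" for j
    using c that by (subst sum.remove[of _ c]) (auto intro!: sum.cong)
  have 2: "(\<Sum>k=j..n. P k ((\<tau>(c := y)) k)) = (\<Sum>k=j..n. P k (\<tau> k))" if "j \<in> {Suc c..n}" for j
    using that by (auto intro!: sum.cong)
  have 3: "(\<Prod>k=1..n. w k ((\<tau>(c := y)) k)) = w c y * (\<Prod>k\<in>{1..n} - {c}. w k (\<tau> k))"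
    using c by (subst prod.remove[of _ c]) (auto intro!: prod.cong)
  have "{1..n} = {1..c} \<union> {Suc c..n}" using c by auto
  then have "(\<Prod>j=1..n. Q j (\<Sum>k=j..n. P k ((\<tau>(c := y)) k))) =
      (\<Prod>j=1..c. Q j (\<Sum>k=j..n. P k ((\<tau>(c := y)) k))) * (\<Prod>j=Suc c..n. Q j (\<Sum>k=j..n. P k ((\<tau>(c := y)) k)))"
    by (simp only:) (rule prod.union_disjoint, auto)
  also have "\<dots> = (\<Prod>j=1..c. Q j (P c y + (\<Sum>k\<in>{j..n} - {c}. P k (\<tau> k)))) *
      (\<Prod>j=Suc c..n. Q j (\<Sum>k=j..n. P k (\<tau> k)))"
    by (intro arg_cong2[where f = "(*)"] prod.cong refl arg_cong[where f = "Q _"]) (use 1 2 in auto)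
  finally show ?thesis
    unfolding chain_def 3 by (simp only: mult_ac)
qed

definition hankel_weight :: "real \<Rightarrow> complex \<Rightarrow> real \<Rightarrow> complex" where
  "hankel_weight e s x = 1 / ((exp (2 * of_real pi * \<i> * s) - 1) * Gamma s) *
     (hankel_power e (s - 1) x * vector_derivative (hankel e) (at x))"

text \<open>
  In the \<open>i\<close>-th hybrid the first \<open>i\<close> coordinates run along the regularized path.  When the coordinate
  \<open>i\<close> is replaced, the \<open>i\<close>-th kernel factor is freed from its junk value at \<open>0\<close> at the same time: with
  the other coordinates fixed, it occurs for finitely many parameters only.
\<close>

context
  fixes n :: nat and s :: "nat \<Rightarrow> complex" and e :: real
  assumes s: "\<And>k. k \<in> {1..n} \<Longrightarrow> s k \<notin> \<int>" and e: "0 < e" "e < 1 / (2 * (real n + 1))"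
begin

definition hybrid_kernel :: "nat \<Rightarrow> nat \<Rightarrow> complex \<Rightarrow> complex" where
  "hybrid_kernel i j = (if j \<le> i then desing_limit else desing_quotient)"

definition hybrid_path :: "nat \<Rightarrow> nat \<Rightarrow> real \<Rightarrow> complex" where
  "hybrid_path i k = (if k \<le> i then reg_path n else hankel e)"

definition hybrid_weight :: "nat \<Rightarrow> nat \<Rightarrow> real \<Rightarrow> complex" where
  "hybrid_weight i k = (if k \<le> i then reg_weight n (s k) else hankel_weight e (s k))"

abbreviation hybrid :: "nat \<Rightarrow> (nat \<Rightarrow> real) \<Rightarrow> complex" where
  "hybrid i \<equiv> chain n (hybrid_kernel i) (hybrid_path i) (hybrid_weight i)"

lemma path_weight_hybrid: "\<exists>K. path_weight n K (hybrid_path i k) (hybrid_weight i k)"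
proof (cases "k \<le> i")
  case True
  then show ?thesis
    unfolding hybrid_path_def hybrid_weight_def
    using path_weight_reg[of "norm (s k)" n] by (metis order_refl)
next
  case False
  have "e \<le> 1 / (real n + 1)" using e by (simp add: field_simps)
  then show ?thesis
    using path_weight_hankel[OF e(1), of n "1 / ((exp (2 * of_real pi * \<i> * s k) - 1) *
        Gamma (s k))" "s k - 1"] False
    unfolding hybrid_path_def hybrid_weight_def hankel_weight_def[abs_def] by auto
qed

lemma integrable_hybrid:
  assumes "n \<ge> 1"
  shows "integrable (lborel_n n) (hybrid i)"
proof -
  obtain C where C: "C > 0" "kernel_bound C desing_limit" "kernel_bound C desing_quotient"
      using kernel_bounds by blast
  obtain K where "\<And>k. k \<in> {1..n} \<Longrightarrow> path_weight n K (hybrid_path i k) (hybrid_weight i k)"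
    using path_weight_common[of "{1..n}" n "hybrid_path i" "hybrid_weight i"] path_weight_hybrid
        by blast
  then show ?thesis
    using assms C by (intro integrable_chain[where C = C and K =
        K]) (auto simp: hybrid_kernel_def desing_limit_measurable desing_quotient_measurable)
qed

text \<open>Fubini puts the coordinate Suc i innermost. With the others frozen, the kernel factors
  beyond Suc i are constant, and those up to i are already holomorphic by the earlier steps. Only
  the factor Suc i has to be altered, at a single value of t, before \<open>hankel_eq_reg\<close>
  applies.\<close>

lemma hybrid_step:
  assumes c: "Suc i \<le> n"
  shows "integral\<^sup>L (lborel_n n) (hybrid i) =
    integral\<^sup>L (lborel_n n) (hybrid (Suc i))"
proof -
  interpret product_sigma_finite "\<lambda>_::nat. lborel :: real measure"
    by (rule product_sigma_finite_lborel)
  define c where "c = Suc i"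
  define I where "I = {1..n} - {c}"
  have I: "finite I" "c \<notin> I" "insert c I = {1..n}" using c by (auto simp: I_def c_def)
  have c1: "c \<in> {1..n}" "1 \<le> n" using c by (auto simp: c_def)
  obtain C where C: "C > 0" "kernel_bound C desing_limit" using kernel_bounds by blast
  have insert: "integral\<^sup>L (lborel_n n) f = (\<integral>\<tau>. (\<integral>y. f (\<tau>(c := y)) \<partial>lborel) \<partial>(\<Pi>\<^sub>M k\<in>I. lborel))"
    if "integrable (lborel_n n) f" for f :: "(nat \<Rightarrow> real) \<Rightarrow> complex"
    using product_integral_insert[OF I(1,2), of f] that unfolding I(3) by simp
  have "(\<integral>y. hybrid i (\<tau>(c := y)) \<partial>lborel) =
      (\<integral>y. hybrid c (\<tau>(c := y)) \<partial>lborel)" for \<tau> :: "nat \<Rightarrow> real"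
  proof -
    define v where "v = (\<lambda>j. \<Sum>k\<in>{j..n} - {c}. hybrid_path i k (\<tau> k))"
    define d where "d = (\<Prod>j=Suc c..n. desing_quotient (\<Sum>k=j..n. hybrid_path i k (\<tau> k))) *
        (\<Prod>k\<in>{1..n} - {c}. hybrid_weight i k (\<tau> k))"
    define g where "g = (\<lambda>t. \<Prod>j=1..c. desing_limit (t + v j))"
    define g0 where "g0 = (\<lambda>t. (\<Prod>j=1..i. desing_limit (t + v j)) * desing_quotient (t + v c))"
    have "hybrid i (\<tau>(c := y)) =
        d * (g0 (hankel e y) * hankel_weight e (s c) y)" for y
      unfolding chain_upd[OF c1(1)] d_def g0_def v_def
      by (simp add: c_def hybrid_kernel_def hybrid_path_def[of i "Suc i"] hybrid_weight_def[of i
          "Suc i"] mult_ac)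
    moreover have "hybrid c (\<tau>(c := y)) =
        d * (g (reg_path n y) * reg_weight n (s c) y)" for y
    proof -
      have 1: "hybrid_path c k = hybrid_path i k" "hybrid_weight c k = hybrid_weight i k" if "k \<noteq> c"
          for k
        using that by (auto simp: hybrid_path_def hybrid_weight_def c_def)
      have 2: "(\<Sum>k\<in>{j..n} - {c}. hybrid_path c k (\<tau> k)) = v j" for j
        unfolding v_def by (intro sum.cong) (auto simp: 1)
      have 3: "(\<Sum>k=j..n. hybrid_path c k (\<tau> k)) = (\<Sum>k=j..n. hybrid_path i k (\<tau> k))"
          if "j \<in> {Suc c..n}" for j
        using that by (intro sum.cong) (auto simp: 1)
      have 4: "(\<Prod>k\<in>{1..n} - {c}. hybrid_weight c k (\<tau> k)) = (\<Prod>k\<in>{1..n} - {c}. hybrid_weight i k (\<tau> k))"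
        by (intro prod.cong) (auto simp: 1)
      have 5: "(\<Prod>j=Suc c..n. hybrid_kernel c j (\<Sum>k=j..n. hybrid_path c k (\<tau> k))) =
          (\<Prod>j=Suc c..n. desing_quotient (\<Sum>k=j..n. hybrid_path i k (\<tau> k)))"
        by (intro prod.cong) (auto simp: 3 hybrid_kernel_def)
      have 6: "(\<Prod>j=1..c. hybrid_kernel c j (hybrid_path c c y + v j)) = g (reg_path n y)"
        unfolding g_def by (intro prod.cong) (auto simp: hybrid_kernel_def hybrid_path_def)
      have 7: "hybrid_weight c c = reg_weight n (s c)" by (simp add: hybrid_weight_def)
      show ?thesis
        unfolding chain_upd[OF c1(1)] 2 4 5 6 7 d_def by (simp only: mult_ac)
    qed
    moreover have "(\<integral>y. g0 (hankel e y) * hankel_weight e (s c) y \<partial>lborel) =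
        (\<integral>y. g (reg_path n y) * reg_weight n (s c) y \<partial>lborel)"
      unfolding hankel_weight_def
    proof (rule hankel_eq_reg)
      have strip: "in_strip n (hybrid_path i k (\<tau> k))" for k
        using path_weight_hybrid[of i k] by (auto simp: path_weight_def)
      have v_strip: "\<bar>Im (v j)\<bar> \<le> 1" if "j \<in> {1..c}" for j
        unfolding v_def
      proof (rule in_strip_sum(1)[where n = n])
        have "card ({j..n} - {c}) \<le> card {1..n}" using that by (intro card_mono) auto
        then show "card ({j..n} - {c}) \<le> n" by simp
      qed (rule strip)
      have tv_strip: "\<bar>Im (t + v j)\<bar> \<le> 1" "Re (t + v j) \<ge> -1" if "j \<in> {1..c}" "in_strip n t" for j t
      proof -
        have "t + v j = (\<Sum>k=j..n. if k = c then t else hybrid_path i k (\<tau> k))"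
          unfolding v_def using that c1 by (subst sum.remove[of "{j..n}" c]) (auto intro!: sum.cong)
        moreover have "card {j..n} \<le> n" using that by auto
        ultimately show "\<bar>Im (t + v j)\<bar> \<le> 1" "Re (t + v j) \<ge> -1"
          using in_strip_sum[of "{j..n}" n "\<lambda>k. if k = c then t else hybrid_path i k
              (\<tau> k)"] strip that by auto
      qed
      \<comment> \<open>The ball of radius 2/(n+1) lies in the unit disc because n \<ge> 1, so t + v
        j has imaginary part at most 2 < 2 pi.\<close>
      have R: "2 / (real n + 1) \<le> 1" using c1 by (simp add: field_simps)
      show "g holomorphic_on ball 0 (2 / (real n + 1))"
        unfolding g_def
      proof (intro holomorphic_on_prod)
        fix j assume j: "j \<in> {1..c}"
        have "(\<lambda>t. t + v j) ` ball 0 (2 / (real n + 1)) \<subseteq> kernel_strip"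
        proof safe
          fix t :: complex assume t: "t \<in> ball 0 (2 / (real n + 1))"
          have "\<bar>Im t\<bar> \<le> 1" using t R abs_Im_le_cmod[of t] unfolding mem_ball dist_0_norm by linarith
          then have "\<bar>Im (t + v j)\<bar> \<le> 2" using v_strip[OF j] by simp
          then show "\<bar>Im (t + v j)\<bar> < 2 * pi" using pi_gt3 by linarith
        qed
        then have "(desing_limit \<circ> (\<lambda>t. t + v j)) holomorphic_on ball 0 (2 / (real n + 1))"
          by (intro holomorphic_on_compose_gen[OF _ desing_limit_holomorphic] holomorphic_intros)
        then show "(\<lambda>t. desing_limit (t + v j)) holomorphic_on ball 0 (2 / (real n + 1))"
            by (simp add: o_def)
      qed
      show "g \<in> borel_measurable borel" "g0 \<in> borel_measurable borel"
        unfolding g_def g0_def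
        by (intro borel_measurable_times borel_measurable_prod measurable_compose[OF _ desing_limit_measurable] measurable_compose[OF _ desing_quotient_measurable]; measurable)+
      show "norm (g t) \<le> (C ^ c * exp (- Re (v 1) / 4)) * exp (- Re t / 4)" if t: "in_strip n t" for t
      proof -
        have "norm (g t) = (\<Prod>j=1..c. norm (desing_limit (t + v j)))" by (simp add: g_def prod_norm)
        also have "\<dots> \<le> (\<Prod>j=1..c. C * (if j = 1 then exp (- Re (t + v 1) / 4) else 1))"
        proof (intro prod_mono conjI norm_ge_zero)
          fix j assume j: "j \<in> {1..c}"
          have "norm (desing_limit (t + v j)) \<le> C \<and> norm (desing_limit (t + v j))
              \<le> C * exp (- Re (t + v j) / 4)"
            using C(2) tv_strip[OF j t] unfolding kernel_bound_def by blast
          then show "norm (desing_limit (t + v j)) \<le> C * (if j =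
              1 then exp (- Re (t + v 1) / 4) else 1)"
            by (cases "j = 1") (simp_all only: if_True if_False mult_1_right simp_thms)
        qed
        also have "\<dots> = C ^ c * exp (- Re (t + v 1) / 4)"
          by (simp add: prod.distrib prod.delta c_def)
        also have "exp (- Re (t + v 1) / 4) = exp (- Re (v 1) / 4) * exp (- Re t / 4)"
          by (simp flip: exp_add)
        finally show ?thesis by (simp add: mult.assoc)
      qed
      show "C ^ c * exp (- Re (v 1) / 4) \<ge> 0" using C(1) by simp
      show "s c \<notin> \<int>" using s c1 by blast
      show "0 < e" "e < 1 / (2 * (real n + 1))" using e by auto
      show "g0 t = g t" if "t \<noteq> - v c" for t
      proof -
        have "t + v c \<noteq> 0" using that by (simp add: eq_neg_iff_add_eq_0)
        then have "desing_quotient (t + v c) = desing_limit (t + v c)" by (simp add: desing_limit_def)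
        then show ?thesis by (simp add: g_def g0_def c_def)
      qed
    qed
    ultimately show ?thesis by simp
  qed
  then show ?thesis
    unfolding insert[OF integrable_hybrid[OF c1(2)]] c_def by simp
qed

lemma hankel_chain_eq_reg_chain:
  "integral\<^sup>L (lborel_n n) (chain n (\<lambda>_. desing_quotient) (\<lambda>_. hankel e) (\<lambda>k. hankel_weight e (s k))) =
   integral\<^sup>L (lborel_n n) (chain n (\<lambda>_. desing_limit) (\<lambda>_. reg_path n) (\<lambda>k. reg_weight n (s k)))"
proof -
  have "integral\<^sup>L (lborel_n n) (hybrid 0) =
    integral\<^sup>L (lborel_n n) (hybrid i)" if "i \<le> n" for i
    using that
  proof (induction i)
    case (Suc i)
    then show ?case using hybrid_step[of i] by simp
  qed simp
  moreover have "hybrid 0 =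
      chain n (\<lambda>_. desing_quotient) (\<lambda>_. hankel e) (\<lambda>k. hankel_weight e (s k))"
    by (rule chain_cong) (auto simp: hybrid_kernel_def hybrid_path_def hybrid_weight_def)
  moreover have "hybrid n =
      chain n (\<lambda>_. desing_limit) (\<lambda>_. reg_path n) (\<lambda>k. reg_weight n (s k))"
    by (rule chain_cong) (auto simp: hybrid_kernel_def hybrid_path_def hybrid_weight_def)
  ultimately show ?thesis by (metis order_refl)
qed

text \<open>Distributing the prefactors over the kernel factors and the coordinates turns the
  approximation into a \<open>chain\<close> with kernel \<open>desing_factor c\<close>. The bound
  from \<open>kernel_bounds\<close>, uniform for c near 1, justifies the limit under the
  integral.\<close>

lemma desing_approx_tendsto:
  assumes n: "n \<ge> 1"
  shows "(desing_approx n s e \<longlongrightarrow>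
    integral\<^sup>L (lborel_n n) (chain n (\<lambda>_. desing_limit) (\<lambda>_. reg_path n) (\<lambda>k. reg_weight n (s k))))
        (at 1)"
proof -
  obtain C where C: "C > 0" "kernel_bound C desing_quotient" "\<And>c. \<bar>c - 1\<bar> < 1 / 2 \<Longrightarrow>
      kernel_bound C (desing_factor c)"
    using kernel_bounds by blast
  have "\<exists>K. path_weight n K (hankel e) (hankel_weight e (s k))" if "k \<in> {1..n}" for k
    using path_weight_hybrid[of 0 k] that by (simp add: hybrid_path_def hybrid_weight_def)
  then obtain K where K: "\<And>k. k \<in> {1..n} \<Longrightarrow> path_weight n K (hankel e) (hankel_weight e (s k))"
    using path_weight_common[of "{1..n}" n "\<lambda>_. hankel e" "\<lambda>k. hankel_weight e (s k)"] by blast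
  have approx: "desing_approx n s e c = integral\<^sup>L (lborel_n n) (chain n (\<lambda>_. desing_factor c)
      (\<lambda>_. hankel e) (\<lambda>k. hankel_weight e (s k)))" for c
  proof -
    define A where "A = 1 / (1 - complex_of_real c) ^ n"
    define B where "B = (\<Prod>k=1..n. 1 / ((exp (2 * of_real pi * \<i> * s k) - 1) * Gamma (s k)))"
    have "chain n (\<lambda>_. desing_factor c) (\<lambda>_. hankel e) (\<lambda>k. hankel_weight e (s k)) \<tau> = A * B *
        (desing_kernel n c (\<lambda>k. hankel e (\<tau> k)) * (\<Prod>k=1..n. hankel_power e (s k - 1) (\<tau> k) *
            vector_derivative (hankel e) (at (\<tau> k))))" for \<tau>
      unfolding chain_def hankel_weight_def desing_factor_def desing_kernel_def A_def B_def prod.distrib prod_dividef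
      by (simp add: mult_ac)
    then have "chain n (\<lambda>_. desing_factor c) (\<lambda>_. hankel e) (\<lambda>k. hankel_weight e (s k)) = (\<lambda>\<tau>. A * B *
        (desing_kernel n c (\<lambda>k. hankel e (\<tau> k)) * (\<Prod>k=1..n. hankel_power e (s k - 1) (\<tau> k) *
            vector_derivative (hankel e) (at (\<tau> k)))))"
      by (rule ext)
    then show ?thesis
      unfolding desing_approx_def contour_power_integral_def A_def[symmetric] B_def[symmetric]
      by (simp only: integral_mult_right_zero)
  qed
  show ?thesis
    unfolding hankel_chain_eq_reg_chain[symmetric] tendsto_at_iff_sequentially comp_def
  proof (intro allI impI)
    fix X :: "nat \<Rightarrow> real" assume X: "\<forall>i. X i \<in> UNIV - {1}" "X \<longlonglongrightarrow> 1"
    have "\<forall>\<^sub>F m in sequentially. \<bar>X m - 1\<bar> < 1 / 2"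
      using tendstoD[OF X(2), of "1 / 2"] by (simp add: dist_real_def)
    then obtain N where N: "\<And>m. m \<ge> N \<Longrightarrow> \<bar>X m - 1\<bar> < 1 / 2"
      by (auto simp: eventually_sequentially)
    have lim: "filterlim (\<lambda>m. X (m + N)) (at 1) sequentially"
      using X LIMSEQ_ignore_initial_segment[OF X(2), of N] by (auto simp: filterlim_at)
    have "(\<lambda>m. integral\<^sup>L (lborel_n n) (chain n (\<lambda>_. desing_factor (X (m +
        N))) (\<lambda>_. hankel e) (\<lambda>k. hankel_weight e (s k)))) \<longlonglongrightarrow>
        integral\<^sup>L (lborel_n n) (chain n (\<lambda>_. desing_quotient) (\<lambda>_. hankel e) (\<lambda>k. hankel_weight e
            (s k)))"
    proof (rule chain_dominated_convergence[OF n, where C = C and K = K])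
      show "(\<lambda>m. desing_factor (X (m + N)) T) \<longlonglongrightarrow> desing_quotient T" if "\<bar>Im T\<bar> \<le> 1" for T
      proof (rule filterlim_compose[OF desing_factor_tendsto lim])
        show "\<bar>Im T\<bar> < 2 * pi" using that pi_gt3 by linarith
      qed
    qed (use C K N in \<open>auto simp: desing_factor_measurable desing_quotient_measurable\<close>)
    then show "(\<lambda>m. desing_approx n s e (X m)) \<longlonglongrightarrow>
        integral\<^sup>L (lborel_n n) (chain n (\<lambda>_. desing_quotient) (\<lambda>_. hankel e) (\<lambda>k. hankel_weight e
            (s k)))"
      unfolding approx by (rule LIMSEQ_offset)
  qed
qed

end

section \<open>The regularized integral as the unique entire extension\<close>

definition zeta_reg :: "nat \<Rightarrow> (nat \<Rightarrow> complex) \<Rightarrow> complex" where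
  "zeta_reg n s = integral\<^sup>L (lborel_n n) (chain n (\<lambda>_. desing_limit) (\<lambda>_. reg_path n)
      (\<lambda>k. reg_weight n (s k)))"

lemma zeta_reg_cong: "(\<And>k. k \<in> {1..n} \<Longrightarrow> s k = s' k) \<Longrightarrow> zeta_reg n s = zeta_reg n s'"
  unfolding zeta_reg_def chain_def
      by (intro Bochner_Integration.integral_cong refl arg_cong2[where f = "(*)"] prod.cong) auto

text \<open>A convergent sequence of points is bounded, so one constant from
  \<open>path_weight_reg\<close> dominates all the weights.\<close>

lemma zeta_reg_tendsto:
  assumes n: "n \<ge> 1" and lim: "\<And>k. k \<in> {1..n} \<Longrightarrow> (\<lambda>m. S m k) \<longlonglongrightarrow> s k"
  shows "(\<lambda>m. zeta_reg n (S m)) \<longlonglongrightarrow> zeta_reg n s"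
proof -
  obtain C where C: "C > 0" "kernel_bound C desing_limit" using kernel_bounds by blast
  have "\<exists>B. \<forall>m. norm (S m k) \<le> B" if "k \<in> {1..n}" for k
    using convergent_imp_Bseq[of "\<lambda>m. S m k"] lim[OF that] by (auto simp: convergent_def Bseq_def)
  then obtain B where B: "\<And>k m. k \<in> {1..n} \<Longrightarrow> norm (S m k) \<le> B k" by metis
  define M where "M = (\<Sum>k=1..n. \<bar>B k\<bar>)"
  have M: "norm (S m k) \<le> M" if "k \<in> {1..n}" for m k
  proof -
    have "norm (S m k) \<le> \<bar>B k\<bar>" using B[OF that, of m] by simp
    also have "\<dots> \<le> M" unfolding M_def using that by (intro member_le_sum) auto
    finally show ?thesis .
  qed
  have M': "norm (s k) \<le> M" if "k \<in> {1..n}" for k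
    by (rule LIMSEQ_le_const2[OF tendsto_norm[OF lim[OF that]]]) (use M[OF that] in auto)
  obtain K where K: "\<And>s. norm s \<le> M \<Longrightarrow> path_weight n K (reg_path n) (reg_weight n s)"
    using path_weight_reg by blast
  show ?thesis
    unfolding zeta_reg_def
  proof (rule chain_dominated_convergence[OF n, where C = C and K = K])
    show "(\<lambda>m. reg_weight n (S m k) x) \<longlonglongrightarrow> reg_weight n (s k) x" if "k \<in> {1..n}" for k x
    proof -
      have "isCont (\<lambda>s. reg_weight n s x) (s k)"
        using holomorphic_on_imp_continuous_on[OF reg_weight_holomorphic[of n x]]
            by (simp add: continuous_on_eq_continuous_at)
      then show ?thesis using lim[OF that] by (rule isCont_tendsto_compose)
    qed
  qed (use C K M M' in \<open>auto simp: desing_limit_measurable\<close>)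
qed

lemma zeta_reg_holomorphic:
  assumes n: "n \<ge> 1"
  shows "(\<lambda>z. zeta_reg n (s(i := z))) holomorphic_on UNIV"
  unfolding zeta_reg_def
proof (rule holomorphic_integral)
  obtain C where C: "C > 0" "kernel_bound C desing_limit" using kernel_bounds by blast
  have ex: "\<exists>K. path_weight n K (reg_path n) (reg_weight n (s k))" for s :: "nat \<Rightarrow> complex" and k
    using path_weight_reg[of "norm (s k)" n] by (metis order_refl)
  show "chain n (\<lambda>_. desing_limit) (\<lambda>_. reg_path n) (\<lambda>k. reg_weight n
      ((s(i := z)) k)) \<in> borel_measurable (lborel_n n)" for z
  proof -
    obtain K where "\<And>k. k \<in> {1..n} \<Longrightarrow> path_weight n K (reg_path n) (reg_weight n ((s(i := z)) k))"
      using path_weight_common[of "{1..n}" n "\<lambda>_. reg_path n" "\<lambda>k. reg_weight n ((s(i := z)) k)"] ex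
          by blast
    then show ?thesis by (intro chain_measurable[where K = K] desing_limit_measurable)
  qed
  show "(\<lambda>z. chain n (\<lambda>_. desing_limit) (\<lambda>_. reg_path n) (\<lambda>k. reg_weight n
      ((s(i := z)) k)) \<tau>) holomorphic_on UNIV" for \<tau>
    unfolding chain_def
  proof (intro holomorphic_on_mult holomorphic_on_const holomorphic_on_prod)
    fix k
    show "(\<lambda>z. reg_weight n ((s(i := z)) k) (\<tau> k)) holomorphic_on UNIV"
      by (cases "k = i") (simp_all add: reg_weight_holomorphic)
  qed
  show "\<exists>B. integrable (lborel_n n) B \<and> (\<forall>z\<in>cball z0 1. \<forall>\<tau>\<in>space (lborel_n n).
      norm (chain n (\<lambda>_. desing_limit) (\<lambda>_. reg_path n) (\<lambda>k. reg_weight n ((s(i := z)) k)) \<tau>)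
          \<le> B \<tau>)" for z0
  proof -
    define M where "M = (\<Sum>k=1..n. norm (s k)) + norm z0 + 1"
    obtain K where K: "\<And>s. norm s \<le> M \<Longrightarrow> path_weight n K (reg_path n) (reg_weight n s)"
      using path_weight_reg by blast
    have M: "norm ((s(i := z)) k) \<le> M" if "z \<in> cball z0 1" "k \<in> {1..n}" for z k
    proof (cases "k = i")
      case True
      have "norm z \<le> norm z0 + 1" using that(1) norm_triangle_ineq4[of z0 "z0 - z"]
          by (simp add: dist_norm)
      also have "\<dots> \<le> M" by (simp add: M_def sum_nonneg)
      finally show ?thesis using True by simp
    next
      case False
      have "norm (s k) \<le> (\<Sum>k=1..n. norm (s k))" using that(2) by (intro member_le_sum) auto
      also have "\<dots> \<le> M" by (simp add: M_def)
      finally show ?thesis using False by simp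
    qed
    show ?thesis
      using integrable_prod_exp[where B = "C ^ n" and n = n and K = K]
      by (intro exI[of _ "\<lambda>\<tau>. C ^ n * (\<Prod>k=1..n. K * exp (- \<bar>\<tau> k\<bar> / 8))"] conjI ballI
          norm_chain_le[OF n]) (use C K M in auto)
  qed
qed

text \<open>The limit formula is available only where no coordinate is an integer. Such points are
  dense: a small common imaginary shift makes all imaginary parts nonzero.\<close>

lemma non_integer_perturbation:
  obtains S where "\<And>m k. k \<in> {1..n} \<Longrightarrow> S m k \<notin> \<int>" "\<And>k. (\<lambda>m. S m k) \<longlonglongrightarrow> (s k :: complex)"
    "\<And>m. s \<in> Cn n \<Longrightarrow> S m \<in> Cn n" "S \<longlonglongrightarrow> s"
proof -
  have "eventually (\<lambda>d. \<forall>k\<in>{1..n}. Im (s k) + d \<noteq> 0) (at_right (0::real))"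
  proof (rule eventually_ball_finite, simp, rule ballI)
    fix k
    show "\<forall>\<^sub>F d in at_right 0. Im (s k) + d \<noteq> 0"
    proof (cases "Im (s k) \<ge> 0")
      case True
      then show ?thesis using eventually_at_right_less[of "0::real"] by (auto elim: eventually_mono)
    next
      case False
      then have "\<forall>\<^sub>F d in at_right 0. d \<in> {0<..<- Im (s k)}" by (intro eventually_at_right_real) auto
      then show ?thesis by (auto elim: eventually_mono)
    qed
  qed
  then obtain b where b: "b > 0" "\<And>d k. 0 < d \<Longrightarrow> d < b \<Longrightarrow> k \<in> {1..n} \<Longrightarrow> Im (s k) + d \<noteq> 0"
    unfolding eventually_at_right_field by blast
  define d where "d = (\<lambda>m. b / real (m + 2))"
  have d: "0 < d m" "d m < b" for m using b(1) by (auto simp: d_def field_simps add_pos_nonneg)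
  have dlim: "d \<longlonglongrightarrow> 0"
    unfolding d_def by (rule LIMSEQ_ignore_initial_segment[OF lim_const_over_n])
  \<comment> \<open>Coordinates outside {1..n} stay fixed, so that \<open>S m\<close> remains in
    \<open>Cn n\<close>.\<close>
  define S where "S = (\<lambda>m k. if k \<in> {1..n} then s k + \<i> * of_real (d m) else s k)"
  show ?thesis
  proof (rule that[of S])
    fix m k assume k: "k \<in> {1..n}"
    have "Im (S m k) \<noteq> 0" using b(2)[OF d k] k by (simp add: S_def)
    then show "S m k \<notin> \<int>" by (auto elim: Ints_cases)
  next
    fix k
    have "(\<lambda>m. s k + \<i> * of_real (d m)) \<longlonglongrightarrow> s k + \<i> * of_real 0"
      by (intro tendsto_intros dlim)
    then show "(\<lambda>m. S m k) \<longlonglongrightarrow> s k" by (cases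
        "k \<in> {1..n}") (simp_all only: S_def if_True if_False tendsto_const of_real_0 mult_zero_right add_0_right)
  next
    fix m assume "s \<in> Cn n"
    then show "S m \<in> Cn n" by (auto simp: Cn_def S_def PiE_def extensional_def)
  next
    define p where "p = (\<lambda>(d::real) k. if k \<in> {1..n} then s k + \<i> * of_real d else s k)"
    have "continuous_on UNIV p"
    proof (rule continuous_on_coordinatewise_then_product)
      show "continuous_on UNIV (\<lambda>d. p d k)" for k
        by (cases "k \<in> {1..n}") (auto simp: p_def intro!: continuous_intros)
    qed
    from continuous_on_tendsto_compose[OF this dlim] have "(\<lambda>m. p (d m)) \<longlonglongrightarrow> p 0" by simp
    moreover have "p 0 = s" by (auto simp: p_def)
    ultimately show "S \<longlonglongrightarrow> s" by (simp add: S_def p_def)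
  qed
qed

text \<open>Any competitor has the same limit formula, so it agrees with \<open>zeta_reg\<close> at
  the points without integral coordinates, and continuity carries the equality to all of
  \<open>Cn n\<close>.\<close>

lemma zeta_desing_eq:
  assumes n: "n \<ge> 1"
  shows "zeta_desing n = restrict (zeta_reg n) (Cn n)" (is "_ = ?F")
  unfolding zeta_desing_def
proof (rule the_equality)
  have "entire_Cn n (?F)"
    unfolding entire_Cn_def
  proof (intro conjI ballI)
    have "continuous_on (Cn n) (zeta_reg n)"
      unfolding continuous_on_sequentially comp_def
    proof (intro allI ballI impI)
      fix S and s :: "nat \<Rightarrow> complex" assume *: "s \<in> Cn n" "(\<forall>m. S m \<in> Cn n) \<and> S \<longlonglongrightarrow> s"
      have "(\<lambda>m. S m k) \<longlonglongrightarrow> s k" for k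
        using continuous_on_tendsto_compose[OF continuous_on_product_coordinates[of k] conjunct2[OF *(2)]] by simp
      then show "(\<lambda>m. zeta_reg n (S m)) \<longlonglongrightarrow> zeta_reg n s" by (intro zeta_reg_tendsto[OF n])
    qed
    then show "continuous_on (Cn n) (?F)"
      by (rule continuous_on_cong[THEN iffD1, rotated -1]) auto
    fix s i assume "s \<in> Cn n" "i \<in> {1..n}"
    then have "s(i := z) \<in> Cn n" for z by (auto simp: Cn_def PiE_def extensional_def)
    then show "(\<lambda>z. ?F (s(i := z))) holomorphic_on UNIV"
      using zeta_reg_holomorphic[OF n, of s i] by simp
  qed
  moreover have "\<forall>\<^sub>F e in at_right 0. (desing_approx n s e \<longlongrightarrow> ?F s) (at 1)"
    if s: "s \<in> Cn n" "\<forall>i\<in>{1..n}. s i \<notin> \<int>" for s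
  proof -
    have "\<forall>\<^sub>F e in at_right 0. e \<in> {0<..<1 / (2 * (real n + 1))}"
      by (rule eventually_at_right_real) auto
    then show ?thesis
    proof eventually_elim
      case (elim e)
      then show ?case
        using desing_approx_tendsto[of n s e] s n by (simp add: zeta_reg_def)
    qed
  qed
  ultimately show "?F \<in> extensional (Cn n) \<and> entire_Cn n (?F) \<and>
     (\<forall>s\<in>Cn n. (\<forall>i\<in>{1..n}. s i \<notin> \<int>) \<longrightarrow>
        (\<forall>\<^sub>F \<epsilon> in at_right 0. (desing_approx n s \<epsilon> \<longlongrightarrow> ?F s) (at 1)))"
    by auto
next
  fix F assume F: "F \<in> extensional (Cn n) \<and> entire_Cn n F \<and>
     (\<forall>s\<in>Cn n. (\<forall>i\<in>{1..n}. s i \<notin> \<int>) \<longrightarrow>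
        (\<forall>\<^sub>F \<epsilon> in at_right 0. (desing_approx n s \<epsilon> \<longlongrightarrow> F s) (at 1)))"
  have nonint: "F s = zeta_reg n s" if s: "s \<in> Cn n" "\<forall>i\<in>{1..n}. s i \<notin> \<int>" for s
  proof -
    have "\<forall>\<^sub>F e in at_right 0. e \<in> {0<..<1 / (2 * (real n + 1))}"
      by (rule eventually_at_right_real) auto
    moreover have "\<forall>\<^sub>F e in at_right 0. (desing_approx n s e \<longlongrightarrow> F s) (at 1)" using F s by blast
    \<comment> \<open>One radius has to serve both limit statements, so that uniqueness of limits
      applies to the same approximation.\<close>
    ultimately have "\<forall>\<^sub>F e in at_right 0. e \<in> {0<..<1 / (2 * (real n +
        1))} \<and> (desing_approx n s e \<longlongrightarrow> F s) (at 1)"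
      by (rule eventually_conj)
    then obtain e where e: "e \<in> {0<..<1 / (2 * (real n + 1))}" "(desing_approx n s e \<longlongrightarrow> F s) (at 1)"
      using eventually_happens'[OF trivial_limit_at_right_real] by blast
    then have "(desing_approx n s e \<longlongrightarrow> zeta_reg n s) (at 1)"
      using desing_approx_tendsto[of n s e] s n by (simp add: zeta_reg_def)
    then show ?thesis using e(2) tendsto_unique[of "at (1::real)"] by auto
  qed
  have "F s = zeta_reg n s" if s: "s \<in> Cn n" for s
  proof -
    obtain S where S: "\<And>m k. k \<in> {1..n} \<Longrightarrow> S m k \<notin> \<int>" "\<And>k. (\<lambda>m. S m k) \<longlonglongrightarrow> s k" "\<And>m. S m \<in> Cn n" "S \<longlonglongrightarrow> s"
      using non_integer_perturbation[of n s] s by metis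
    note S(4)
    moreover have "continuous_on (Cn n) F" using F by (simp add: entire_Cn_def)
    ultimately have "(\<lambda>m. F (S m)) \<longlonglongrightarrow> F s"
      using s S(3) unfolding continuous_on_sequentially comp_def by blast
    moreover have "(\<lambda>m. F (S m)) \<longlonglongrightarrow> zeta_reg n s"
      using zeta_reg_tendsto[OF n, of S s] S nonint by simp
    ultimately show ?thesis using LIMSEQ_unique by blast
  qed
  then show "F = ?F"
    using F by (auto simp: fun_eq_iff extensional_def)
qed

lemma zeta_FKMT_eq:
  assumes n: "n \<ge> 1"
  shows "zeta_FKMT n k = zeta_reg n (\<lambda>i. - of_nat (k i))"
proof -
  have "(\<lambda>i\<in>{1..n}. - of_nat (k i)) \<in> Cn n" by (simp add: Cn_def)
  then show ?thesis
    by (simp add: zeta_FKMT_def zeta_desing_eq[OF n] cong: zeta_reg_cong) (rule zeta_reg_cong, simp)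
qed

section \<open>Values at the non-positive integers\<close>

text \<open>For m < k the reciprocal Gamma function has a zero at m + 1 - k, and for m > k the
  Pochhammer symbol of -k contains the factor 0.\<close>

lemma reg_coeff_neg_nat: "reg_coeff (- of_nat k) m = (if m = k then (-1) ^ k * fact k else 0)"
proof -
  consider "m < k" | "m = k" | "m > k" by linarith
  then show ?thesis
  proof cases
    case 1
    then have "- of_nat k + of_nat (Suc m) = - complex_of_nat (k - Suc m)"
      by (simp add: of_nat_diff)
    then have "rGamma (- of_nat k + of_nat (Suc m)) = (0 :: complex)"
      by (simp only: rGamma_eq_zero_iff minus_of_nat_in_nonpos_Ints)
    then show ?thesis using 1 by (simp add: reg_coeff_def del: of_nat_Suc)
  next
    case 2
    have "- of_nat k + of_nat (Suc k) = (1 :: complex)" by simp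
    then show ?thesis using 2 by (simp add: reg_coeff_def pochhammer_same del: of_nat_Suc)
  next
    case 3
    then show ?thesis by (simp add: reg_coeff_def pochhammer_of_nat_eq_0_lemma)
  qed
qed

text \<open>The ray disappears because \<open>rGamma\<close> vanishes at -k, and the series on the
  circle collapses to its k-th term.\<close>

lemma reg_weight_neg_nat:
  "reg_weight n (- of_nat k) x = (if x \<in> {0..1} then
     ((-1) ^ k * fact k * of_real (real n + 1) ^ k) * exp (- (2 * of_real pi * \<i> * of_nat k *
         of_real x)) else 0)"
proof -
  define r where "r = 1 / (2 * (real n + 1))"
  have r: "r > 0" by (simp add: r_def)
  have "circ_term n (- of_nat k) m x = 0" if "m \<noteq> k" for m
    using that by (simp add: circ_term_def reg_coeff_neg_nat)
  then have "circ_weight n (- of_nat k) x = circ_term n (- of_nat k) k x"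
    by (subst suminf_finite[of "{k}"]) auto
  also have "\<dots> = (1 / 2) ^ k * exp (- (2 * of_real pi * \<i> * of_nat k * of_real x)) *
      (exp (- of_nat k * of_real (ln r)) * ((-1) ^ k * fact k))"
    unfolding circ_term_def reg_coeff_neg_nat r_def by simp
  \<comment> \<open>Here l^(-k) = (2(n+1))^k; its power of 2 cancels the factor (1/2)^k of
    \<open>circ_term\<close>.\<close>
  also have "exp (- of_nat k * complex_of_real (ln r)) = 2 ^ k * of_real (real n + 1) ^ k"
  proof -
    have "exp (- of_nat k * complex_of_real (ln r)) = inverse (of_real r) ^ k"
      using r by (simp add: exp_minus exp_of_nat_mult exp_of_real power_inverse)
    also have "inverse (complex_of_real r) = 2 * of_real (real n + 1)"
      by (simp add: r_def)
    finally show ?thesis by (simp only: power_mult_distrib)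
  qed
  finally have "circ_weight n (- of_nat k) x =
      ((-1) ^ k * fact k * of_real (real n + 1) ^ k) * exp (- (2 * of_real pi * \<i> * of_nat k *
          of_real x))"
    by (simp add: power_divide del: of_real_add)
  moreover have "rGamma (- complex_of_nat k) = 0"
    by (simp only: rGamma_eq_zero_iff minus_of_nat_in_nonpos_Ints)
  ultimately show ?thesis by (simp add: reg_weight_def)
qed

lemma reg_functional_neg_nat:
  assumes g: "g holomorphic_on ball 0 (2 / (real n + 1))"
  shows "(\<integral>x. g (reg_path n x) * reg_weight n (- of_nat k) x \<partial>lborel) = (-1) ^ k * (deriv ^^ k) g 0"
proof -
  define r where "r = 1 / (real n + 1)"
  have r: "r > 0" "2 / (real n + 1) = 2 * r" "real n + 1 = inverse r" by (simp_all add: r_def)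
  define h where "h = (\<lambda>x. g (of_real r * exp (2 * of_real pi * \<i> * of_real x)) * exp (- (2 *
      of_real pi * \<i> * of_nat k * of_real x)))"
  define c where "c = (-1) ^ k * fact k * complex_of_real (real n + 1) ^ k"
  have "continuous_on {0..1} (\<lambda>x. g (of_real r * exp (2 * of_real pi * \<i> * of_real x)))"
  proof (rule continuous_on_compose2[OF holomorphic_on_imp_continuous_on[OF g]])
    show "(\<lambda>x::real. of_real r * exp (2 * of_real pi * \<i> * of_real x)) ` {0..1} \<subseteq> ball 0 (2 /
        (real n + 1))"
      unfolding r(2) using r(1) by (auto simp: norm_mult)
  qed (intro continuous_intros)
  then have "continuous_on {0..1} h"
    unfolding h_def by (intro continuous_intros)
  then have "set_integrable lborel {0..1} h"
    by (rule borel_integrable_atLeastAtMost')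
  then have "(\<integral>x. indicator {0..1} x *\<^sub>R h x \<partial>lborel) = integral {0..1} h"
    using set_borel_integral_eq_integral(2)[of "{0..1}" h] by (simp add: set_lebesgue_integral_def)
  also have "\<dots> = (deriv ^^ k) g 0 / fact k * of_real r ^ k"
    unfolding h_def by (rule integral_unique, rule circle_fourier_coeff) (use g r in \<open>simp_all only:\<close>)
  finally have h: "(\<integral>x. indicator {0..1} x *\<^sub>R h x \<partial>lborel) = (deriv ^^ k) g 0 / fact k *
      of_real r ^ k" .
  have "g (reg_path n x) * reg_weight n (- of_nat k) x = c * (indicator {0..1} x *\<^sub>R h x)" for x
    by (simp add: reg_weight_neg_nat reg_path_def h_def c_def r_def)
  then have "(\<integral>x. g (reg_path n x) * reg_weight n (- of_nat k) x \<partial>lborel) =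
      c * (\<integral>x. indicator {0..1} x *\<^sub>R h x \<partial>lborel)"
    by (simp only: integral_mult_right_zero)
  also have "\<dots> = (-1) ^ k * (deriv ^^ k) g 0"
    unfolding h c_def r(3) using r(1) by (simp add: field_simps)
  finally show ?thesis .
qed

text \<open>The analytic counterpart of \<open>iterated_taylor\<close>. Functions replace series
  because the coordinates not yet integrated move the argument away from 0.\<close>

fun desing_taylor :: "(nat \<Rightarrow> nat) \<Rightarrow> nat \<Rightarrow> complex \<Rightarrow> complex" where
  "desing_taylor m 0 = (\<lambda>_. 1)"
| "desing_taylor m (Suc i) = (\<lambda>z. (deriv ^^ m (Suc i)) (\<lambda>u. desing_limit u *
    desing_taylor m i u) z / fact (m (Suc i)))"

lemma open_desing_domain: "open kernel_strip"
  by (intro open_Collect_less continuous_intros)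

lemma desing_taylor_holomorphic: "desing_taylor m i holomorphic_on kernel_strip"
  by (induction i) (auto intro!: holomorphic_intros holomorphic_higher_deriv desing_limit_holomorphic open_desing_domain)

lemma has_fps_expansion_higher_deriv:
  "f has_fps_expansion F \<Longrightarrow> (deriv ^^ k) f has_fps_expansion (fps_deriv ^^ k) (F :: complex fps)"
  by (induction k) (auto intro: has_fps_expansion_deriv)

lemma desing_taylor_has_fps_expansion:
    "desing_taylor m i has_fps_expansion iterated_taylor desing_fps m i"
proof (induction i)
  case (Suc i)
  have "fps_taylor k f = (fps_deriv ^^ k) f * fps_const (1 / fact k)" for k and f :: "complex fps"
    by (rule fps_ext) (simp add: fps_taylor_def fps_nth_higher_deriv)
  then have eq: "iterated_taylor desing_fps m (Suc i) =
      (fps_deriv ^^ m (Suc i)) (desing_fps * iterated_taylor desing_fps m i) *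
          fps_const (1 / fact (m (Suc i)))"
    by simp
  have "(\<lambda>u. desing_limit u * desing_taylor m i u) has_fps_expansion desing_fps *
      iterated_taylor desing_fps m i"
    by (intro has_fps_expansion_mult desing_limit_has_fps_expansion Suc)
  then have "(\<lambda>z. (deriv ^^ m (Suc i)) (\<lambda>u. desing_limit u * desing_taylor m i u) z *
      (1 / fact (m (Suc i)))) has_fps_expansion
      iterated_taylor desing_fps m (Suc i)"
    unfolding eq by (rule has_fps_expansion_mult[OF has_fps_expansion_higher_deriv has_fps_expansion_const])
  then show ?case by simp
qed simp

text \<open>What is left of the integrand, up to signs and factorials, after the coordinates 1, ...,
  i have been integrated out.\<close>

definition partial_chain :: "nat \<Rightarrow> (nat \<Rightarrow> nat) \<Rightarrow> nat \<Rightarrow> (nat \<Rightarrow> real) \<Rightarrow> complex" where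
  "partial_chain n m i \<tau> = desing_taylor m i (\<Sum>k=Suc i..n. reg_path n (\<tau> k)) *
     (\<Prod>j=Suc i..n. desing_limit (\<Sum>k=j..n. reg_path n (\<tau> k))) * (\<Prod>k=Suc i..n. reg_weight n (- of_nat
         (m k)) (\<tau> k))"

lemma reg_path_props:
  shows "in_strip n (reg_path n x)" "reg_path n \<in> borel_measurable borel"
      "reg_weight n s \<in> borel_measurable borel"
    "x \<in> {0..1} \<Longrightarrow> norm (reg_path n x) \<le> 1 / (real n + 1)"
proof -
  obtain K where "path_weight n K (reg_path n) (reg_weight n s)"
    using path_weight_reg[of "norm s" n] by (metis order_refl)
  then show "in_strip n (reg_path n x)" "reg_path n \<in> borel_measurable borel"
      "reg_weight n s \<in> borel_measurable borel"
    by (auto simp: path_weight_def)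
  show "norm (reg_path n x) \<le> 1 / (real n + 1)" if "x \<in> {0..1}"
  proof -
    have "reg_path n x = of_real (1 / (real n + 1)) * exp (2 * of_real pi * \<i> * of_real x)"
      using that by (simp add: reg_path_def)
    then have "norm (reg_path n x) = \<bar>1 / (real n + 1)\<bar> * norm (exp (2 * of_real pi * \<i> * of_real x))"
      by (simp only: norm_mult norm_of_real)
    then show ?thesis by simp
  qed
qed

lemma integrable_reg_weight_neg_nat: "integrable lborel (reg_weight n (- of_nat k))"
proof (rule Bochner_Integration.integrable_bound)
  show "integrable lborel (\<lambda>x::real. indicator {0..1} x *\<^sub>R (fact k * (real n + 1) ^ k))"
    by (intro integrable_indicator) auto
  have "norm (reg_weight n (- of_nat k) x) \<le> norm (indicat_real {0..1} x *\<^sub>R (fact k * (real n +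
      1) ^ k))" for x
  proof (cases "x \<in> {0..1}")
    case True
    have "norm (complex_of_real (real n + 1)) = real n + 1" by (simp only: norm_of_real)
    then show ?thesis using True
      by (simp add: reg_weight_neg_nat norm_mult norm_power del: of_real_add)
  next
    case False
    then show ?thesis by (simp only: reg_weight_neg_nat if_False norm_zero norm_ge_zero)
  qed
  then show "AE x in lborel. norm (reg_weight n (- of_nat k) x) \<le> norm (indicat_real {0..1} x *\<^sub>R
      (fact k * (real n + 1) ^ k))"
    by (rule AE_I2)
qed (use reg_path_props(3) in auto)

text \<open>The weights vanish unless all parameters lie in [0,1]; there the tail sums stay in the
  closed unit disc, where compactness bounds the holomorphic factors.\<close>

lemma integrable_partial_chain:
  "integrable (\<Pi>\<^sub>M k\<in>{Suc i..n}. lborel) (partial_chain n m i)"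
proof -
  interpret product_sigma_finite "\<lambda>_::nat. lborel :: real measure"
    by (rule product_sigma_finite_lborel)
  let ?M = "\<Pi>\<^sub>M k\<in>{Suc i..n}. lborel :: real measure"
  define D where "D = kernel_strip"
  define T where "T = (\<lambda>j \<tau>. \<Sum>k=j..n. reg_path n (\<tau> k))"
  have D: "T j \<tau> \<in> D" if "j \<ge> 1" for j \<tau>
  proof -
    have "\<bar>Im (T j \<tau>)\<bar> \<le> 1"
      unfolding T_def using that by (intro in_strip_sum(1)[where n = n] reg_path_props) auto
    then show ?thesis using pi_gt3 by (auto simp: D_def)
  qed
  have Dset: "D \<in> sets borel" unfolding D_def using open_desing_domain by (rule borel_open)
  have hol_meas: "(\<lambda>\<tau>. f (T j \<tau>)) \<in> borel_measurable ?M"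
    if f: "f holomorphic_on D" and j: "j \<ge> Suc i" for f j
  proof -
    \<comment> \<open>Holomorphy is known on D only; cut off outside D the function is Borel
      measurable, and the tail sums never leave D.\<close>
    have fm: "(\<lambda>z. indicator D z *\<^sub>R f z) \<in> borel_measurable borel"
      by (rule borel_measurable_continuous_on_indicator[OF Dset holomorphic_on_imp_continuous_on[OF f]])
    have "(\<lambda>\<tau>. T j \<tau>) \<in> borel_measurable ?M"
      unfolding T_def using j
      by (intro borel_measurable_sum measurable_compose[OF _ reg_path_props(2)] measurable_compose[OF measurable_component_singleton]) auto
    from measurable_compose[OF this fm] show ?thesis using D[of j] j by simp
  qed
  have wm: "(\<lambda>\<tau>. reg_weight n (- of_nat (m k)) (\<tau> k)) \<in> borel_measurable ?M" if "k \<in> {Suc i..n}" for k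
    using that by (intro measurable_compose[OF _ reg_path_props(3)] measurable_compose[OF measurable_component_singleton]) auto
  have pc: "partial_chain n m i = (\<lambda>\<tau>. desing_taylor m i (T (Suc i) \<tau>) * (\<Prod>j=Suc i..n. desing_limit
      (T j \<tau>)) *
      (\<Prod>k=Suc i..n. reg_weight n (- of_nat (m k)) (\<tau> k)))"
    by (simp add: fun_eq_iff partial_chain_def T_def)
  have meas: "partial_chain n m i \<in> borel_measurable ?M"
    unfolding pc
    using desing_taylor_holomorphic desing_limit_holomorphic unfolding D_def[symmetric]
    by (intro borel_measurable_times borel_measurable_prod hol_meas wm) auto
  have ball: "cball 0 1 \<subseteq> D"
  proof
    fix z :: complex assume "z \<in> cball 0 1"
    then have "\<bar>Im z\<bar> \<le> 1" using abs_Im_le_cmod[of z] by simp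
    then show "z \<in> D" using pi_gt3 by (auto simp: D_def)
  qed
  have bounded: "\<exists>B>0. \<forall>z\<in>cball 0 1. norm (f z) \<le> B" if "f holomorphic_on D"
      for f :: "complex \<Rightarrow> complex"
  proof -
    have "continuous_on (cball 0 1) f"
      using that ball holomorphic_on_imp_continuous_on continuous_on_subset by metis
    then have "bounded (f ` cball 0 1)"
      by (intro compact_imp_bounded compact_continuous_image) auto
    then show ?thesis by (auto simp: bounded_pos)
  qed
  obtain B1 where B1: "B1 > 0" "\<And>z. z \<in> cball 0 1 \<Longrightarrow> norm (desing_taylor m i z) \<le> B1"
    using bounded[of "desing_taylor m i"] desing_taylor_holomorphic unfolding D_def by blast
  obtain B2 where B2: "B2 > 0" "\<And>z. z \<in> cball 0 1 \<Longrightarrow> norm (desing_limit z) \<le> B2"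
    using bounded[of desing_limit] desing_limit_holomorphic unfolding D_def by blast
  define W where "W = (\<lambda>\<tau>. \<Prod>k=Suc i..n. reg_weight n (- of_nat (m k)) (\<tau> k))"
  have bound: "norm (partial_chain n m i \<tau>) \<le> norm ((B1 * (\<Prod>j=Suc i..n. B2)) * W \<tau>)" for \<tau>
  proof (cases "\<forall>k\<in>{Suc i..n}. \<tau> k \<in> {0..1}")
    case True
    have T: "T j \<tau> \<in> cball 0 1" if "j \<ge> Suc i" for j
    proof -
      have "norm (T j \<tau>) \<le> real (card {j..n}) * (1 / (real n + 1))"
        unfolding T_def using True that by (intro sum_norm_bound reg_path_props) auto
      also have "\<dots> \<le> 1" using that by (simp add: field_simps)
      finally show ?thesis by simp
    qed
    have "norm (desing_taylor m i (T (Suc i) \<tau>)) * (\<Prod>j=Suc i..n. norm (desing_limit (T j \<tau>)))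
        \<le> B1 * (\<Prod>j=Suc i..n. B2)"
      using B1 B2 T by (intro mult_mono prod_mono prod_nonneg) (auto intro: less_imp_le)
    then have "norm (desing_taylor m i (T (Suc i) \<tau>)) * (\<Prod>j=Suc i..n. norm (desing_limit (T j \<tau>))) *
        norm (W \<tau>) \<le> B1 * (\<Prod>j=Suc i..n. B2) * norm (W \<tau>)"
      by (intro mult_right_mono) auto
    then show ?thesis
      using B1 B2 by (simp add: pc W_def norm_mult prod_norm[symmetric] norm_power abs_mult)
  next
    case False
    then obtain k where "k \<in> {Suc i..n}" "\<tau> k \<notin> {0..1}" by blast
    then have "W \<tau> = 0" unfolding W_def by (intro prod_zero) (auto simp: reg_weight_neg_nat)
    moreover have "partial_chain n m i \<tau> = desing_taylor m i (T (Suc i) \<tau>) *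
        (\<Prod>j=Suc i..n. desing_limit (T j \<tau>)) * W \<tau>"
      by (simp only: pc W_def)
    ultimately show ?thesis by simp
  qed
  have "integrable ?M W"
    unfolding W_def by (intro product_integrable_prod integrable_reg_weight_neg_nat) auto
  then have "integrable ?M (\<lambda>\<tau>. (B1 * (\<Prod>j=Suc i..n. B2)) * W \<tau>)"
    by simp
  then show ?thesis
    by (rule Bochner_Integration.integrable_bound[OF _ meas]) (rule AE_I2, rule bound)
qed

text \<open>The coordinate i + 1 enters \<open>desing_taylor m i\<close> and exactly one kernel
  factor, both through the same tail sum. Integrating it gives a derivative of their product at the
  sum of the later coordinates, which is the recursion of \<open>desing_taylor\<close>.\<close>

lemma partial_chain_step:
  assumes i: "Suc i \<le> n"
  shows "integral\<^sup>L (\<Pi>\<^sub>M k\<in>{Suc i..n}. lborel) (partial_chain n m i) =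
    (-1) ^ m (Suc i) * fact (m (Suc i)) * integral\<^sup>L (\<Pi>\<^sub>M k\<in>{Suc (Suc i)..n}. lborel)
        (partial_chain n m (Suc i))"
proof -
  let ?w = "\<lambda>k. reg_weight n (- of_nat (m k))" and ?p = "reg_path n"
  interpret product_sigma_finite "\<lambda>_::nat. lborel :: real measure"
    by (rule product_sigma_finite_lborel)
  define c where "c = Suc i"
  have ins: "{c..n} = insert c {Suc c..n}" using i by (auto simp: c_def)
  have "(\<integral>y. partial_chain n m i (\<tau>(c := y)) \<partial>lborel) = (-1) ^ m c * fact (m c) *
      partial_chain n m c \<tau>" for \<tau> :: "nat \<Rightarrow> real"
  proof -
    define v where "v = (\<Sum>k=Suc c..n. ?p (\<tau> k))"
    define d where "d = (\<Prod>j=Suc c..n. desing_limit (\<Sum>k=j..n. ?p (\<tau> k))) * (\<Prod>k=Suc c..n. ?w k (\<tau> k))"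
    define f where "f = (\<lambda>u. desing_limit u * desing_taylor m i u)"
    have sum: "(\<Sum>k=c..n. ?p ((\<tau>(c := y)) k)) = ?p y + v" for y
    proof -
      have "(\<Sum>k=c..n. ?p ((\<tau>(c := y)) k)) = ?p y + (\<Sum>k=Suc c..n. ?p ((\<tau>(c := y)) k))"
        unfolding ins by simp
      also have "(\<Sum>k=Suc c..n. ?p ((\<tau>(c := y)) k)) = v"
        unfolding v_def by (intro sum.cong) auto
      finally show ?thesis .
    qed
    have sum': "(\<Sum>k=j..n. ?p ((\<tau>(c := y)) k)) = (\<Sum>k=j..n. ?p (\<tau> k))" if "j \<in> {Suc c..n}" for j y
      using that by (intro sum.cong) auto
    have "partial_chain n m i (\<tau>(c := y)) = d * (f (?p y + v) * ?w c y)" for y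
    proof -
      have 1: "(\<Prod>j=c..n. desing_limit (\<Sum>k=j..n. ?p ((\<tau>(c := y)) k))) =
          desing_limit (?p y + v) * (\<Prod>j=Suc c..n. desing_limit (\<Sum>k=j..n. ?p (\<tau> k)))"
      proof -
        have "(\<Prod>j=c..n. desing_limit (\<Sum>k=j..n. ?p ((\<tau>(c := y)) k))) = desing_limit (\<Sum>k=c..n. ?p
            ((\<tau>(c := y)) k)) *
            (\<Prod>j=Suc c..n. desing_limit (\<Sum>k=j..n. ?p ((\<tau>(c := y)) k)))"
          using i by (intro prod.atLeast_Suc_atMost) (simp add: c_def)
        also have "(\<Prod>j=Suc c..n. desing_limit (\<Sum>k=j..n. ?p ((\<tau>(c := y)) k))) =
            (\<Prod>j=Suc c..n. desing_limit (\<Sum>k=j..n. ?p (\<tau> k)))"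
          by (intro prod.cong refl arg_cong[where f = desing_limit] sum')
        finally show ?thesis unfolding sum .
      qed
      have 2: "(\<Prod>k=c..n. ?w k ((\<tau>(c := y)) k)) =
          ?w c y * (\<Prod>k=Suc c..n. ?w k (\<tau> k))"
        using i by (subst prod.atLeast_Suc_atMost) (auto simp: c_def intro!: prod.cong)
      show ?thesis
        unfolding partial_chain_def c_def[symmetric] 1 2 sum d_def f_def by (simp only: mult_ac)
    qed
    then have "(\<integral>y. partial_chain n m i (\<tau>(c := y)) \<partial>lborel) = d * (\<integral>y. f (?p y + v) * ?w c y \<partial>lborel)"
      by (simp only: integral_mult_right_zero)
    also have "(\<integral>y. f (?p y + v) * ?w c y \<partial>lborel) = (-1) ^ m c * (deriv ^^ m c) (\<lambda>t. f (t + v)) 0"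
    proof (rule reg_functional_neg_nat)
      have v: "\<bar>Im v\<bar> \<le> 1"
        unfolding v_def by (intro in_strip_sum(1)[where n = n] reg_path_props) auto
      have R: "2 / (real n + 1) \<le> 1" using i by (simp add: field_simps)
      have "(\<lambda>t. t + v) ` ball 0 (2 / (real n + 1)) \<subseteq> kernel_strip"
      proof safe
        fix t :: complex assume t: "t \<in> ball 0 (2 / (real n + 1))"
        have "\<bar>Im t\<bar> \<le> 1" using t R abs_Im_le_cmod[of t] unfolding mem_ball dist_0_norm by linarith
        then have "\<bar>Im (t + v)\<bar> \<le> 2" using v by simp
        then show "\<bar>Im (t + v)\<bar> < 2 * pi" using pi_gt3 by linarith
      qed
      moreover have "f holomorphic_on kernel_strip"
        unfolding f_def by (intro holomorphic_intros desing_limit_holomorphic desing_taylor_holomorphic)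
      ultimately have "(f \<circ> (\<lambda>t. t + v)) holomorphic_on ball 0 (2 / (real n + 1))"
        by (intro holomorphic_on_compose_gen[of _ _ f] holomorphic_intros) auto
      then show "(\<lambda>t. f (t + v)) holomorphic_on ball 0 (2 / (real n + 1))" by (simp add: o_def)
    qed
    also have "(deriv ^^ m c) (\<lambda>t. f (t + v)) 0 = (deriv ^^ m c) f v"
      using higher_deriv_shift_0[of "m c" f v] by (simp add: o_def add.commute)
    also have "\<dots> = fact (m c) * desing_taylor m c v" by (simp add: c_def f_def)
    also have "d * ((-1) ^ m c * (fact (m c) * desing_taylor m c v)) = (-1) ^ m c * fact (m c) *
        partial_chain n m c \<tau>"
      by (simp add: partial_chain_def d_def v_def mult_ac)
    finally show ?thesis .
  qed
  moreover have "integral\<^sup>L (\<Pi>\<^sub>M k\<in>{c..n}. lborel) (partial_chain n m i) =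
      (\<integral>\<tau>. (\<integral>y. partial_chain n m i (\<tau>(c := y)) \<partial>lborel) \<partial>(\<Pi>\<^sub>M k\<in>{Suc c..n}. lborel))"
    using integrable_partial_chain[of i n m] unfolding c_def[symmetric] ins
        by (intro product_integral_insert) auto
  ultimately show ?thesis by (simp add: c_def)
qed

lemma zeta_reg_neg_nat:
  assumes "n \<ge> 1"
  shows "zeta_reg n (\<lambda>k. - of_nat (m k)) = (\<Prod>i=1..n. (-1) ^ m i * fact (m i)) *
      fps_nth (iterated_taylor desing_fps m n) 0"
proof -
  have "zeta_reg n (\<lambda>k. - of_nat (m k)) =
      (\<Prod>l=1..i. (-1) ^ m l * fact (m l)) * integral\<^sup>L (\<Pi>\<^sub>M k\<in>{Suc i..n}. lborel)
          (partial_chain n m i)" if "i \<le> n" for i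
    using that
  proof (induction i)
    case 0
    show ?case by (simp add: zeta_reg_def chain_def partial_chain_def[abs_def] chain_def[abs_def])
  next
    case (Suc i)
    then show ?case using partial_chain_step[of i n m] by (simp add: mult_ac)
  qed
  \<comment> \<open>The product measure over the empty index set is a unit point mass, and the empty
    tail sum is 0.\<close>
  from this[of n] have "zeta_reg n (\<lambda>k. - of_nat (m k)) = (\<Prod>l=1..n. (-1) ^ m l * fact (m l)) *
      desing_taylor m n 0"
    by (simp add: PiM_empty lebesgue_integral_count_space_finite partial_chain_def)
  moreover have "desing_taylor m n 0 = fps_nth (iterated_taylor desing_fps m n) 0"
    using has_fps_expansion_imp_0_eq_fps_nth_0[OF desing_taylor_has_fps_expansion] by simp
  ultimately show ?thesis by simp
qed

lemma Z_FKMT_eq: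
  assumes "n \<ge> 1"
  shows "Z_FKMT n = (\<Prod>i=1..n. mps_eval desing_fps (\<Sum>k=i..n. mps_var k))"
proof (rule mps_eqI)
  fix m
  \<comment> \<open>The signs and factorials of the values undo the weights of
    \<open>generating_series\<close>.\<close>
  have "(\<Prod>i=1..n. (-1) ^ k i / fact (k i) :: complex) * (\<Prod>i=1..n. (-1) ^ k i * fact (k i)) = 1"
      for k :: "nat \<Rightarrow> nat"
    unfolding prod.distrib[symmetric] by (rule prod.neutral) (simp flip: power_mult_distrib)
  then show "mps_coeff (Z_FKMT n) m = mps_coeff (\<Prod>i=1..n. mps_eval desing_fps (\<Sum>k=i..n. mps_var k)) m"
    unfolding mps_coeff_prod_eval Z_FKMT_def generating_series_def mps_coeff_Abs zeta_FKMT_eq[OF assms] zeta_reg_neg_nat[OF assms]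
    by (simp add: mult.assoc[symmetric])
qed

theorem theorem3p5:
  fixes n :: nat
  assumes "n \<ge> 1"
  shows "Z_EMS n =
    (\<Prod>i=1..n. mps_eval (Abs_fps (\<lambda>m. (- 1) ^ m / fact (m + 1))) (\<Sum>k=i..n. mps_var k))
    * mps_negate_vars (Z_FKMT n)"
  by (rule Z_EMS_eq_FKMT[OF desing_fps_eq Z_FKMT_eq[OF assms]])

end
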